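(* Let $P\subset\mathbb{P}^7$ be a fixed plane and let $W_P$ be a generic web of quadrics in $\mathbb{P}^7$ containing $P$ in its base locus. Let $BS(W_P)$ be the base locus of $W_P$ and let $Z'$ be the double cover of $\mathbb{P}^3$ branched along the determinant surface $D_{W_P}$. Then $BS(W_P)$ and $Z'$ are birational varieties.
   Context: Work over $\mathbb{C}$. A web of quadrics in $\mathbb{P}^7$ is a $4$-dimensional linear subspace $W=\langle Q_1,\dots,Q_4\rangle$ of the $36$-dimensional space of quadratic forms on $\mathbb{C}^8$ (identified with symmetric $8\times 8$ matrices); its members are $Q_\lambda=\lambda_1Q_1+\dots+\lambda_4Q_4$, $\lambda\in\mathbb{P}^3$, so $\mathbb{P}^3$ parametrizes the quadrics of $W$. The base locus $BS(W)$ is the common zero set $\{Q_1=\dots=Q_4=0\}\subset\mathbb{P}^7$. The determinant surface is $D_W=\{\lambda\in\mathbb{P}^3\mid \det(\lambda_1Q_1+\dots+\lambda_4Q_4)=0\}$, an octic surface parametrizing the degenerate quadrics of $W$. Webs containing a fixed plane $P$ in the base locus are the $4$-dimensional subspaces of the $30$-dimensional space of quadratic forms vanishing on $P$, parametrized by the Grassmannian $G(4,30)$; "generic $W_P$" means $W_P$ lies in a suitable nonempty Zariski open subset of this parameter space. *)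

theory Defs
  imports "HOL-Analysis.Analysis"
begin

inductive polyfn :: "('a \<Rightarrow> complex) set \<Rightarrow> ('a \<Rightarrow> complex) \<Rightarrow> bool" for C where
  pf_const: "polyfn C (\<lambda>_. c)"
| pf_coord: "f \<in> C \<Longrightarrow> polyfn C f"
| pf_add: "polyfn C f \<Longrightarrow> polyfn C g \<Longrightarrow> polyfn C (\<lambda>x. f x + g x)"
| pf_mult: "polyfn C f \<Longrightarrow> polyfn C g \<Longrightarrow> polyfn C (\<lambda>x. f x * g x)"

definition vcoords :: "(complex^'i \<Rightarrow> complex) set" where
  "vcoords = range (\<lambda>i x. x $ i)"

text \<open>A subset of the weighted projective space P(w) is represented by its affine cone
  (a scaling-invariant subset of complex^'i not containing 0).\<close>

definition wact :: "('i \<Rightarrow> nat) \<Rightarrow> complex \<Rightarrow> complex^'i \<Rightarrow> complex^'i" where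
  "wact w t x = (\<chi> i. t ^ w i * x $ i)"

definition wequiv :: "('i \<Rightarrow> nat) \<Rightarrow> complex^'i \<Rightarrow> complex^'i \<Rightarrow> bool" where
  "wequiv w x y \<longleftrightarrow> (\<exists>t. t \<noteq> 0 \<and> y = wact w t x)"

definition whom :: "('i \<Rightarrow> nat) \<Rightarrow> nat \<Rightarrow> (complex^'i \<Rightarrow> complex) \<Rightarrow> bool" where
  "whom w d f \<longleftrightarrow> polyfn vcoords f \<and> (\<forall>t x. t \<noteq> 0 \<longrightarrow> f (wact w t x) = t ^ d * f x)"

definition wopen_in :: "('i \<Rightarrow> nat) \<Rightarrow> (complex^'i) set \<Rightarrow> (complex^'i) set \<Rightarrow> bool" where
  "wopen_in w X U \<longleftrightarrow> (\<exists>F. (\<forall>f\<in>F. \<exists>d. whom w d f) \<and> U = X - {x. \<forall>f\<in>F. f x = 0})"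

definition wdense :: "('i \<Rightarrow> nat) \<Rightarrow> (complex^'i) set \<Rightarrow> (complex^'i) set \<Rightarrow> bool" where
  "wdense w X U \<longleftrightarrow> U \<subseteq> X \<and>
     (\<forall>f d. whom w d f \<and> (\<forall>x\<in>U. f x = 0) \<longrightarrow> (\<forall>x\<in>X. f x = 0))"

definition wmap :: "('i \<Rightarrow> nat) \<Rightarrow> ('j \<Rightarrow> nat) \<Rightarrow> (complex^'i \<Rightarrow> complex^'j) \<Rightarrow> bool" where
  "wmap w w' \<Phi> \<longleftrightarrow> (\<exists>e. \<forall>j. whom w (e * w' j) (\<lambda>x. \<Phi> x $ j))"

definition birational ::
  "('i \<Rightarrow> nat) \<Rightarrow> (complex^'i) set \<Rightarrow> ('j \<Rightarrow> nat) \<Rightarrow> (complex^'j) set \<Rightarrow> bool" where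
  "birational w X w' Y \<longleftrightarrow>
     (\<exists>U V \<Phi> \<Psi>. wopen_in w X U \<and> U \<noteq> {} \<and> wdense w X U \<and>
        wopen_in w' Y V \<and> V \<noteq> {} \<and> wdense w' Y V \<and>
        wmap w w' \<Phi> \<and> wmap w' w \<Psi> \<and>
        (\<forall>x\<in>U. \<Phi> x \<in> V \<and> wequiv w (\<Psi> (\<Phi> x)) x) \<and>
        (\<forall>y\<in>V. \<Psi> y \<in> U \<and> wequiv w' (\<Phi> (\<Psi> y)) y))"

definition qf :: "complex^8^8 \<Rightarrow> complex^8 \<Rightarrow> complex" where
  "qf A x = (\<Sum>i\<in>UNIV. \<Sum>j\<in>UNIV. x $ i * A $ i $ j * x $ j)"

definition pencil :: "complex^8^8^4 \<Rightarrow> complex^4 \<Rightarrow> complex^8^8" where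
  "pencil Q l = (\<chi> i j. \<Sum>k\<in>UNIV. l $ k * Q $ k $ i $ j)"

definition webs_on :: "complex^8 \<Rightarrow> complex^8 \<Rightarrow> complex^8 \<Rightarrow> (complex^8^8^4) set" where
  "webs_on p1 p2 p3 = {Q. (\<forall>k. transpose (Q $ k) = Q $ k) \<and>
      (\<forall>k a b c. qf (Q $ k) (a *s p1 + b *s p2 + c *s p3) = 0) \<and>
      (\<forall>l. pencil Q l = 0 \<longrightarrow> l = 0)}"

definition web_coords :: "(complex^8^8^4 \<Rightarrow> complex) set" where
  "web_coords = range (\<lambda>(k,i,j) Q. Q $ k $ i $ j)"

definition base_locus :: "complex^8^8^4 \<Rightarrow> (complex^8) set" where
  "base_locus Q = {x. x \<noteq> 0 \<and> (\<forall>k. qf (Q $ k) x = 0)}"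

text \<open>Weights (1,1,1,1,4) of the weighted projective space P(1,1,1,1,4) containing
  the double cover Z' = {w^2 = det(lambda_1 Q_1 + ... + lambda_4 Q_4)}.\<close>
definition wZ :: "5 \<Rightarrow> nat" where
  "wZ i = (if i = 4 then 4 else 1)"

definition zlam :: "complex^5 \<Rightarrow> complex^4" where
  "zlam x = (\<chi> k. if k = 0 then x $ 0 else if k = 1 then x $ 1 else if k = 2 then x $ 2 else x $ 3)"

definition double_cover :: "complex^8^8^4 \<Rightarrow> (complex^5) set" where
  "double_cover Q = {x. x \<noteq> 0 \<and> (x $ 4) ^ 2 = det (pencil Q (zlam x))}"

end

theory Submission
  imports Defs
begin

text \<open>Take \<open>P\<close> spanned by \<open>e\<^sub>0, e\<^sub>1, e\<^sub>2\<close>. For a general base point \<open>x\<close> exactly one quadric \<open>Q\<^sub>\<lambda>\<close> of the web contains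
  the space \<open>\<langle>P, x\<rangle>\<close>; \<open>\<lambda>\<close> is given by the \<open>3 \<times> 3\<close> minors of the matrix \<open>(Q\<^sub>k x)\<^sub>i\<close>, \<open>i < 3\<close>. Conversely a smooth
  \<open>Q\<^sub>\<lambda>\<close> contains two such spaces through \<open>P\<close>, namely the isotropic lines of the binary form that \<open>Q\<^sub>\<lambda>\<close>
  induces on the orthogonal of \<open>P\<close> modulo \<open>P\<close>; they are told apart by a square root of \<open>det Q\<^sub>\<lambda>\<close>, and the other
  quadrics of the web cut each of them in \<open>P\<close> and one further point \<open>x\<close>. This gives mutually inverse
  polynomial maps on the open sets \<open>hU \<noteq> 0\<close> and \<open>hV \<noteq> 0\<close>.

  It remains to see that these open sets are dense. On the double cover, multiply \<open>hV\<close> over the two sheets. On the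
  base locus, a dimension count (more polynomials than variables are algebraically dependent) shows that for a
  general web the base locus is smooth off \<open>P\<close>, and that every choice of four coordinates maps \<open>hU = 0\<close> into a
  hypersurface; near a smooth point some four coordinates parametrize the base locus, so it is not contained in
  \<open>hU = 0\<close>. General points of \<open>P\<close> are smooth as well, hence limits of points off \<open>P\<close>.\<close>

section \<open>Polynomial functions and algebraic dependence\<close>

text \<open>No irreducibility or dimension theory enters. Density is checked in the classical
  topology: a polynomial is continuous, so it vanishes at limits of its zeros. The obstacle is that
  a single base locus is not known to be irreducible, so one point with \<open>hU\<close> nonzero
  says nothing about its other parts. The argument therefore moves to the space of all pairs of a
  web and a base point. With one coordinate of the point set to 1, each quadric equation is solved
  for a diagonal entry of its matrix, so any two such pairs are joined by a polynomial curve, and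
  one pair with \<open>hU\<close> nonzero suffices. Four coordinates are taken because the affine
  cone over the threefold base locus has dimension 4.

  Genericity must end up as one nonzero polynomial in the entries of the web. Elimination is
  replaced by linear algebra on monomials, and the finitely many conditions multiply because the
  webs through \<open>P\<close> form a linear space, where nonzero polynomials are compared along a
  line.

  A square root of \<open>det\<close> separates the isotropic lines because the discriminant of the
  binary form is \<open>det\<close> times a square.\<close>

lemma polyfn_uminus: "polyfn C f \<Longrightarrow> polyfn C (\<lambda>z. - f z)"
  using pf_mult[OF pf_const[of C "-1"], of f] by simp

lemma polyfn_diff: "polyfn C f \<Longrightarrow> polyfn C g \<Longrightarrow> polyfn C (\<lambda>z. f z - g z)"
  using pf_add[OF _ polyfn_uminus, of C f g] by simp

lemma polyfn_sum: "(\<And>i. i \<in> I \<Longrightarrow> polyfn C (f i)) \<Longrightarrow> polyfn C (\<lambda>z. \<Sum>i\<in>I. f i z)"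
  by (induction I rule: infinite_finite_induct) (auto intro: pf_const pf_add)

lemma polyfn_prod: "(\<And>i. i \<in> I \<Longrightarrow> polyfn C (f i)) \<Longrightarrow> polyfn C (\<lambda>z. \<Prod>i\<in>I. f i z)"
  by (induction I rule: infinite_finite_induct) (auto intro: pf_const pf_mult)

lemma polyfn_power: "polyfn C f \<Longrightarrow> polyfn C (\<lambda>z. f z ^ n)"
  by (induction n) (auto intro: pf_const pf_mult)

lemmas polyfn_intros = pf_const pf_add pf_mult polyfn_uminus polyfn_diff polyfn_sum polyfn_prod
  polyfn_power

lemma polyfn_compose:
  assumes "polyfn C f" and "\<And>c. c \<in> C \<Longrightarrow> polyfn C' (\<lambda>z. c (g z))"
  shows "polyfn C' (\<lambda>z. f (g z))"
  using assms by (induction rule: polyfn.induct) (auto intro: polyfn_intros)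

lemma polyfn_mono: "polyfn C f \<Longrightarrow> C \<subseteq> C' \<Longrightarrow> polyfn C' f"
  using polyfn_compose[of C f C' "\<lambda>z. z"] by (auto intro: pf_coord)

text \<open>Shows that a polynomial in a reduced coordinate set ignores the omitted
  coordinates.\<close>

lemma polyfn_eqI:
  assumes "polyfn C f" and "\<And>c. c \<in> C \<Longrightarrow> c x = c y"
  shows "f x = f y"
  using assms by (induction rule: polyfn.induct) auto

lemma polyfn_along_curve:
  assumes "polyfn C f" and "\<And>c. c \<in> C \<Longrightarrow> \<exists>p. \<forall>t. c (\<gamma> t) = poly p t"
  shows "\<exists>p. \<forall>t. f (\<gamma> t) = poly p t"
  using assms
proof (induction rule: polyfn.induct)
  case (pf_const c)
  then show ?case by (intro exI[of _ "[:c:]"]) simp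
next
  case (pf_add f g)
  then obtain p q where "\<forall>t. f (\<gamma> t) = poly p t" "\<forall>t. g (\<gamma> t) = poly q t" by blast
  then show ?case by (intro exI[of _ "p + q"]) simp
next
  case (pf_mult f g)
  then obtain p q where "\<forall>t. f (\<gamma> t) = poly p t" "\<forall>t. g (\<gamma> t) = poly q t" by blast
  then show ?case by (intro exI[of _ "p * q"]) simp
qed blast

lemma polyfn_vcoord: "polyfn vcoords (\<lambda>x. x $ i)"
  by (rule pf_coord) (auto simp: vcoords_def)

lemma polyfn_web_coord: "polyfn web_coords (\<lambda>Q. Q $ k $ i $ j)"
  by (rule pf_coord) (unfold web_coords_def, rule range_eqI[of _ _ "(k, i, j)"], simp)

lemma continuous_polyfn_vcoords:
  assumes "polyfn vcoords f"
  shows "continuous_on UNIV f"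
  using assms by (induction rule: polyfn.induct) (auto simp: vcoords_def intro!: continuous_intros)

text \<open>The product is a nonzero polynomial with finitely many roots. This stands in for the
  irreducibility of a curve joining two points.\<close>

lemma poly_nonzero_avoid_finite:
  fixes p q :: "complex poly"
  assumes "poly p a \<noteq> 0" "poly q b \<noteq> 0"
  shows "\<exists>t. poly p t \<noteq> 0 \<and> poly q t \<noteq> 0"
proof -
  have "p * q \<noteq> 0" using assms by auto
  then have "finite {t. poly (p * q) t = 0}" by (rule poly_roots_finite)
  then have "{t. poly (p * q) t = 0} \<noteq> UNIV" using infinite_UNIV_char_0 by metis
  then show ?thesis by auto
qed

lemma poly_nonzero_near_0:
  fixes p :: "complex poly"
  assumes "poly p a \<noteq> 0" "\<epsilon> > 0"
  shows "\<exists>t. norm t < \<epsilon> \<and> poly p t \<noteq> 0"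
proof -
  have "p \<noteq> 0" using assms by auto
  then have fin: "finite {t. poly p t = 0}" by (rule poly_roots_finite)
  have "infinite (ball (0::complex) \<epsilon>)"
    using \<open>\<epsilon> > 0\<close> by (simp add: uncountable_ball uncountable_infinite)
  then have "\<not> ball 0 \<epsilon> \<subseteq> {t. poly p t = 0}" using fin finite_subset by blast
  then show ?thesis by (auto simp: dist_norm)
qed

text \<open>On an incidence variety \<open>Z\<close> the eliminated coordinates become polynomials
  in the remaining set \<open>C\<close> only after restriction to \<open>Z\<close>.\<close>

definition polyfn_on :: "'a set \<Rightarrow> ('a \<Rightarrow> complex) set \<Rightarrow> ('a \<Rightarrow> complex) \<Rightarrow> bool" where
  "polyfn_on Z C f \<longleftrightarrow> (\<exists>g. polyfn C g \<and> (\<forall>z\<in>Z. f z = g z))"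

lemma polyfn_onI: "polyfn C f \<Longrightarrow> polyfn_on Z C f"
  by (auto simp: polyfn_on_def)

lemma polyfn_on_cong: "polyfn_on Z C f \<Longrightarrow> (\<And>z. z \<in> Z \<Longrightarrow> f' z = f z) \<Longrightarrow> polyfn_on Z C f'"
  by (auto simp: polyfn_on_def)

lemma polyfn_on_const: "polyfn_on Z C (\<lambda>_. c)"
  by (intro polyfn_onI pf_const)

lemma polyfn_on_add: "polyfn_on Z C f \<Longrightarrow> polyfn_on Z C g \<Longrightarrow> polyfn_on Z C (\<lambda>z. f z + g z)"
  unfolding polyfn_on_def by (elim exE conjE, rule exI, rule conjI, erule (1) pf_add) simp

lemma polyfn_on_mult: "polyfn_on Z C f \<Longrightarrow> polyfn_on Z C g \<Longrightarrow> polyfn_on Z C (\<lambda>z. f z * g z)"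
  unfolding polyfn_on_def by (elim exE conjE, rule exI, rule conjI, erule (1) pf_mult) simp

lemma polyfn_on_uminus: "polyfn_on Z C f \<Longrightarrow> polyfn_on Z C (\<lambda>z. - f z)"
  unfolding polyfn_on_def by (elim exE conjE, rule exI, rule conjI, erule polyfn_uminus) simp

lemma polyfn_on_diff: "polyfn_on Z C f \<Longrightarrow> polyfn_on Z C g \<Longrightarrow> polyfn_on Z C (\<lambda>z. f z - g z)"
  unfolding polyfn_on_def by (elim exE conjE, rule exI, rule conjI, erule (1) polyfn_diff) simp

lemma polyfn_on_sum: "(\<And>i. i \<in> I \<Longrightarrow> polyfn_on Z C (f i)) \<Longrightarrow> polyfn_on Z C (\<lambda>z. \<Sum>i\<in>I. f i z)"
  by (induction I rule: infinite_finite_induct) (auto intro: polyfn_on_const polyfn_on_add)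

lemmas polyfn_on_intros = polyfn_on_const polyfn_on_add polyfn_on_mult polyfn_on_uminus
  polyfn_on_diff polyfn_on_sum

lemma polyfn_on_compose:
  assumes "polyfn C f" and "\<And>c. c \<in> C \<Longrightarrow> polyfn_on Z C' (\<lambda>z. c (g z))"
  shows "polyfn_on Z C' (\<lambda>z. f (g z))"
  using assms by (induction rule: polyfn.induct) (auto intro: polyfn_on_intros)

section \<open>Spans of monomials\<close>

text \<open>An inductive span makes sums and products provable by induction;
  \<open>lspan_finite\<close> recovers explicit coefficients once they are needed.\<close>

inductive lspan :: "('a \<Rightarrow> complex) set \<Rightarrow> ('a \<Rightarrow> complex) \<Rightarrow> bool" for M where
  lspan_zero: "lspan M (\<lambda>_. 0)"
| lspan_add: "lspan M f \<Longrightarrow> m \<in> M \<Longrightarrow> lspan M (\<lambda>z. a * m z + f z)"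

lemma lspan_finite:
  assumes "lspan M f" "finite M"
  shows "\<exists>a. \<forall>z. f z = (\<Sum>m\<in>M. a m * m z)"
  using assms
proof (induction rule: lspan.induct)
  case lspan_zero
  then show ?case by (intro exI[of _ "\<lambda>_. 0"]) simp
next
  case (lspan_add f m b)
  then obtain a where a: "\<forall>z. f z = (\<Sum>m\<in>M. a m * m z)" by blast
  have "(\<Sum>m'\<in>M. ((if m' = m then b else 0) + a m') * m' z)
      = (\<Sum>m'\<in>M. if m' = m then b * m' z else 0) + (\<Sum>m'\<in>M. a m' * m' z)" for z
    unfolding sum.distrib[symmetric] by (intro sum.cong) (auto simp: distrib_right)
  then have "\<forall>z. b * m z + f z = (\<Sum>m'\<in>M. ((if m' = m then b else 0) + a m') * m' z)"
    using a lspan_add.hyps lspan_add.prems by simp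
  then show ?case by (rule exI[of _ "\<lambda>m'. (if m' = m then b else 0) + a m'"])
qed

lemma lspan_plus: "lspan M f \<Longrightarrow> lspan M g \<Longrightarrow> lspan M (\<lambda>z. f z + g z)"
proof (induction rule: lspan.induct)
  case (lspan_add f m a)
  then show ?case using lspan.lspan_add[of M "\<lambda>z. f z + g z" m a] by (simp add: add.assoc)
qed simp

lemma lspan_base: "m \<in> M \<Longrightarrow> lspan M (\<lambda>z. a * m z)"
  using lspan_add[OF lspan_zero, of m M a] by simp

lemma lspan_mult:
  assumes "lspan M f" "lspan M' g" and MM: "\<And>m m'. m \<in> M \<Longrightarrow> m' \<in> M' \<Longrightarrow> (\<lambda>z. m z * m' z) \<in> M''"
  shows "lspan M'' (\<lambda>z. f z * g z)"
  using assms(1)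
proof (induction rule: lspan.induct)
  case lspan_zero
  then show ?case by (simp add: lspan.lspan_zero)
next
  case (lspan_add f m a)
  have "lspan M'' (\<lambda>z. a * m z * g z)"
    using assms(2)
  proof (induction rule: lspan.induct)
    case lspan_zero
    then show ?case by (simp add: lspan.lspan_zero)
  next
    case (lspan_add g m' b)
    then show ?case
      using lspan.lspan_add[OF lspan_add.IH MM[OF \<open>m \<in> M\<close> \<open>m' \<in> M'\<close>], of "a * b"]
      by (simp add: algebra_simps)
  qed
  from lspan_plus[OF this lspan_add.IH] show ?case by (simp add: algebra_simps)
qed

text \<open>The bound is on each exponent, not on the total degree, so the exponent vectors number
  exactly \<open>(d + 1) ^ card C\<close>. Monomials are functions and may coincide, hence only an
  upper bound on their number.\<close>

definition monomials :: "('a \<Rightarrow> complex) set \<Rightarrow> nat \<Rightarrow> ('a \<Rightarrow> complex) set" where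
  "monomials C d = (\<lambda>\<beta> z. \<Prod>c\<in>C. c z ^ \<beta> c) ` (C \<rightarrow>\<^sub>E {..d})"

lemma finite_monomials: "finite C \<Longrightarrow> finite (monomials C d)"
  by (simp add: monomials_def finite_PiE)

lemma card_monomials: "finite C \<Longrightarrow> card (monomials C d) \<le> (d + 1) ^ card C"
  unfolding monomials_def
  by (rule order_trans[OF card_image_le]) (simp_all add: finite_PiE card_PiE)

lemma monomialsI: "finite C \<Longrightarrow> (\<And>c. c \<in> C \<Longrightarrow> \<beta> c \<le> d) \<Longrightarrow> (\<lambda>z. \<Prod>c\<in>C. c z ^ \<beta> c) \<in> monomials C d"
  unfolding monomials_def by (rule image_eqI[of _ _ "restrict \<beta> C"]) (auto cong: prod.cong)

lemma lspan_monomials_mult: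
  assumes "finite C" "lspan (monomials C d) f" "lspan (monomials C e) g"
  shows "lspan (monomials C (d + e)) (\<lambda>z. f z * g z)"
proof (rule lspan_mult[OF assms(2,3)])
  fix m m' assume "m \<in> monomials C d" "m' \<in> monomials C e"
  then obtain \<beta> \<beta>' where b: "m = (\<lambda>z. \<Prod>c\<in>C. c z ^ \<beta> c)" "m' = (\<lambda>z. \<Prod>c\<in>C. c z ^ \<beta>' c)"
    "\<beta> \<in> C \<rightarrow>\<^sub>E {..d}" "\<beta>' \<in> C \<rightarrow>\<^sub>E {..e}"
    by (auto simp: monomials_def)
  have "(\<lambda>z. \<Prod>c\<in>C. c z ^ (\<beta> c + \<beta>' c)) \<in> monomials C (d + e)"
    using b by (intro monomialsI assms) (auto intro!: add_mono)
  then show "(\<lambda>z. m z * m' z) \<in> monomials C (d + e)"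
    by (simp add: b power_add prod.distrib)
qed

lemma monomials_mono: "d \<le> e \<Longrightarrow> monomials C d \<subseteq> monomials C e"
  unfolding monomials_def by (intro image_mono PiE_mono) auto

lemma lspan_mono: "lspan M f \<Longrightarrow> M \<subseteq> M' \<Longrightarrow> lspan M' f"
  by (induction rule: lspan.induct) (auto intro: lspan.intros)

lemma one_in_monomials: "finite C \<Longrightarrow> (\<lambda>_. 1) \<in> monomials C d"
  using monomialsI[of C "\<lambda>_. 0" d] by simp

lemma polyfn_lspan_monomials:
  assumes "polyfn C f" "finite C"
  shows "\<exists>d. lspan (monomials C d) f"
  using assms
proof (induction rule: polyfn.induct)
  case (pf_const a)
  show ?case using lspan_base[OF one_in_monomials[OF \<open>finite C\<close>], of 0 a] by auto
next
  case (pf_coord f)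
  have "(\<Prod>c\<in>C. c z ^ (if c = f then 1 else 0)) = (\<Prod>c\<in>C. if c = f then c z else 1)" for z
    by (intro prod.cong) auto
  also have "(\<Prod>c\<in>C. if c = f then c z else 1) = f z" for z
    using pf_coord by simp
  finally have "f = (\<lambda>z. \<Prod>c\<in>C. c z ^ (if c = f then 1 else 0))" by auto
  moreover have "(\<lambda>z. \<Prod>c\<in>C. c z ^ (if c = f then 1 else 0)) \<in> monomials C 1"
    by (rule monomialsI) (use pf_coord in auto)
  ultimately have "f \<in> monomials C 1" by simp
  then show ?case using lspan_base[of f "monomials C 1" 1] by auto
next
  case (pf_add f g)
  then obtain d e where "lspan (monomials C d) f" "lspan (monomials C e) g" by blast
  then have "lspan (monomials C (d + e)) f" "lspan (monomials C (d + e)) g"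
    using lspan_mono[OF _ monomials_mono] le_add1 le_add2 by blast+
  then show ?case using lspan_plus by blast
next
  case (pf_mult f g)
  then show ?case using lspan_monomials_mult by blast
qed

section \<open>Algebraic relations by counting monomials\<close>

text \<open>Gaussian elimination: an equation with a nonzero coefficient at \<open>e0\<close> is
  solved for the unknown \<open>e0\<close> and substituted into the others, leaving one equation and
  one unknown fewer.\<close>

lemma homogeneous_system_nontrivial:
  fixes a :: "'e \<Rightarrow> 'b \<Rightarrow> complex"
  assumes "finite B" "finite E" "card B < card E"
  shows "\<exists>c. (\<exists>e\<in>E. c e \<noteq> 0) \<and> (\<forall>b\<in>B. (\<Sum>e\<in>E. a e b * c e) = 0)"
  using assms
proof (induction B arbitrary: E a rule: finite_induct)
  case empty
  then obtain e where "e \<in> E" by fastforce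
  then show ?case by (intro exI[of _ "\<lambda>_. 1"]) auto
next
  case (insert b B)
  show ?case
  proof (cases "\<forall>e\<in>E. a e b = 0")
    case True
    obtain c where "\<exists>e\<in>E. c e \<noteq> 0" "\<forall>b\<in>B. (\<Sum>e\<in>E. a e b * c e) = 0"
      using insert.IH[OF insert.prems(1), of a] insert.prems(2) insert.hyps by (metis card_insert_disjoint Suc_lessD)
    then show ?thesis using True by (intro exI[of _ c]) auto
  next
    case False
    then obtain e0 where e0: "e0 \<in> E" "a e0 b \<noteq> 0" by blast
    define E' where "E' = E - {e0}"
    have E: "E = insert e0 E'" "e0 \<notin> E'" "finite E'" using e0 insert by (auto simp: E'_def)
    have cd: "card B < card E'" using insert.prems insert.hyps E by simp
    obtain c where c: "\<exists>e\<in>E'. c e \<noteq> 0"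
      "\<forall>b'\<in>B. (\<Sum>e\<in>E'. (a e b' - a e b / a e0 b * a e0 b') * c e) = 0"
      using insert.IH[OF E(3), of "\<lambda>e b'. a e b' - a e b / a e0 b * a e0 b'"] cd by blast
    define c' where "c' = c(e0 := - (\<Sum>e\<in>E'. a e b * c e) / a e0 b)"
    have c': "(\<Sum>e\<in>E. a e b' * c' e) = (\<Sum>e\<in>E'. a e b' * c e) - a e0 b' * (\<Sum>e\<in>E'. a e b * c e) / a e0 b" for b'
    proof -
      have "(\<Sum>e\<in>E'. a e b' * c' e) = (\<Sum>e\<in>E'. a e b' * c e)"
        using E by (intro sum.cong) (auto simp: c'_def)
      then show ?thesis using E by (simp add: c'_def)
    qed
    have "(\<Sum>e\<in>E. a e b' * c' e) = 0" if "b' \<in> insert b B" for b'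
    proof (cases "b' = b")
      case True
      then show ?thesis using e0 by (simp add: c')
    next
      case False
      then have "0 = (\<Sum>e\<in>E'. (a e b' - a e b / a e0 b * a e0 b') * c e)" using c that by auto
      also have "\<dots> = (\<Sum>e\<in>E'. a e b' * c e) - (\<Sum>e\<in>E'. (a e0 b' / a e0 b) * (a e b * c e))"
        unfolding sum_subtractf[symmetric] by (intro sum.cong) (auto simp: field_simps)
      finally show ?thesis unfolding c' sum_distrib_left[symmetric] by simp
    qed
    moreover have "\<exists>e\<in>E. c' e \<noteq> 0" using c E by (auto simp: c'_def)
    ultimately show ?thesis by blast
  qed
qed

definition multipoly :: "'j set \<Rightarrow> nat \<Rightarrow> (('j \<Rightarrow> nat) \<Rightarrow> complex) \<Rightarrow> ('j \<Rightarrow> complex) \<Rightarrow> complex" where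
  "multipoly J N c v = (\<Sum>\<alpha>\<in>J \<rightarrow>\<^sub>E {..N}. c \<alpha> * (\<Prod>j\<in>J. v j ^ \<alpha> j))"

text \<open>Counting monomials of bounded degree: the powers of the \<open>\<phi> j\<close> outgrow the monomials in \<open>C\<close>.\<close>

lemma algebraic_relation:
  assumes "finite C" "finite J" "card C < card J" "\<And>j. j \<in> J \<Longrightarrow> polyfn_on Z C (\<phi> j)"
  shows "\<exists>N c. (\<exists>\<alpha>\<in>J \<rightarrow>\<^sub>E {..N}. c \<alpha> \<noteq> 0) \<and> (\<forall>z\<in>Z. multipoly J N c (\<lambda>j. \<phi> j z) = 0)"
proof -
  obtain \<psi> where \<psi>: "\<And>j. j \<in> J \<Longrightarrow> polyfn C (\<psi> j)" "\<And>j z. j \<in> J \<Longrightarrow> z \<in> Z \<Longrightarrow> \<phi> j z = \<psi> j z"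
    using assms(4) unfolding polyfn_on_def by metis
  obtain d where d: "\<And>j. j \<in> J \<Longrightarrow> lspan (monomials C (d j)) (\<psi> j)"
    using polyfn_lspan_monomials[OF \<psi>(1) \<open>finite C\<close>] by metis
  \<comment> \<open>Products with all exponents at most \<open>N\<close> then lie in the span of
    \<open>monomials C (K * N)\<close>; the \<open>+ 1\<close> gives
    \<open>K * N + 1 \<le> K * (N + 1)\<close> below.\<close>
  define K where "K = (\<Sum>j\<in>J. d j) + 1"
  have pow: "lspan (monomials C (n * d j)) (\<lambda>z. \<psi> j z ^ n)" if "j \<in> J" for j n
  proof (induction n)
    case 0
    then show ?case using lspan_base[OF one_in_monomials[OF \<open>finite C\<close>], of 0 1] by simp
  next
    case (Suc n)
    then show ?case using lspan_monomials_mult[OF \<open>finite C\<close> d[OF that] Suc] by simp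
  qed
  have prd: "lspan (monomials C (\<Sum>j\<in>J'. \<alpha> j * d j)) (\<lambda>z. \<Prod>j\<in>J'. \<psi> j z ^ \<alpha> j)" if "J' \<subseteq> J" for J' \<alpha>
    using finite_subset[OF that \<open>finite J\<close>] that
  proof (induction J' rule: finite_induct)
    case empty
    then show ?case using lspan_base[OF one_in_monomials[OF \<open>finite C\<close>], of 0 1] by simp
  next
    case (insert j J')
    then show ?case using lspan_monomials_mult[OF \<open>finite C\<close> pow] by simp
  qed
  \<comment> \<open>Chosen so that \<open>(K * (N + 1)) ^ card C = N * (N + 1) ^ card C\<close>,
    which is just below \<open>(N + 1) ^ Suc (card C)\<close>: more products than monomials.\<close>
  define N where "N = K ^ card C"
  define B where "B = monomials C (K * N)"
  have finB: "finite B" using \<open>finite C\<close> by (simp add: B_def finite_monomials)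
  have in_span: "lspan B (\<lambda>z. \<Prod>j\<in>J. \<psi> j z ^ \<alpha> j)" if "\<alpha> \<in> J \<rightarrow>\<^sub>E {..N}" for \<alpha>
  proof -
    have "(\<Sum>j\<in>J. \<alpha> j * d j) \<le> (\<Sum>j\<in>J. N * d j)"
      using that by (intro sum_mono mult_right_mono) auto
    also have "\<dots> \<le> K * N" by (simp add: K_def sum_distrib_left algebra_simps)
    finally show ?thesis unfolding B_def using lspan_mono[OF prd[OF order_refl] monomials_mono] by blast
  qed
  have "\<exists>a. \<forall>\<alpha>\<in>J \<rightarrow>\<^sub>E {..N}. \<forall>z. (\<Prod>j\<in>J. \<psi> j z ^ \<alpha> j) = (\<Sum>m\<in>B. a \<alpha> m * m z)"
    using lspan_finite[OF in_span finB] by (intro bchoice) blast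
  then obtain a where a: "\<And>\<alpha> z. \<alpha> \<in> J \<rightarrow>\<^sub>E {..N} \<Longrightarrow> (\<Prod>j\<in>J. \<psi> j z ^ \<alpha> j) = (\<Sum>m\<in>B. a \<alpha> m * m z)"
    by blast
  have "card B \<le> (K * N + 1) ^ card C" unfolding B_def by (rule card_monomials[OF \<open>finite C\<close>])
  also have "\<dots> \<le> (K * (N + 1)) ^ card C" by (intro power_mono) (auto simp: K_def)
  also have "\<dots> = N * (N + 1) ^ card C" by (simp only: power_mult_distrib N_def)
  also have "\<dots> < (N + 1) ^ Suc (card C)" by simp
  also have "\<dots> \<le> (N + 1) ^ card J" using assms(3) by (intro power_increasing) auto
  also have "\<dots> = card (J \<rightarrow>\<^sub>E {..N})" using \<open>finite J\<close> by (simp add: card_PiE)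
  finally obtain c where c: "\<exists>\<alpha>\<in>J \<rightarrow>\<^sub>E {..N}. c \<alpha> \<noteq> 0"
    "\<forall>m\<in>B. (\<Sum>\<alpha>\<in>J \<rightarrow>\<^sub>E {..N}. a \<alpha> m * c \<alpha>) = 0"
    using homogeneous_system_nontrivial[of B "J \<rightarrow>\<^sub>E {..N}" a] finB \<open>finite J\<close> by (auto simp: finite_PiE)
  have "multipoly J N c (\<lambda>j. \<phi> j z) = 0" if "z \<in> Z" for z
  proof -
    have "multipoly J N c (\<lambda>j. \<phi> j z) = (\<Sum>\<alpha>\<in>J \<rightarrow>\<^sub>E {..N}. \<Sum>m\<in>B. c \<alpha> * (a \<alpha> m * m z))"
      unfolding multipoly_def using \<psi>(2)[OF _ that] a
      by (intro sum.cong) (auto simp: sum_distrib_left[symmetric] cong: prod.cong)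
    also have "\<dots> = (\<Sum>m\<in>B. (\<Sum>\<alpha>\<in>J \<rightarrow>\<^sub>E {..N}. a \<alpha> m * c \<alpha>) * m z)"
      by (subst sum.swap) (simp add: sum_distrib_left mult_ac)
    also have "\<dots> = 0" using c by simp
    finally show ?thesis .
  qed
  then show ?thesis using c by blast
qed

lemma multipoly_insert:
  assumes "finite J" "i \<notin> J"
  shows "multipoly (insert i J) N c v = (\<Sum>n\<le>N. v i ^ n * multipoly J N (\<lambda>\<alpha>. c (\<alpha>(i := n))) v)"
proof -
  have inj: "inj_on (\<lambda>(n, \<alpha>). \<alpha>(i := n)) ({..N} \<times> (J \<rightarrow>\<^sub>E {..N}))"
    using inj_combinator[OF assms(2), of "\<lambda>_. {..N}"] .
  have "multipoly (insert i J) N c v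
      = (\<Sum>(n, \<alpha>)\<in>{..N} \<times> (J \<rightarrow>\<^sub>E {..N}). c (\<alpha>(i := n)) * (\<Prod>j\<in>insert i J. v j ^ (\<alpha>(i := n)) j))"
    unfolding multipoly_def PiE_insert_eq
    by (subst sum.reindex[OF inj]) (simp add: case_prod_unfold)
  also have "\<dots> = (\<Sum>n\<le>N. \<Sum>\<alpha>\<in>J \<rightarrow>\<^sub>E {..N}. c (\<alpha>(i := n)) * (\<Prod>j\<in>insert i J. v j ^ (\<alpha>(i := n)) j))"
    by (simp add: sum.cartesian_product)
  also have "\<dots> = (\<Sum>n\<le>N. v i ^ n * multipoly J N (\<lambda>\<alpha>. c (\<alpha>(i := n))) v)"
  proof (intro sum.cong refl)
    fix n
    have "(\<Prod>j\<in>insert i J. v j ^ (\<alpha>(i := n)) j) = v i ^ n * (\<Prod>j\<in>J. v j ^ \<alpha> j)" for \<alpha>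
      using assms by (simp, intro disjI2 prod.cong) auto
    then show "(\<Sum>\<alpha>\<in>J \<rightarrow>\<^sub>E {..N}. c (\<alpha>(i := n)) * (\<Prod>j\<in>insert i J. v j ^ (\<alpha>(i := n)) j))
        = v i ^ n * multipoly J N (\<lambda>\<alpha>. c (\<alpha>(i := n))) v"
      by (simp add: multipoly_def sum_distrib_left mult_ac)
  qed
  finally show ?thesis .
qed

lemma multipoly_cong: "(\<And>j. j \<in> J \<Longrightarrow> v j = v' j) \<Longrightarrow> multipoly J N c v = multipoly J N c v'"
  unfolding multipoly_def by (intro sum.cong refl) (simp cong: prod.cong)

text \<open>Induction on the variables: with suitable values of the others, the polynomial in the
  new variable has a nonzero coefficient and hence a non-root.\<close>

lemma multipoly_nonzero:
  assumes "finite J" "\<alpha> \<in> J \<rightarrow>\<^sub>E {..N}" "c \<alpha> \<noteq> 0"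
  shows "\<exists>v. multipoly J N c v \<noteq> 0"
  using assms
proof (induction J arbitrary: \<alpha> c rule: finite_induct)
  case empty
  then show ?case by (simp add: multipoly_def)
next
  case (insert i J)
  from insert.prems(1) obtain n \<beta> where b: "\<beta> \<in> J \<rightarrow>\<^sub>E {..N}" "n \<le> N" "\<alpha> = \<beta>(i := n)"
    by (auto simp: PiE_insert_eq)
  then obtain v where v: "multipoly J N (\<lambda>\<alpha>. c (\<alpha>(i := n))) v \<noteq> 0"
    using insert.IH[OF b(1), of "\<lambda>\<alpha>. c (\<alpha>(i := n))"] insert.prems(2) unfolding b(3) by blast
  define p where "p = (\<Sum>n\<le>N. monom (multipoly J N (\<lambda>\<alpha>. c (\<alpha>(i := n))) v) n)"
  have "coeff p n \<noteq> 0" using v b(2) by (simp add: p_def coeff_sum)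
  then have "p \<noteq> 0" by auto
  then obtain t where t: "poly p t \<noteq> 0"
    using poly_all_0_iff_0 by blast
  have "multipoly (insert i J) N c (v(i := t)) = poly p t"
  proof -
    have "multipoly J N c' (v(i := t)) = multipoly J N c' v" for c'
      using insert.hyps by (intro multipoly_cong) auto
    then show ?thesis
      unfolding multipoly_insert[OF insert.hyps]
      by (simp add: p_def poly_sum poly_monom mult.commute)
  qed
  then show ?case using t by metis
qed

lemma polyfn_multipoly:
  assumes "\<And>j. j \<in> J \<Longrightarrow> polyfn C (\<phi> j)"
  shows "polyfn C (\<lambda>z. multipoly J N c (\<lambda>j. \<phi> j z))"
  unfolding multipoly_def by (intro polyfn_intros assms)

text \<open>Apply the relation to the \<open>\<phi> j\<close> together with \<open>h\<close>, and cancel the largest power of \<open>h\<close>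
  dividing it: what remains is nontrivial after setting \<open>h = 0\<close>.\<close>

lemma algebraic_relation_on_hypersurface:
  assumes "finite C" "finite J" "card C \<le> card J"
    and \<phi>: "\<And>j. j \<in> J \<Longrightarrow> polyfn_on Z C (\<phi> j)" and h: "polyfn_on Z C h"
    and zs: "zs \<in> Z" "h zs \<noteq> 0"
    and conn: "\<And>z. z \<in> Z \<Longrightarrow> \<exists>\<gamma>. \<gamma> 0 = z \<and> \<gamma> 1 = zs \<and> (\<forall>t. \<gamma> t \<in> Z) \<and>
      (\<forall>c\<in>C. \<exists>p. \<forall>t. c (\<gamma> t) = poly p t)"
  shows "\<exists>N c. (\<exists>v. multipoly J N c v \<noteq> 0) \<and>
    (\<forall>z\<in>Z. h z = 0 \<longrightarrow> multipoly J N c (\<lambda>j. \<phi> j z) = 0)"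
proof -
  \<comment> \<open>\<open>None\<close> marks the extra function \<open>h\<close>, so that splitting
    it off by \<open>multipoly_insert\<close> expands the relation in powers of
    \<open>h\<close>.\<close>
  define J' where "J' = insert None (Some ` J)"
  define \<phi>' where "\<phi>' = (\<lambda>i. case i of None \<Rightarrow> h | Some j \<Rightarrow> \<phi> j)"
  have J': "finite J'" "card C < card J'" "finite (Some ` J)" "None \<notin> Some ` J"
    using assms(2,3) by (auto simp: J'_def card_image)
  have "polyfn_on Z C (\<phi>' j)" if "j \<in> J'" for j
    using that \<phi> h by (auto simp: J'_def \<phi>'_def)
  then obtain N c where c: "\<exists>\<alpha>\<in>J' \<rightarrow>\<^sub>E {..N}. c \<alpha> \<noteq> 0" "\<And>z. z \<in> Z \<Longrightarrow> multipoly J' N c (\<lambda>j. \<phi>' j z) = 0"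
    using algebraic_relation[OF assms(1) J'(1,2), of Z \<phi>'] by blast
  define S where "S n v = multipoly (Some ` J) N (\<lambda>\<alpha>. c (\<alpha>(None := n))) v" for n v
  have rel: "(\<Sum>n\<le>N. h z ^ n * S n (\<lambda>j. \<phi>' j z)) = 0" if "z \<in> Z" for z
    using c(2)[OF that] unfolding J'_def multipoly_insert[OF J'(3,4)] S_def by (simp add: \<phi>'_def)
  define good where "good n \<longleftrightarrow> n \<le> N \<and> (\<exists>\<alpha>\<in>Some ` J \<rightarrow>\<^sub>E {..N}. c (\<alpha>(None := n)) \<noteq> 0)" for n
  have "\<exists>n. good n" using c(1) unfolding good_def J'_def PiE_insert_eq by auto
  then obtain e where e: "good e" "\<And>n. n < e \<Longrightarrow> \<not> good n"
    using LeastI_ex[of good] not_less_Least[of _ good] by blast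
  have eN: "e \<le> N" using e(1) by (simp add: good_def)
  have low: "S n v = 0" if "n < e" for n v
    using e(2)[OF that] eN that unfolding S_def multipoly_def good_def by auto
  have cancel: "(\<Sum>n=e..N. h z ^ (n - e) * S n (\<lambda>j. \<phi>' j z)) = 0" if "z \<in> Z" "h z \<noteq> 0" for z
  proof -
    have "0 = (\<Sum>n\<in>{e..N}. h z ^ n * S n (\<lambda>j. \<phi>' j z))"
      unfolding rel[OF that(1), symmetric] by (rule sum.mono_neutral_right) (auto simp: low)
    also have "\<dots> = h z ^ e * (\<Sum>n=e..N. h z ^ (n - e) * S n (\<lambda>j. \<phi>' j z))"
      unfolding sum_distrib_left by (intro sum.cong) (auto simp: power_add[symmetric] mult.assoc[symmetric])
    finally show ?thesis using that by simp
  qed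
  have poly_h: "\<exists>p. \<forall>t. f (\<gamma> t) = poly p t"
    if f: "polyfn_on Z C f" and \<gamma>: "\<And>t. \<gamma> t \<in> Z" "\<forall>c\<in>C. \<exists>p. \<forall>t. c (\<gamma> t) = poly p t" for f \<gamma>
  proof -
    obtain g where "polyfn C g" "\<forall>z\<in>Z. f z = g z" using f by (auto simp: polyfn_on_def)
    then show ?thesis using polyfn_along_curve[of C g \<gamma>] \<gamma> by auto
  qed
  have poly_on: "polyfn_on Z C (\<lambda>z. \<Sum>n=e..N. h z ^ (n - e) * S n (\<lambda>j. \<phi>' j z))"
  proof -
    obtain g where g: "polyfn C g" "\<forall>z\<in>Z. h z = g z" using h by (auto simp: polyfn_on_def)
    have "\<forall>j\<in>J. \<exists>f. polyfn C f \<and> (\<forall>z\<in>Z. \<phi> j z = f z)" using \<phi> by (auto simp: polyfn_on_def)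
    then obtain f where f: "\<And>j. j \<in> J \<Longrightarrow> polyfn C (f j)" "\<And>j z. j \<in> J \<Longrightarrow> z \<in> Z \<Longrightarrow> \<phi> j z = f j z"
      by metis
    have "polyfn C (\<lambda>z. \<Sum>n=e..N. g z ^ (n - e) * S n (\<lambda>j. f (the j) z))"
      unfolding S_def by (intro polyfn_intros g polyfn_multipoly) (auto intro: f)
    moreover have "S n (\<lambda>j. \<phi>' j z) = S n (\<lambda>j. f (the j) z)" if "z \<in> Z" for n z
      unfolding S_def using f(2) that by (intro multipoly_cong) (auto simp: \<phi>'_def)
    ultimately show ?thesis using g(2) unfolding polyfn_on_def
      by (intro exI[of _ "\<lambda>z. \<Sum>n=e..N. g z ^ (n - e) * S n (\<lambda>j. f (the j) z)"]) auto
  qed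
  \<comment> \<open>Division by the power of \<open>h\<close> is valid only where \<open>h\<close>
    is nonzero. On the curve from \<open>z\<close> to \<open>zs\<close> this excludes finitely many
    parameters, so the polynomial \<open>q\<close> vanishes identically and in particular at
    \<open>z\<close>.\<close>
  have all: "(\<Sum>n=e..N. h z ^ (n - e) * S n (\<lambda>j. \<phi>' j z)) = 0" if z: "z \<in> Z" for z
  proof -
    obtain \<gamma> where \<gamma>: "\<gamma> 0 = z" "\<gamma> 1 = zs" "\<And>t. \<gamma> t \<in> Z" "\<forall>c\<in>C. \<exists>p. \<forall>t. c (\<gamma> t) = poly p t"
      using conn[OF z] by blast
    obtain p where p: "\<forall>t. h (\<gamma> t) = poly p t" using poly_h[OF h \<gamma>(3,4)] by blast
    obtain q where q: "\<forall>t. (\<Sum>n=e..N. h (\<gamma> t) ^ (n - e) * S n (\<lambda>j. \<phi>' j (\<gamma> t))) = poly q t"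
      using poly_h[OF poly_on \<gamma>(3,4)] by blast
    have "poly p 1 \<noteq> 0" using p zs \<gamma>(2) by metis
    moreover have "poly p t = 0 \<or> poly q t = 0" for t
      using cancel[OF \<gamma>(3)[of t]] p q by metis
    ultimately have "poly q 0 = 0" using poly_nonzero_avoid_finite[of p 1 q 0] by blast
    then show ?thesis using q \<gamma>(1) by metis
  qed
  define c' where "c' \<alpha> = c (\<lambda>i. case i of None \<Rightarrow> e | Some j \<Rightarrow> if j \<in> J then \<alpha> j else undefined)" for \<alpha>
  have S_e: "S e v = multipoly J N c' (\<lambda>j. v (Some j))" for v
  proof -
    have bij: "bij_betw (\<lambda>\<beta>. \<lambda>i. case i of None \<Rightarrow> undefined | Some j \<Rightarrow> if j \<in> J then \<beta> j else undefined)
        (J \<rightarrow>\<^sub>E {..N}) (Some ` J \<rightarrow>\<^sub>E {..N})"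
    proof (rule bij_betwI[of _ _ _ "\<lambda>\<alpha>. restrict (\<lambda>j. \<alpha> (Some j)) J"])
      show "(\<lambda>\<beta>. \<lambda>i. case i of None \<Rightarrow> undefined | Some j \<Rightarrow> if j \<in> J then \<beta> j else undefined)
        \<in> (J \<rightarrow>\<^sub>E {..N}) \<rightarrow> (Some ` J \<rightarrow>\<^sub>E {..N})"
        by (auto split: option.split simp: PiE_iff extensional_def)
      show "(\<lambda>\<alpha>. restrict (\<lambda>j. \<alpha> (Some j)) J) \<in> (Some ` J \<rightarrow>\<^sub>E {..N}) \<rightarrow> (J \<rightarrow>\<^sub>E {..N})"
        by (auto simp: PiE_iff)
    qed (auto simp: PiE_iff extensional_def fun_eq_iff split: option.split)
    show ?thesis
      unfolding S_def multipoly_def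
      by (subst sum.reindex_bij_betw[OF bij, symmetric], intro sum.cong refl arg_cong2[where f="(*)"])
        (auto simp: c'_def fun_eq_iff prod.reindex split: option.split intro!: arg_cong[of _ _ c] prod.cong)
  qed
  obtain \<alpha> where "\<alpha> \<in> Some ` J \<rightarrow>\<^sub>E {..N}" "c (\<alpha>(None := e)) \<noteq> 0"
    using e(1) unfolding good_def by blast
  then obtain v where "S e v \<noteq> 0"
    using multipoly_nonzero[OF J'(3), of \<alpha> N "\<lambda>\<alpha>. c (\<alpha>(None := e))"] unfolding S_def by blast
  then have "multipoly J N c' (\<lambda>j. v (Some j)) \<noteq> 0" unfolding S_e .
  then have "\<exists>v. multipoly J N c' v \<noteq> 0" by (rule exI[of _ "\<lambda>j. v (Some j)"])
  moreover have "multipoly J N c' (\<lambda>j. \<phi> j z) = 0" if "z \<in> Z" "h z = 0" for z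
  proof -
    have "0 = (\<Sum>n=e..N. h z ^ (n - e) * S n (\<lambda>j. \<phi>' j z))" using all[OF that(1)] by simp
    also have "\<dots> = (\<Sum>n\<in>{e}. h z ^ (n - e) * S n (\<lambda>j. \<phi>' j z))"
      using that(2) eN by (intro sum.mono_neutral_right) auto
    finally show ?thesis by (simp add: S_e \<phi>'_def)
  qed
  ultimately show ?thesis by blast
qed

section \<open>Quadrics containing the coordinate plane\<close>

lemma UNIV_8: "(UNIV :: 8 set) = {0, 1, 2, 3, 4, 5, 6, 7}"
proof -
  have "x \<in> {0, 1, 2, 3, 4, 5, 6, 7}" for x :: 8
  proof (induct x)
    case (of_int z)
    then have "0 \<le> z" and "z < 8" by simp_all
    then have "z = 0 \<or> z = 1 \<or> z = 2 \<or> z = 3 \<or> z = 4 \<or> z = 5 \<or> z = 6 \<or> z = 7" by arith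
    then show ?case by auto
  qed
  then show ?thesis by auto
qed

lemma UNIV_4': "(UNIV :: 4 set) = {0, 1, 2, 3}"
proof -
  have "x \<in> {0, 1, 2, 3}" for x :: 4
  proof (induct x)
    case (of_int z)
    then have "0 \<le> z" and "z < 4" by simp_all
    then have "z = 0 \<or> z = 1 \<or> z = 2 \<or> z = 3" by arith
    then show ?case by auto
  qed
  then show ?thesis by auto
qed

lemma UNIV_5: "(UNIV :: 5 set) = {0, 1, 2, 3, 4}"
proof -
  have "x \<in> {0, 1, 2, 3, 4}" for x :: 5
  proof (induct x)
    case (of_int z)
    then have "0 \<le> z" and "z < 5" by simp_all
    then have "z = 0 \<or> z = 1 \<or> z = 2 \<or> z = 3 \<or> z = 4" by arith
    then show ?case by auto
  qed
  then show ?thesis by auto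
qed

lemma sum_8: "sum f (UNIV :: 8 set) = f 0 + f 1 + f 2 + f 3 + f 4 + f 5 + f 6 + f 7"
  unfolding UNIV_8 by (simp add: add.assoc)

lemma sum_4': "sum f (UNIV :: 4 set) = f 0 + f 1 + f 2 + f 3"
  unfolding UNIV_4' by (simp add: add.assoc)

lemma all_8: "(\<forall>i::8. R i) \<longleftrightarrow> R 0 \<and> R 1 \<and> R 2 \<and> R 3 \<and> R 4 \<and> R 5 \<and> R 6 \<and> R 7"
  using UNIV_8 by (metis (full_types) UNIV_I insertE singletonD)

lemma all_4': "(\<forall>i::4. R i) \<longleftrightarrow> R 0 \<and> R 1 \<and> R 2 \<and> R 3"
  using UNIV_4' by (metis (full_types) UNIV_I insertE singletonD)

lemma all_5: "(\<forall>i::5. R i) \<longleftrightarrow> R 0 \<and> R 1 \<and> R 2 \<and> R 3 \<and> R 4"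
  using UNIV_5 by (metis (full_types) UNIV_I insertE singletonD)

definition vec4 :: "complex \<Rightarrow> complex \<Rightarrow> complex \<Rightarrow> complex \<Rightarrow> complex^4" where
  "vec4 a0 a1 a2 a3 = (\<chi> i. if i = 0 then a0 else if i = 1 then a1 else if i = 2 then a2 else a3)"

definition vec5 :: "complex \<Rightarrow> complex \<Rightarrow> complex \<Rightarrow> complex \<Rightarrow> complex \<Rightarrow> complex^5" where
  "vec5 a0 a1 a2 a3 a4 = (\<chi> i. if i = 0 then a0 else if i = 1 then a1 else if i = 2 then a2
     else if i = 3 then a3 else a4)"

definition vec8 :: "complex \<Rightarrow> complex \<Rightarrow> complex \<Rightarrow> complex \<Rightarrow> complex \<Rightarrow> complex \<Rightarrow> complex \<Rightarrow> complex
    \<Rightarrow> complex^8" where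
  "vec8 a0 a1 a2 a3 a4 a5 a6 a7 = (\<chi> i. if i = 0 then a0 else if i = 1 then a1 else if i = 2 then a2
     else if i = 3 then a3 else if i = 4 then a4 else if i = 5 then a5 else if i = 6 then a6 else a7)"

lemma vec4_nth [simp]: "vec4 a0 a1 a2 a3 $ 0 = a0" "vec4 a0 a1 a2 a3 $ 1 = a1"
  "vec4 a0 a1 a2 a3 $ 2 = a2" "vec4 a0 a1 a2 a3 $ 3 = a3"
  by (simp_all add: vec4_def)

lemma vec5_nth [simp]: "vec5 a0 a1 a2 a3 a4 $ 0 = a0" "vec5 a0 a1 a2 a3 a4 $ 1 = a1"
  "vec5 a0 a1 a2 a3 a4 $ 2 = a2" "vec5 a0 a1 a2 a3 a4 $ 3 = a3" "vec5 a0 a1 a2 a3 a4 $ 4 = a4"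
  by (simp_all add: vec5_def)

lemma vec8_nth [simp]:
  "vec8 a0 a1 a2 a3 a4 a5 a6 a7 $ 0 = a0" "vec8 a0 a1 a2 a3 a4 a5 a6 a7 $ 1 = a1"
  "vec8 a0 a1 a2 a3 a4 a5 a6 a7 $ 2 = a2" "vec8 a0 a1 a2 a3 a4 a5 a6 a7 $ 3 = a3"
  "vec8 a0 a1 a2 a3 a4 a5 a6 a7 $ 4 = a4" "vec8 a0 a1 a2 a3 a4 a5 a6 a7 $ 5 = a5"
  "vec8 a0 a1 a2 a3 a4 a5 a6 a7 $ 6 = a6" "vec8 a0 a1 a2 a3 a4 a5 a6 a7 $ 7 = a7"
  by (simp_all add: vec8_def)

lemma zlam_nth [simp]: "zlam z $ 0 = z $ 0" "zlam z $ 1 = z $ 1" "zlam z $ 2 = z $ 2" "zlam z $ 3 = z $ 3"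
  by (simp_all add: zlam_def)

section \<open>Bilinear forms and quadrics vanishing on the coordinate plane\<close>

definition bl :: "complex^8^8 \<Rightarrow> complex^8 \<Rightarrow> complex^8 \<Rightarrow> complex" where
  "bl A x y = (\<Sum>i\<in>UNIV. x $ i * (A *v y) $ i)"

lemma qf_eq_bl: "qf A x = bl A x x"
  by (simp add: qf_def bl_def matrix_vector_mult_def sum_distrib_left mult.assoc)

lemma bl_add_left: "bl A (x + x') y = bl A x y + bl A x' y"
  by (simp add: bl_def distrib_right sum.distrib)

lemma bl_add_right: "bl A x (y + y') = bl A x y + bl A x y'"
  by (simp add: bl_def matrix_vector_right_distrib distrib_left sum.distrib)

lemma bl_scale_left: "bl A (c *s x) y = c * bl A x y"
  by (simp add: bl_def sum_distrib_left mult.assoc)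

lemma bl_scale_right: "bl A x (c *s y) = c * bl A x y"
  by (simp add: bl_def matrix_vector_mult_scaleR vector_scalar_commute sum_distrib_left mult_ac)

lemma transpose_eq_sym:
  assumes "transpose A = A"
  shows "A $ i $ j = A $ j $ i"
proof -
  have "transpose A $ i $ j = A $ j $ i" by (simp add: transpose_def)
  then show ?thesis unfolding assms .
qed

lemma bl_commute:
  assumes "transpose A = A"
  shows "bl A x y = bl A y x"
proof -
  have "x $ i * (A $ i $ j * y $ j) = y $ j * (A $ j $ i * x $ i)" for i j
    using transpose_eq_sym[OF assms, of i j] by (simp add: mult_ac)
  then have "(\<Sum>i\<in>UNIV. \<Sum>j\<in>UNIV. x $ i * (A $ i $ j * y $ j)) = (\<Sum>i\<in>UNIV. \<Sum>j\<in>UNIV. y $ j * (A $ j $ i * x $ i))"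
    by (intro sum.cong refl)
  also have "\<dots> = (\<Sum>j\<in>UNIV. \<Sum>i\<in>UNIV. y $ j * (A $ j $ i * x $ i))" by (rule sum.swap)
  finally show ?thesis by (simp add: bl_def matrix_vector_mult_def sum_distrib_left)
qed

lemmas bl_bilinear = bl_add_left bl_add_right bl_scale_left bl_scale_right

lemma qf_scale: "qf A (c *s x) = c ^ 2 * qf A x"
  by (simp add: qf_eq_bl bl_bilinear power2_eq_square)

definition in_frame :: "complex^8^8 \<Rightarrow> bool" where
  "in_frame A \<longleftrightarrow> transpose A = A \<and> (\<forall>i\<in>{0, 1, 2}. \<forall>j\<in>{0, 1, 2}. A $ i $ j = 0)"

definition frame_web :: "complex^8^8^4 \<Rightarrow> bool" where
  "frame_web Q \<longleftrightarrow> (\<forall>k. in_frame (Q $ k))"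

lemma in_frame_sym: "in_frame A \<Longrightarrow> A $ i $ j = A $ j $ i"
  by (rule transpose_eq_sym) (simp add: in_frame_def)

lemma in_frame_zero:
  assumes "in_frame A"
  shows "A $ 0 $ 0 = 0" "A $ 0 $ 1 = 0" "A $ 0 $ 2 = 0" "A $ 1 $ 0 = 0" "A $ 1 $ 1 = 0" "A $ 1 $ 2 = 0"
    "A $ 2 $ 0 = 0" "A $ 2 $ 1 = 0" "A $ 2 $ 2 = 0"
  using assms by (auto simp: in_frame_def)

lemma pencil_nth: "pencil Q l $ i $ j = (\<Sum>k\<in>UNIV. l $ k * Q $ k $ i $ j)"
  by (simp add: pencil_def)

lemma in_frame_pencil: "frame_web Q \<Longrightarrow> in_frame (pencil Q l)"
  by (auto simp: frame_web_def in_frame_def transpose_def pencil_def vec_eq_iff)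

lemma pencil_mult: "(pencil Q l *v x) $ i = (\<Sum>k\<in>UNIV. l $ k * (Q $ k *v x) $ i)"
  unfolding matrix_vector_mult_def pencil_def
  by (simp add: sum_distrib_left sum_distrib_right mult.assoc) (rule sum.swap)

lemma bl_pencil: "bl (pencil Q l) x y = (\<Sum>k\<in>UNIV. l $ k * bl (Q $ k) x y)"
  unfolding bl_def pencil_mult by (simp add: sum_distrib_left mult_ac) (rule sum.swap)

text \<open>The representative of \<open>x\<close> modulo \<open>P\<close> in the span of the last
  five basis vectors.\<close>

definition ypart :: "complex^8 \<Rightarrow> complex^8" where
  "ypart x = vec8 0 0 0 (x $ 3) (x $ 4) (x $ 5) (x $ 6) (x $ 7)"

lemma in_frame_ypart:
  assumes "in_frame A"
  shows "(A *v ypart x) $ 0 = (A *v x) $ 0" "(A *v ypart x) $ 1 = (A *v x) $ 1"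
    "(A *v ypart x) $ 2 = (A *v x) $ 2"
  using in_frame_zero[OF assms] by (simp_all add: matrix_vector_mult_def sum_8 ypart_def)

text \<open>\<open>P\<close> is isotropic, so its own term drops out, and the cross term sees only
  rows 0 to 2 of \<open>A\<close>. Along a translate of \<open>P\<close> the form is therefore
  affine linear.\<close>

lemma qf_frame_split:
  assumes "in_frame A"
  shows "qf A x = 2 * (x $ 0 * (A *v x) $ 0 + x $ 1 * (A *v x) $ 1 + x $ 2 * (A *v x) $ 2) + qf A (ypart x)"
proof -
  define p where "p = vec8 (x $ 0) (x $ 1) (x $ 2) 0 0 0 0 0"
  have x: "x = p + ypart x" by (simp add: vec_eq_iff all_8 p_def ypart_def)
  have tr: "transpose A = A" using assms by (simp add: in_frame_def)
  have pp: "bl A p p = 0"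
    using in_frame_zero[OF assms] by (simp add: bl_def matrix_vector_mult_def sum_8 p_def)
  have "qf A x = bl A p p + 2 * bl A p (ypart x) + bl A (ypart x) (ypart x)"
    unfolding qf_eq_bl by (subst (1 2) x) (simp add: bl_bilinear bl_commute[OF tr, of "ypart x" p])
  moreover have "bl A p (ypart x) = x $ 0 * (A *v x) $ 0 + x $ 1 * (A *v x) $ 1 + x $ 2 * (A *v x) $ 2"
    unfolding bl_def by (simp add: sum_8 p_def in_frame_ypart[OF assms])
  ultimately show ?thesis by (simp add: pp qf_eq_bl)
qed

section \<open>Minors and Cramer solutions\<close>

definition det3 where
  "det3 a b c d e f g h i = a * (e * i - f * h) - b * (d * i - f * g) + c * (d * h - e * (g::complex))"

definition minor3 :: "(8 \<Rightarrow> 'k \<Rightarrow> complex) \<Rightarrow> 'k \<Rightarrow> 'k \<Rightarrow> 'k \<Rightarrow> complex" where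
  "minor3 M a b c = det3 (M 0 a) (M 0 b) (M 0 c) (M 1 a) (M 1 b) (M 1 c) (M 2 a) (M 2 b) (M 2 c)"

definition lam :: "complex^8^8^4 \<Rightarrow> complex^8 \<Rightarrow> complex^4" where
  "lam Q x = (let M = (\<lambda>i k. (Q $ k *v x) $ i) in
     vec4 (minor3 M 1 2 3) (- minor3 M 0 2 3) (minor3 M 0 1 3) (- minor3 M 0 1 2))"

definition mB :: "complex^8^8 \<Rightarrow> complex" where
  "mB A = minor3 (\<lambda>i j. A $ i $ j) 3 4 5"

text \<open>\<open>kv\<close> and \<open>lv\<close> are the Cramer solutions spanning the kernel of the \<open>3 \<times> 5\<close> block of \<open>A\<close>
  with rows 0--2 and columns 3--7, provided its first minor \<open>mB\<close> does not vanish.\<close>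

definition kv :: "complex^8^8 \<Rightarrow> complex^8" where
  "kv A = (let B = (\<lambda>i j. A $ i $ j) in
     vec8 0 0 0 (- minor3 B 6 4 5) (- minor3 B 3 6 5) (- minor3 B 3 4 6) (mB A) 0)"

definition lv :: "complex^8^8 \<Rightarrow> complex^8" where
  "lv A = (let B = (\<lambda>i j. A $ i $ j) in
     vec8 0 0 0 (- minor3 B 7 4 5) (- minor3 B 3 7 5) (- minor3 B 3 4 7) 0 (mB A))"

text \<open>The Gram matrix of the binary form induced on the span of \<open>kv A\<close> and
  \<open>lv A\<close>.\<close>

definition al :: "complex^8^8 \<Rightarrow> complex" where "al A = bl A (kv A) (kv A)"
definition be :: "complex^8^8 \<Rightarrow> complex" where "be A = bl A (kv A) (lv A)"
definition ga :: "complex^8^8 \<Rightarrow> complex" where "ga A = bl A (lv A) (lv A)"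

lemma kv_ker:
  assumes "in_frame A"
  shows "(A *v kv A) $ 0 = 0" "(A *v kv A) $ 1 = 0" "(A *v kv A) $ 2 = 0"
  by (simp_all add: matrix_vector_mult_def sum_8 kv_def Let_def mB_def minor3_def det3_def algebra_simps)

lemma lv_ker:
  assumes "in_frame A"
  shows "(A *v lv A) $ 0 = 0" "(A *v lv A) $ 1 = 0" "(A *v lv A) $ 2 = 0"
  by (simp_all add: matrix_vector_mult_def sum_8 lv_def Let_def mB_def minor3_def det3_def algebra_simps)

text \<open>Laplace expansion of a 4 by 4 determinant in which one row of the 3 by 4 matrix is
  repeated.\<close>

lemma minor3_syzygy:
  shows "M 0 3 * minor3 M 0 1 2 = M 0 0 * minor3 M 1 2 3 - M 0 1 * minor3 M 0 2 3 + M 0 2 * minor3 M 0 1 (3::4)"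
    "M 1 3 * minor3 M 0 1 2 = M 1 0 * minor3 M 1 2 3 - M 1 1 * minor3 M 0 2 3 + M 1 2 * minor3 M 0 1 3"
    "M 2 3 * minor3 M 0 1 2 = M 2 0 * minor3 M 1 2 3 - M 2 1 * minor3 M 0 2 3 + M 2 2 * minor3 M 0 1 3"
  by (simp_all add: minor3_def det3_def algebra_simps)

lemma lam_ker:
  shows "(pencil Q (lam Q x) *v x) $ 0 = 0" "(pencil Q (lam Q x) *v x) $ 1 = 0"
    "(pencil Q (lam Q x) *v x) $ 2 = 0"
  unfolding pencil_mult sum_4' lam_def Let_def
  using minor3_syzygy[of "\<lambda>i k. (Q $ k *v x) $ i"] by (simp_all add: algebra_simps)

text \<open>Cramer's rule: replacing a column of a 3 by 3 minor by the vanishing combination of all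
  four columns gives zero. The statement is cross-multiplied to hold without any rank
  condition.\<close>

lemma lam_proportional:
  assumes "(pencil Q l *v x) $ 0 = 0" "(pencil Q l *v x) $ 1 = 0" "(pencil Q l *v x) $ 2 = 0"
  shows "l $ 3 *s lam Q x = lam Q x $ 3 *s l"
proof -
  define M where "M = (\<lambda>i k. (Q $ k *v x) $ i)"
  have r: "l $ 0 * M i 0 + l $ 1 * M i 1 + l $ 2 * M i 2 + l $ 3 * M i 3 = 0" if "i \<in> {0, 1, 2}" for i
    using assms that unfolding pencil_mult sum_4' M_def by auto
  have l: "lam Q x = vec4 (minor3 M 1 2 3) (- minor3 M 0 2 3) (minor3 M 0 1 3) (- minor3 M 0 1 2)"
    by (simp add: lam_def M_def Let_def)
  define r0 where "r0 = l $ 0 * M 0 0 + l $ 1 * M 0 1 + l $ 2 * M 0 2 + l $ 3 * M 0 3"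
  define r1 where "r1 = l $ 0 * M 1 0 + l $ 1 * M 1 1 + l $ 2 * M 1 2 + l $ 3 * M 1 3"
  define r2 where "r2 = l $ 0 * M 2 0 + l $ 1 * M 2 1 + l $ 2 * M 2 2 + l $ 3 * M 2 3"
  have z: "r0 = 0" "r1 = 0" "r2 = 0" using r by (auto simp: r0_def r1_def r2_def)
  have "l $ 3 * minor3 M 1 2 3 + minor3 M 0 1 2 * l $ 0 = det3 r0 (M 0 1) (M 0 2) r1 (M 1 1) (M 1 2) r2 (M 2 1) (M 2 2)"
    "- l $ 3 * minor3 M 0 2 3 + minor3 M 0 1 2 * l $ 1 = det3 (M 0 0) r0 (M 0 2) (M 1 0) r1 (M 1 2) (M 2 0) r2 (M 2 2)"
    "l $ 3 * minor3 M 0 1 3 + minor3 M 0 1 2 * l $ 2 = det3 (M 0 0) (M 0 1) r0 (M 1 0) (M 1 1) r1 (M 2 0) (M 2 1) r2"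
    unfolding r0_def r1_def r2_def by (simp_all add: minor3_def det3_def algebra_simps)
  then have "l $ 3 * minor3 M 1 2 3 + minor3 M 0 1 2 * l $ 0 = 0"
    "- l $ 3 * minor3 M 0 2 3 + minor3 M 0 1 2 * l $ 1 = 0"
    "l $ 3 * minor3 M 0 1 3 + minor3 M 0 1 2 * l $ 2 = 0"
    unfolding z by (simp_all add: det3_def)
  then show ?thesis
    by (simp add: vec_eq_iff all_4' l algebra_simps eq_neg_iff_add_eq_0)
qed

text \<open>Coordinates 6 and 7 are free; Cramer's rule determines coordinates 3 to 5 from them,
  with the denominator \<open>mB A\<close> cleared.\<close>

lemma ker_spanned:
  assumes "in_frame A" "(A *v x) $ 0 = 0" "(A *v x) $ 1 = 0" "(A *v x) $ 2 = 0"
  shows "mB A *s ypart x = x $ 6 *s kv A + x $ 7 *s lv A"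
proof -
  define r where "r i = A $ i $ 3 * x $ 3 + A $ i $ 4 * x $ 4 + A $ i $ 5 * x $ 5 + A $ i $ 6 * x $ 6
    + A $ i $ 7 * x $ 7" for i
  have z: "r 0 = 0" "r 1 = 0" "r 2 = 0"
    using assms(2-4) in_frame_zero[OF assms(1)] by (simp_all add: matrix_vector_mult_def sum_8 r_def)
  let ?B = "\<lambda>i j. A $ i $ j"
  have "mB A * x $ 3 + x $ 6 * minor3 ?B 6 4 5 + x $ 7 * minor3 ?B 7 4 5
      = det3 (r 0) (A $ 0 $ 4) (A $ 0 $ 5) (r 1) (A $ 1 $ 4) (A $ 1 $ 5) (r 2) (A $ 2 $ 4) (A $ 2 $ 5)"
    "mB A * x $ 4 + x $ 6 * minor3 ?B 3 6 5 + x $ 7 * minor3 ?B 3 7 5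
      = det3 (A $ 0 $ 3) (r 0) (A $ 0 $ 5) (A $ 1 $ 3) (r 1) (A $ 1 $ 5) (A $ 2 $ 3) (r 2) (A $ 2 $ 5)"
    "mB A * x $ 5 + x $ 6 * minor3 ?B 3 4 6 + x $ 7 * minor3 ?B 3 4 7
      = det3 (A $ 0 $ 3) (A $ 0 $ 4) (r 0) (A $ 1 $ 3) (A $ 1 $ 4) (r 1) (A $ 2 $ 3) (A $ 2 $ 4) (r 2)"
    unfolding r_def mB_def by (simp_all add: minor3_def det3_def algebra_simps)
  then have "mB A * x $ 3 + x $ 6 * minor3 ?B 6 4 5 + x $ 7 * minor3 ?B 7 4 5 = 0"
    "mB A * x $ 4 + x $ 6 * minor3 ?B 3 6 5 + x $ 7 * minor3 ?B 3 7 5 = 0"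
    "mB A * x $ 5 + x $ 6 * minor3 ?B 3 4 6 + x $ 7 * minor3 ?B 3 4 7 = 0"
    unfolding z by (simp_all add: det3_def)
  then have "mB A * x $ 3 = x $ 6 * (- minor3 ?B 6 4 5) + x $ 7 * (- minor3 ?B 7 4 5)"
    "mB A * x $ 4 = x $ 6 * (- minor3 ?B 3 6 5) + x $ 7 * (- minor3 ?B 3 7 5)"
    "mB A * x $ 5 = x $ 6 * (- minor3 ?B 3 4 6) + x $ 7 * (- minor3 ?B 3 4 7)"
    by algebra+
  then show ?thesis
    by (simp add: vec_eq_iff all_8 ypart_def kv_def lv_def Let_def)
qed

section \<open>The determinant of a quadric containing the plane\<close>

text \<open>The block is padded with an identity so that all blocks keep the index type of
  \<open>A\<close> and can be multiplied.\<close>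

definition blk :: "'n set \<Rightarrow> complex^'n^'n \<Rightarrow> complex^'n^'n" where
  "blk R A = (\<chi> i j. if i \<in> R \<and> j \<in> R then A $ i $ j else if i = j then 1 else 0)"

text \<open>If a permutation moves \<open>i\<close> and its term is nonzero, then \<open>i\<close>
  goes from outside \<open>R\<close> into \<open>R\<close>; but a row in \<open>R\<close> has only
  its diagonal entry, and \<open>p i\<close> is moved too.\<close>

lemma det_unipotent_block:
  fixes A :: "complex^'n^'n"
  shows "det (\<chi> i j. if i = j then 1 else if i \<notin> R \<and> j \<in> R then A $ i $ j else 0) = 1" (is "det ?U = 1")
proof -
  have nz: "(\<Prod>i\<in>UNIV. ?U $ i $ p i) = 0" if p: "p permutes UNIV" "p \<noteq> id" for p
  proof -
    obtain i where i: "p i \<noteq> i" using p(2) by (auto simp: fun_eq_iff)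
    have pp: "p (p i) \<noteq> p i" using i permutes_inj[OF p(1)] by (auto dest: injD)
    have "\<exists>i. ?U $ i $ p i = 0"
    proof (cases "p i \<in> R")
      case True
      then show ?thesis using pp by (intro exI[of _ "p i"]) auto
    next
      case False
      then show ?thesis using i by (intro exI[of _ i]) auto
    qed
    then show ?thesis by (auto intro: prod_zero)
  qed
  have "det ?U = (\<Sum>p\<in>{id}. of_int (sign p) * (\<Prod>i\<in>UNIV. ?U $ i $ p i))"
    unfolding det_def
    by (rule sum.mono_neutral_right) (auto simp: permutes_id nz finite_permutations simp del: vec_lambda_beta)
  then show ?thesis by simp
qed

text \<open>Rows in \<open>R\<close> vanish outside \<open>R\<close>, so \<open>A\<close> is the
  product of its \<open>R\<close>-block, a unipotent matrix \<open>U\<close> carrying the mixed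
  entries, and the complementary block.\<close>

lemma det_block:
  fixes A :: "complex^'n^'n"
  assumes "\<And>i j. i \<in> R \<Longrightarrow> j \<notin> R \<Longrightarrow> A $ i $ j = 0"
  shows "det A = det (blk R A) * det (blk (- R) A)"
proof -
  define U where "U = (\<chi> i j. if i = j then 1 else if i \<notin> R \<and> j \<in> R then A $ i $ j else 0)"
  define W where "W = (\<chi> i j. if i \<in> R then (if i = j then 1 else 0) else A $ i $ j)"
  have W: "W = U ** blk (- R) A"
  proof -
    have "(\<Sum>k\<in>UNIV. U $ i $ k * blk (- R) A $ k $ j) = W $ i $ j" for i j
    proof (cases "i \<in> R")
      case True
      then have "(\<Sum>k\<in>UNIV. U $ i $ k * blk (- R) A $ k $ j) = (\<Sum>k\<in>UNIV. if k = i then blk (- R) A $ i $ j else 0)"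
        by (intro sum.cong) (auto simp: U_def)
      then show ?thesis using True by (simp add: blk_def W_def)
    next
      case False
      show ?thesis
      proof (cases "j \<in> R")
        case True
        then have "(\<Sum>k\<in>UNIV. U $ i $ k * blk (- R) A $ k $ j) = (\<Sum>k\<in>UNIV. if k = j then A $ i $ j else 0)"
          using False by (intro sum.cong) (auto simp: U_def blk_def)
        then show ?thesis using False by (simp add: W_def)
      next
        case nj: False
        then have "(\<Sum>k\<in>UNIV. U $ i $ k * blk (- R) A $ k $ j) = (\<Sum>k\<in>UNIV. if k = i then A $ i $ j else 0)"
          using False by (intro sum.cong) (auto simp: U_def blk_def)
        then show ?thesis using False by (simp add: W_def)
      qed
    qed
    then show ?thesis by (simp add: matrix_matrix_mult_def vec_eq_iff)
  qed
  have A: "A = blk R A ** W"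
  proof -
    have "(\<Sum>k\<in>UNIV. blk R A $ i $ k * W $ k $ j) = A $ i $ j" for i j
    proof (cases "i \<in> R")
      case True
      have "(\<Sum>k\<in>UNIV. blk R A $ i $ k * W $ k $ j) = (\<Sum>k\<in>UNIV. if k = j then (if j \<in> R then A $ i $ j else 0) else 0)"
        using True by (intro sum.cong) (auto simp: W_def blk_def)
      then show ?thesis using True assms by simp
    next
      case False
      then have "(\<Sum>k\<in>UNIV. blk R A $ i $ k * W $ k $ j) = (\<Sum>k\<in>UNIV. if k = i then A $ i $ j else 0)"
        by (intro sum.cong) (auto simp: W_def blk_def)
      then show ?thesis by simp
    qed
    then show ?thesis by (simp add: matrix_matrix_mult_def vec_eq_iff)
  qed
  have "det A = det (blk R A) * (det U * det (blk (- R) A))"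
    by (subst A, subst W) (simp only: det_mul)
  then show ?thesis using det_unipotent_block[of R A] by (simp add: U_def)
qed

lemma det_blk:
  fixes A :: "complex^'n^'n"
  shows "det (blk R A) = (\<Sum>p | p permutes R. of_int (sign p) * (\<Prod>i\<in>R. A $ i $ p i))"
proof -
  have nz: "(\<Prod>i\<in>UNIV. blk R A $ i $ p i) = 0" if p: "p permutes UNIV" "\<not> p permutes R" for p
  proof -
    have "\<exists>i. i \<notin> R \<and> p i \<noteq> i" using p by (auto simp: permutes_def)
    then have "\<exists>i. blk R A $ i $ p i = 0" by (auto simp: blk_def)
    then show ?thesis by (auto intro: prod_zero)
  qed
  have pr: "(\<Prod>i\<in>UNIV. blk R A $ i $ p i) = (\<Prod>i\<in>R. A $ i $ p i)" if p: "p permutes R" for p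
  proof -
    have "(\<Prod>i\<in>UNIV. blk R A $ i $ p i) = (\<Prod>i\<in>R. blk R A $ i $ p i)"
      by (rule prod.mono_neutral_right) (use p in \<open>auto simp: blk_def permutes_not_in\<close>)
    also have "\<dots> = (\<Prod>i\<in>R. A $ i $ p i)"
      by (intro prod.cong) (use p in \<open>auto simp: blk_def permutes_in_image\<close>)
    finally show ?thesis .
  qed
  have "det (blk R A) = (\<Sum>p | p permutes R. of_int (sign p) * (\<Prod>i\<in>UNIV. blk R A $ i $ p i))"
    unfolding det_def
    by (rule sum.mono_neutral_right) (auto simp: nz finite_permutations intro: permutes_subset)
  then show ?thesis by (simp add: pr)
qed

lemma det_blk_2:
  fixes A :: "complex^'n^'n"
  assumes "a \<noteq> b"
  shows "det (blk {a, b} A) = A $ a $ a * A $ b $ b - A $ a $ b * A $ b $ a"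
proof -
  have f: "finite {b}" "a \<notin> {b}" using assms by auto
  show ?thesis
    unfolding det_blk sum_over_permutations_insert[OF f] permutes_sing
    using assms by (simp add: sign_swap_id sign_id swap_id_eq)
qed

lemma det_blk_3:
  fixes A :: "complex^'n^'n"
  assumes "a \<noteq> b" "a \<noteq> c" "b \<noteq> c"
  shows "det (blk {a, b, c} A) = det3 (A $ a $ a) (A $ a $ b) (A $ a $ c) (A $ b $ a) (A $ b $ b) (A $ b $ c)
    (A $ c $ a) (A $ c $ b) (A $ c $ c)"
proof -
  have f: "finite {b, c}" "a \<notin> {b, c}" "finite {c}" "b \<notin> {c}" using assms by auto
  show ?thesis
    unfolding det_blk sum_over_permutations_insert[OF f(1,2)] sum_over_permutations_insert[OF f(3,4)]
      permutes_sing
    using assms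
    by (simp add: sign_swap_id permutation_swap_id sign_compose sign_id swap_id_eq det3_def algebra_simps)
qed

lemma blk_blk: "R' \<subseteq> R \<Longrightarrow> blk R' (blk R A) = blk R' A"
  by (auto simp: blk_def vec_eq_iff)

text \<open>Swapping rows 0, 1, 2 with rows 3, 4, 5 makes the matrix block triangular with blocks on
  {3, 4, 5}, {6, 7} and {0, 1, 2}; three transpositions account for the minus sign.\<close>

lemma det_hyperbolic_block:
  fixes T :: "complex^8^8"
  assumes z: "\<And>i j. i \<in> {0, 1, 2} \<Longrightarrow> j \<in> {0, 1, 2, 6, 7} \<Longrightarrow> T $ i $ j = 0"
    "\<And>i j. i \<in> {6, 7} \<Longrightarrow> j \<in> {0, 1, 2} \<Longrightarrow> T $ i $ j = 0"
  shows "det T = - (minor3 (\<lambda>i j. T $ i $ j) 3 4 5 * minor3 (\<lambda>i j. T $ j $ i) 3 4 5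
    * (T $ 6 $ 6 * T $ 7 $ 7 - T $ 6 $ 7 * T $ 7 $ 6))"
proof -
  let ?t = "Transposition.transpose"
  define p :: "8 \<Rightarrow> 8" where "p = ?t 0 3 \<circ> (?t 1 4 \<circ> ?t 2 5)"
  have pv: "p 0 = 3" "p 1 = 4" "p 2 = 5" "p 3 = 0" "p 4 = 1" "p 5 = 2" "p 6 = 6" "p 7 = 7"
    by (simp_all add: p_def Transposition.transpose_def)
  have perm: "p permutes UNIV"
    unfolding p_def by (intro permutes_compose permutes_swap_id) auto
  have sgn: "sign p = -1"
    by (simp add: p_def sign_compose sign_swap_id permutation_swap_id permutation_compose)
  define T' where "T' = (\<chi> i. T $ p i)"
  have T': "det T' = - det T"
    unfolding T'_def det_permute_rows[OF perm] by (simp add: sgn)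
  have c1: "- {3, 4, 5} = {0, 1, 2, 6, 7::8}"
    using UNIV_8 by auto
  have c2: "- {6, 7} = {0, 1, 2, 3, 4, 5::8}"
    using UNIV_8 by auto
  have "det T' = det (blk {3, 4, 5} T') * det (blk {0, 1, 2, 6, 7} T')"
    unfolding c1[symmetric]
  proof (rule det_block)
    fix i j :: 8 assume i: "i \<in> {3, 4, 5}" and "j \<notin> {3, 4, 5}"
    then have "j \<in> {0, 1, 2, 6, 7}" using c1 by blast
    moreover have "p i \<in> {0, 1, 2}" using i by (auto simp: pv)
    ultimately show "T' $ i $ j = 0" using z(1) by (simp add: T'_def)
  qed
  also have "det (blk {0, 1, 2, 6, 7} T') = det (blk {6, 7} (blk {0, 1, 2, 6, 7} T')) * det (blk (- {6, 7}) (blk {0, 1, 2, 6, 7} T'))"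
  proof (rule det_block)
    fix i j :: 8 assume i: "i \<in> {6, 7}" and "j \<notin> {6, 7}"
    then have j: "j \<in> {0, 1, 2, 3, 4, 5}" using c2 by blast
    then have "j \<in> {0, 1, 2} \<or> j \<in> {3, 4, 5}" by auto
    then show "blk {0, 1, 2, 6, 7} T' $ i $ j = 0"
    proof
      assume j: "j \<in> {0, 1, 2}"
      have "p i = i" using i pv by blast
      then have "T' $ i $ j = 0" using z(2)[OF i j] by (simp add: T'_def)
      moreover have "i \<noteq> j" using i j by auto
      ultimately show ?thesis by (simp add: blk_def)
    next
      assume j: "j \<in> {3, 4, 5}"
      then have "i \<noteq> j" "j \<notin> {0, 1, 2, 6, 7}" using i by auto
      then show ?thesis by (simp add: blk_def)
    qed
  qed
  also have "blk {6, 7} (blk {0, 1, 2, 6, 7} T') = blk {6, 7} T'" by (rule blk_blk) auto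
  also have "blk (- {6, 7}) (blk {0, 1, 2, 6, 7} T') = blk {0, 1, 2} T'"
    unfolding c2 by (auto simp: blk_def vec_eq_iff)
  finally have "det T' = det (blk {3, 4, 5} T') * (det (blk {6, 7} T') * det (blk {0, 1, 2} T'))" .
  also have "det (blk {3, 4, 5} T') = minor3 (\<lambda>i j. T $ i $ j) 3 4 5"
    by (subst det_blk_3) (simp_all add: T'_def pv minor3_def)
  also have "det (blk {6, 7} T') = T $ 6 $ 6 * T $ 7 $ 7 - T $ 6 $ 7 * T $ 7 $ 6"
    by (subst det_blk_2) (simp_all add: T'_def pv)
  also have "det (blk {0, 1, 2} T') = minor3 (\<lambda>i j. T $ j $ i) 3 4 5"
    by (subst det_blk_3) (simp_all add: T'_def pv minor3_def det3_def algebra_simps)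
  finally show ?thesis using T' by (simp add: algebra_simps)
qed

lemma gram_entry: "(Finite_Cartesian_Product.transpose V ** A ** V) $ i $ j = bl A (column i V) (column j V)"
proof -
  have "(Finite_Cartesian_Product.transpose V ** A ** V) $ i $ j
      = (\<Sum>k\<in>UNIV. Finite_Cartesian_Product.transpose V $ i $ k * (A ** V) $ k $ j)"
    unfolding matrix_mul_assoc[symmetric] by (simp add: matrix_matrix_mult_def)
  also have "\<dots> = bl A (column i V) (column j V)"
    by (simp add: bl_def column_def transpose_def matrix_matrix_mult_def matrix_vector_mult_def)
  finally show ?thesis .
qed

lemma bl_axis: "bl A (axis i 1) y = (A *v y) $ i"
proof -
  have "bl A (axis i 1) y = (\<Sum>k\<in>UNIV. if k = i then (A *v y) $ i else 0)"
    unfolding bl_def by (intro sum.cong) (auto simp: axis_def)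
  then show ?thesis by simp
qed

lemma matrix_mult_axis: "(A *v axis j 1) $ i = A $ i $ j"
  for A :: "complex^8^8"
  by (simp add: matrix_vector_mult_def axis_def if_distrib[of "\<lambda>x. _ * x"] cong: if_cong)

text \<open>The Gram matrix in the basis \<open>e\<^sub>0, \<dots>, e\<^sub>5, k, l\<close>: the restriction of the quadric to the two-dimensional
  space of \<open>P\<close>-orthogonal vectors modulo \<open>P\<close> carries the discriminant.\<close>

lemma det_in_frame:
  assumes A: "in_frame A" and m: "mB A \<noteq> 0"
  shows "(mB A)\<^sup>2 * det A = (be A)\<^sup>2 - al A * ga A"
proof -
  define V :: "complex^8^8" where "V = (\<chi> i j. if j = 6 then kv A $ i else if j = 7 then lv A $ i else if i = j then 1 else 0)"
  define T where "T = Finite_Cartesian_Product.transpose V ** A ** V"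
  have col: "column 6 V = kv A" "column 7 V = lv A" "j \<noteq> 6 \<Longrightarrow> j \<noteq> 7 \<Longrightarrow> column j V = axis j 1" for j
    by (auto simp: V_def column_def vec_eq_iff axis_def)
  have tr: "Finite_Cartesian_Product.transpose A = A" using A by (simp add: in_frame_def)
  have T1: "T $ i $ j = A $ i $ j" if "i \<notin> {6, 7}" "j \<notin> {6, 7}" for i j
    using that unfolding T_def gram_entry by (simp add: col bl_axis matrix_mult_axis)
  have T2: "T $ i $ 6 = 0" "T $ i $ 7 = 0" "T $ 6 $ i = 0" "T $ 7 $ i = 0" if "i \<in> {0, 1, 2}" for i
    using that kv_ker[OF A] lv_ker[OF A] unfolding T_def gram_entry
    by (auto simp: col bl_axis bl_commute[OF tr, of "kv A" "axis _ 1"] bl_commute[OF tr, of "lv A" "axis _ 1"])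
  have T3: "T $ 6 $ 6 = al A" "T $ 6 $ 7 = be A" "T $ 7 $ 6 = be A" "T $ 7 $ 7 = ga A"
    unfolding T_def gram_entry col al_def be_def ga_def by (simp_all add: bl_commute[OF tr, of "lv A" "kv A"])
  have z: "A $ i $ j = 0" if "i \<in> {0, 1, 2}" "j \<in> {0, 1, 2}" for i j
    using A that unfolding in_frame_def by blast
  have "det T = - (minor3 (\<lambda>i j. T $ i $ j) 3 4 5 * minor3 (\<lambda>i j. T $ j $ i) 3 4 5
    * (T $ 6 $ 6 * T $ 7 $ 7 - T $ 6 $ 7 * T $ 7 $ 6))"
  proof (rule det_hyperbolic_block)
    fix i j :: 8 assume i: "i \<in> {0, 1, 2}" and j: "j \<in> {0, 1, 2, 6, 7}"
    consider "j \<in> {0, 1, 2}" | "j = 6" | "j = 7" using j by blast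
    then show "T $ i $ j = 0"
    proof cases
      case 1
      then have "i \<notin> {6, 7}" "j \<notin> {6, 7}" using i by auto
      then show ?thesis using T1 z i 1 by simp
    qed (use T2 i in auto)
  next
    fix i j :: 8 assume "i \<in> {6, 7}" "j \<in> {0, 1, 2}"
    then show "T $ i $ j = 0" using T2[of j] by blast
  qed
  also have "minor3 (\<lambda>i j. T $ i $ j) 3 4 5 = mB A"
    by (simp add: mB_def minor3_def T1)
  also have "minor3 (\<lambda>i j. T $ j $ i) 3 4 5 = mB A"
    using in_frame_sym[OF A, of 3] in_frame_sym[OF A, of 4] in_frame_sym[OF A, of 5]
    by (simp add: mB_def minor3_def T1)
  finally have "det T = (mB A)\<^sup>2 * ((be A)\<^sup>2 - al A * ga A)"
    by (simp add: T3 power2_eq_square algebra_simps)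
  moreover have "det T = (det V)\<^sup>2 * det A"
    by (simp add: T_def det_mul power2_eq_square)
  \<comment> \<open>Columns 6 and 7 of \<open>V\<close> meet rows 6 and 7 in the diagonal matrix
    with entries \<open>mB A\<close>. Thus \<open>det T\<close> carries the fourth power of
    \<open>mB A\<close> from \<open>V\<close> and the second from the blocks, and one square
    cancels.\<close>
  moreover have "det V = (mB A)\<^sup>2"
  proof -
    have "det V = det (blk {6, 7} V) * det (blk (- {6, 7}) V)"
      by (rule det_block) (auto simp: V_def kv_def lv_def Let_def)
    also have "blk (- {6, 7}) V = mat 1"
      by (auto simp: blk_def V_def mat_def vec_eq_iff)
    also have "det (blk {6, 7} V) = (mB A)\<^sup>2"
      by (subst det_blk_2) (simp_all add: V_def kv_def lv_def Let_def power2_eq_square)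
    finally show ?thesis by simp
  qed
  ultimately have "(mB A)\<^sup>2 * ((mB A)\<^sup>2 * det A) = (mB A)\<^sup>2 * ((be A)\<^sup>2 - al A * ga A)"
    by (simp add: power2_eq_square mult.assoc)
  then show ?thesis using m by (subst (asm) mult_left_cancel) auto
qed

section \<open>The two rational maps\<close>

definition smat :: "complex \<Rightarrow> complex^8^8 \<Rightarrow> complex^8^8" where
  "smat t A = (\<chi> i j. t * A $ i $ j)"

lemma smat_nth: "smat t A $ i $ j = t * A $ i $ j"
  by (simp add: smat_def)

lemma pencil_scale: "pencil Q (t *s l) = smat t (pencil Q l)"
  by (simp add: smat_def pencil_def vec_eq_iff sum_distrib_left mult.assoc)

lemma smat_mult: "smat t A *v x = t *s (A *v x)"
  by (simp add: smat_def matrix_vector_mult_def vec_eq_iff sum_distrib_left mult.assoc)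

lemma bl_smat: "bl (smat t A) x y = t * bl A x y"
  by (simp add: bl_def smat_mult sum_distrib_left mult_ac)

lemma minor3_scale: "minor3 (\<lambda>i j. t * M i j) a b c = t ^ 3 * minor3 M a b c"
  by (simp add: minor3_def det3_def power3_eq_cube algebra_simps)

lemma mB_smat: "mB (smat t A) = t ^ 3 * mB A"
  by (simp add: mB_def smat_nth minor3_scale)

lemma kv_smat: "kv (smat t A) = t ^ 3 *s kv A"
  by (simp add: kv_def Let_def smat_nth minor3_scale mB_smat vec_eq_iff all_8)

lemma lv_smat: "lv (smat t A) = t ^ 3 *s lv A"
  by (simp add: lv_def Let_def smat_nth minor3_scale mB_smat vec_eq_iff all_8)

lemma be_smat: "be (smat t A) = t ^ 7 * be A"
  by (simp add: be_def kv_smat lv_smat bl_smat bl_bilinear) (simp add: eval_nat_numeral)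

lemma ga_smat: "ga (smat t A) = t ^ 7 * ga A"
  by (simp add: ga_def lv_smat bl_smat bl_bilinear) (simp add: eval_nat_numeral)

lemma det_smat: "det (smat t A) = t ^ 8 * det A"
proof -
  have "smat t A = (\<chi> i. t *s A $ i)" by (simp add: smat_def vec_eq_iff)
  then show ?thesis by (simp add: det_rows_mul)
qed

lemma mult_scale: "A *v (t *s x) = t *s (A *v x)" for A :: "complex^8^8"
  by (simp add: vector_scalar_commute)

lemma lam_scale: "lam Q (t *s x) = t ^ 3 *s lam Q x"
  by (simp add: lam_def Let_def mult_scale minor3_scale vec_eq_iff all_4')

lemma frame_webD: "frame_web Q \<Longrightarrow> in_frame (Q $ k)"
  by (simp add: frame_web_def)

lemma lam_ypart: "frame_web Q \<Longrightarrow> lam Q (ypart x) = lam Q x"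
  by (simp add: lam_def Let_def minor3_def in_frame_ypart[OF frame_webD])

text \<open>The quadratic formula for \<open>al s^2 + 2 be s t + ga t^2 = 0\<close> with
  \<open>s = ga\<close>: then \<open>t = - be + mB w\<close>, as
  \<open>(mB w)^2 = be^2 - al ga\<close> when \<open>w\<close> is a square root of the determinant.
  The opposite \<open>w\<close> gives the other isotropic line.\<close>

definition isovec :: "complex^8^8 \<Rightarrow> complex \<Rightarrow> complex^8" where
  "isovec A w = ga A *s kv A + (mB A * w - be A) *s lv A"

lemma isovec_smat: "isovec (smat t A) (t ^ 4 * w) = t ^ 10 *s isovec A w"
  by (simp add: isovec_def mB_smat be_smat ga_smat kv_smat lv_smat vec_eq_iff)
    (simp add: algebra_simps flip: power_add)

lemma isovec_ker:
  assumes "in_frame A"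
  shows "(A *v isovec A w) $ 0 = 0" "(A *v isovec A w) $ 1 = 0" "(A *v isovec A w) $ 2 = 0"
proof -
  define s where "s = mB A * w - be A"
  show "(A *v isovec A w) $ 0 = 0" "(A *v isovec A w) $ 1 = 0" "(A *v isovec A w) $ 2 = 0"
    using kv_ker[OF assms] lv_ker[OF assms] unfolding isovec_def s_def[symmetric]
    by (simp_all add: matrix_vector_right_distrib mult_scale)
qed

lemma isovec_isotropic:
  assumes "in_frame A" "mB A \<noteq> 0" "w\<^sup>2 = det A"
  shows "qf A (isovec A w) = 0"
proof -
  have tr: "Finite_Cartesian_Product.transpose A = A" using assms by (simp add: in_frame_def)
  define s where "s = mB A * w - be A"
  have "qf A (isovec A w) = (ga A)\<^sup>2 * al A + 2 * ga A * (mB A * w - be A) * be A + (mB A * w - be A)\<^sup>2 * ga A"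
    unfolding qf_eq_bl isovec_def s_def[symmetric]
    by (simp add: bl_bilinear bl_commute[OF tr, of "lv A" "kv A"] al_def[symmetric] be_def[symmetric] ga_def[symmetric])
      (simp add: power2_eq_square algebra_simps)
  also have "\<dots> = ga A * (ga A * al A - (be A)\<^sup>2 + (mB A)\<^sup>2 * w\<^sup>2)"
    by (simp add: power2_eq_square algebra_simps)
  also have "\<dots> = 0" using det_in_frame[OF assms(1,2)] assms(3) by (simp add: algebra_simps)
  finally show ?thesis .
qed

lemma isovec_nth: "isovec A w $ 0 = 0" "isovec A w $ 1 = 0" "isovec A w $ 2 = 0"
  "isovec A w $ 6 = ga A * mB A" "isovec A w $ 7 = (mB A * w - be A) * mB A"
  by (simp_all add: isovec_def kv_def lv_def Let_def left_diff_distrib)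

text \<open>For \<open>y\<close> in the span of \<open>e\<^sub>3, \<dots>, e\<^sub>7\<close>, the point of \<open>y + P\<close> on the first three quadrics
  is given by Cramer's rule.\<close>

definition lift :: "complex^8^8^4 \<Rightarrow> complex^8 \<Rightarrow> complex^8" where
  "lift Q y = (let M = (\<lambda>i k. (Q $ k *v y) $ i); N = minor3 M 0 1 2; c = (\<lambda>k. - qf (Q $ k) y) in
     vec8 (det3 (c 0) (c 1) (c 2) (M 1 0) (M 1 1) (M 1 2) (M 2 0) (M 2 1) (M 2 2))
       (det3 (M 0 0) (M 0 1) (M 0 2) (c 0) (c 1) (c 2) (M 2 0) (M 2 1) (M 2 2))
       (det3 (M 0 0) (M 0 1) (M 0 2) (M 1 0) (M 1 1) (M 1 2) (c 0) (c 1) (c 2))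
       (2 * N * y $ 3) (2 * N * y $ 4) (2 * N * y $ 5) (2 * N * y $ 6) (2 * N * y $ 7))"

lemma lift_scale: "lift Q (t *s y) = t ^ 4 *s lift Q y"
  by (simp add: lift_def Let_def mult_scale minor3_scale qf_scale vec_eq_iff all_8)
    (simp add: det3_def eval_nat_numeral algebra_simps)

text \<open>By \<open>qf_frame_split\<close>, the coordinates 0 to 2 of a point on the three
  quadrics solve the linear system that \<open>lift\<close> solves by Cramer's rule; the common
  denominator appears as the scalar.\<close>

lemma lift_ypart:
  assumes Q: "frame_web Q" and q: "qf (Q $ 0) x = 0" "qf (Q $ 1) x = 0" "qf (Q $ 2) x = 0"
  shows "lift Q (ypart x) = (- 2 * lam Q x $ 3) *s x"
proof -
  define M where "M = (\<lambda>i k. (Q $ k *v x) $ i)"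
  have c: "- qf (Q $ k) (ypart x) = 2 * (x $ 0 * M 0 k + x $ 1 * M 1 k + x $ 2 * M 2 k)"
    if "qf (Q $ k) x = 0" for k
    using qf_frame_split[OF frame_webD[OF Q], of k x] that by (simp add: M_def add_eq_0_iff2)
  have l: "lam Q x $ 3 = - minor3 M 0 1 2" by (simp add: lam_def Let_def M_def)
  show ?thesis
    unfolding lift_def Let_def c[OF q(1)] c[OF q(2)] c[OF q(3)] in_frame_ypart[OF frame_webD[OF Q]] l
    unfolding minor3_def in_frame_ypart[OF frame_webD[OF Q]]
    by (simp add: vec_eq_iff all_8 ypart_def flip: M_def fun_cong[OF fun_cong[OF M_def]])
      (simp add: det3_def algebra_simps)
qed

lemma ypart_lift: "y $ 0 = 0 \<Longrightarrow> y $ 1 = 0 \<Longrightarrow> y $ 2 = 0 \<Longrightarrow> ypart (lift Q y) = (- 2 * lam Q y $ 3) *s y"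
  by (simp add: ypart_def lift_def lam_def Let_def vec_eq_iff all_8)

lemma det3_cramer:
  "det3 c0 c1 c2 b0 b1 b2 d0 d1 d2 * a0 + det3 a0 a1 a2 c0 c1 c2 d0 d1 d2 * b0 + det3 a0 a1 a2 b0 b1 b2 c0 c1 c2 * d0
    = c0 * det3 a0 a1 a2 b0 b1 b2 d0 d1 d2"
  "det3 c0 c1 c2 b0 b1 b2 d0 d1 d2 * a1 + det3 a0 a1 a2 c0 c1 c2 d0 d1 d2 * b1 + det3 a0 a1 a2 b0 b1 b2 c0 c1 c2 * d1
    = c1 * det3 a0 a1 a2 b0 b1 b2 d0 d1 d2"
  "det3 c0 c1 c2 b0 b1 b2 d0 d1 d2 * a2 + det3 a0 a1 a2 c0 c1 c2 d0 d1 d2 * b2 + det3 a0 a1 a2 b0 b1 b2 c0 c1 c2 * d2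
    = c2 * det3 a0 a1 a2 b0 b1 b2 d0 d1 d2"
  by (simp_all add: det3_def algebra_simps)

text \<open>Restricted to a translate of \<open>P\<close> each quadric is affine linear, so three of
  them impose a 3 by 3 linear system, and \<open>det3_cramer\<close> verifies its solution.\<close>

lemma qf_lift:
  assumes Q: "frame_web Q" and y: "y $ 0 = 0" "y $ 1 = 0" "y $ 2 = 0" and k: "k \<in> {0, 1, 2}"
  shows "qf (Q $ k) (lift Q y) = 0"
proof -
  define M where "M = (\<lambda>i k. (Q $ k *v y) $ i)"
  define c where "c = (\<lambda>k. - qf (Q $ k) y)"
  define N where "N = minor3 M 0 1 2"
  have yl: "ypart (lift Q y) = (2 * N) *s y"
    unfolding ypart_lift[OF y] by (simp add: lam_def Let_def N_def M_def)
  have M: "(Q $ k *v lift Q y) $ i = 2 * N * M i k" if "i \<in> {0, 1, 2}" for i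
    using in_frame_ypart[OF frame_webD[OF Q], of k "lift Q y"] that unfolding yl mult_scale
    by (auto simp: M_def)
  have l: "lift Q y $ 0 = det3 (c 0) (c 1) (c 2) (M 1 0) (M 1 1) (M 1 2) (M 2 0) (M 2 1) (M 2 2)"
    "lift Q y $ 1 = det3 (M 0 0) (M 0 1) (M 0 2) (c 0) (c 1) (c 2) (M 2 0) (M 2 1) (M 2 2)"
    "lift Q y $ 2 = det3 (M 0 0) (M 0 1) (M 0 2) (M 1 0) (M 1 1) (M 1 2) (c 0) (c 1) (c 2)"
    by (simp_all add: lift_def Let_def M_def c_def)
  have s: "lift Q y $ 0 * M 0 k + lift Q y $ 1 * M 1 k + lift Q y $ 2 * M 2 k = c k * N"
    using k unfolding l N_def minor3_def by (auto simp: det3_cramer)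
  have "qf (Q $ k) (lift Q y) = 2 * (lift Q y $ 0 * (2 * N * M 0 k) + lift Q y $ 1 * (2 * N * M 1 k)
      + lift Q y $ 2 * (2 * N * M 2 k)) + 4 * N\<^sup>2 * qf (Q $ k) y"
    unfolding qf_frame_split[OF frame_webD[OF Q], of k "lift Q y"] yl qf_scale using M by (simp add: power_mult_distrib)
  also have "\<dots> = 4 * N * (lift Q y $ 0 * M 0 k + lift Q y $ 1 * M 1 k + lift Q y $ 2 * M 2 k)
      + 4 * N\<^sup>2 * qf (Q $ k) y"
    by (simp add: algebra_simps)
  also have "\<dots> = 0" unfolding s by (simp add: c_def power2_eq_square)
  finally show ?thesis .
qed

text \<open>The point of the cover is \<open>(l, w)\<close> with
  \<open>w = (x $ 7 * ga A + x $ 6 * be A) / e\<close>; acting on it by \<open>e\<close> with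
  weights 1, 1, 1, 1, 4 clears the denominator.\<close>

definition Phi :: "complex^8^8^4 \<Rightarrow> complex^8 \<Rightarrow> complex^5" where
  "Phi Q x = (let l = lam Q x; A = pencil Q l; e = mB A * x $ 6 in
     vec5 (e * l $ 0) (e * l $ 1) (e * l $ 2) (e * l $ 3) (e ^ 3 * (x $ 7 * ga A + x $ 6 * be A)))"

definition Psi :: "complex^8^8^4 \<Rightarrow> complex^5 \<Rightarrow> complex^8" where
  "Psi Q z = lift Q (isovec (pencil Q (zlam z)) (z $ 4))"

text \<open>\<open>x $ 6\<close> and \<open>mB\<close> make the denominator \<open>e\<close> of
  \<open>Phi\<close> nonzero, \<open>ga\<close> makes the isotropic vector a nonzero multiple of
  \<open>ypart x\<close>, and \<open>lam Q x $ 3\<close> is the Cramer denominator of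
  \<open>lift\<close>.\<close>

definition hU :: "complex^8^8^4 \<Rightarrow> complex^8 \<Rightarrow> complex" where
  "hU Q x = (let A = pencil Q (lam Q x) in x $ 6 * lam Q x $ 3 * mB A * ga A)"

text \<open>With \<open>z $ 3\<close> nonzero, the fourth quadric vanishes wherever the first three
  and the quadric at \<open>zlam z\<close> do. The last factor is the Cramer denominator of
  \<open>lift\<close>.\<close>

definition hV :: "complex^8^8^4 \<Rightarrow> complex^5 \<Rightarrow> complex" where
  "hV Q z = (let A = pencil Q (zlam z) in z $ 3 * mB A * ga A * lam Q (isovec A (z $ 4)) $ 3)"

lemma wact_wZ_nth [simp]: "wact wZ t z $ 0 = t * z $ 0" "wact wZ t z $ 1 = t * z $ 1" "wact wZ t z $ 2 = t * z $ 2"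
  "wact wZ t z $ 3 = t * z $ 3" "wact wZ t z $ 4 = t ^ 4 * z $ 4"
  by (simp_all add: wact_def wZ_def)

lemma zlam_wact: "zlam (wact wZ t z) = t *s zlam z"
  by (simp add: vec_eq_iff all_4')

lemma wact_one: "wact (\<lambda>_. 1) t x = t *s x"
  by (simp add: wact_def vec_eq_iff)

text \<open>\<open>isovec\<close> has weighted degree 10 = 7 + 3 and \<open>lift\<close> has degree
  4.\<close>

lemma Psi_wact: "Psi Q (wact wZ t z) = t ^ 40 *s Psi Q z"
  by (simp add: Psi_def zlam_wact pencil_scale isovec_smat lift_scale flip: power_mult)

text \<open>The factors contribute 41 = 1 + 3 + 7 + 3 * 10.\<close>

lemma hV_wact: "hV Q (wact wZ t z) = t ^ 41 * hV Q z"
proof -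
  have p: "t * (t ^ 3 * (t ^ 7 * ((t ^ 10) ^ 3 * a))) = t ^ 41 * a" for a
    by (simp add: mult.assoc[symmetric] flip: power_mult power_Suc2 power_add power_Suc)
  show ?thesis
    unfolding hV_def Let_def zlam_wact pencil_scale mB_smat ga_smat wact_wZ_nth isovec_smat lam_scale
    using p by (simp add: mult_ac)
qed

text \<open>\<open>lam\<close> has degree 3, hence \<open>mB\<close> has degree 9, \<open>be\<close>
  and \<open>ga\<close> have degree 21, and \<open>e\<close> has degree 10. This gives 10 + 3 = 13
  in the first four coordinates and 3 * 10 + 1 + 21 = 4 * 13 in the last.\<close>

lemma Phi_scale: "Phi Q (t *s x) = wact wZ (t ^ 13) (Phi Q x)"
proof -
  have 1: "(t ^ 3) ^ 3 * a * (t * b) * (t ^ 3 * c) = t ^ 13 * (a * b * c)" for a b c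
    by (simp add: mult_ac flip: power_mult power_add) (simp add: eval_nat_numeral)
  have 2: "((t ^ 3) ^ 3 * a * (t * b)) ^ 3 * (t * c * ((t ^ 3) ^ 7 * d) + t * b * ((t ^ 3) ^ 7 * f))
      = (t ^ 13) ^ 4 * ((a * b) ^ 3 * (c * d + b * f))" for a b c d f
  proof -
    have "t ^ 52 = t * t ^ 51" by (simp flip: power_Suc)
    then show ?thesis
      by (simp add: power_mult_distrib ring_distribs mult_ac flip: power_mult)
  qed
  show ?thesis
    unfolding Phi_def Let_def lam_scale pencil_scale mB_smat ga_smat be_smat
    by (simp only: vec_eq_iff all_5 vec5_nth wact_wZ_nth vector_smult_component 1 2 simp_thms)
qed

lemma hU_scale: "hU Q (t *s x) = t ^ 34 * hU Q x"
proof -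
  have "t * b * (t ^ 3 * c) * ((t ^ 3) ^ 3 * a) * ((t ^ 3) ^ 7 * d) = t ^ 34 * (b * c * a * d)" for a b c d
    by (simp add: mult_ac flip: power_mult) (simp add: mult.assoc[symmetric] flip: power_add power_Suc power_Suc2)
  then show ?thesis
    unfolding hU_def Let_def lam_scale pencil_scale mB_smat ga_smat by simp
qed

lemma wact_wact: "wact w s (wact w t z) = wact w (s * t) z"
  by (simp add: wact_def vec_eq_iff power_mult_distrib)

lemma wact_id: "wact w 1 z = z"
  by (simp add: wact_def vec_eq_iff)

lemma wact_eq_zero_iff: "t \<noteq> 0 \<Longrightarrow> wact w t z = 0 \<longleftrightarrow> z = 0"
  by (auto simp: wact_def vec_eq_iff)

lemma double_cover_wact:
  assumes "z \<in> double_cover Q" "t \<noteq> 0"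
  shows "wact wZ t z \<in> double_cover Q"
  using assms unfolding double_cover_def
  by (auto simp: wact_eq_zero_iff zlam_wact pencil_scale det_smat power_mult_distrib simp flip: power_mult)

section \<open>The two maps are mutually inverse on the open sets\<close>

lemma Phi_on_U:
  assumes Q: "frame_web Q" and x: "x \<in> base_locus Q" and h: "hU Q x \<noteq> 0"
  shows "Phi Q x \<in> double_cover Q" "hV Q (Phi Q x) \<noteq> 0" "\<exists>c. c \<noteq> 0 \<and> Psi Q (Phi Q x) = c *s x"
proof -
  define l where "l = lam Q x"
  define A where "A = pencil Q l"
  define e where "e = mB A * x $ 6"
  have nz: "x $ 6 \<noteq> 0" "l $ 3 \<noteq> 0" "mB A \<noteq> 0" "ga A \<noteq> 0"
    using h by (auto simp: hU_def Let_def l_def A_def)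
  then have e: "e \<noteq> 0" by (simp add: e_def)
  \<comment> \<open>The value for which coordinates 6 and 7 of \<open>isovec A w\<close> are in the
    ratio \<open>x $ 6 : x $ 7\<close>.\<close>
  define w where "w = (x $ 7 * ga A + x $ 6 * be A) / e"
  define z where "z = vec5 (l $ 0) (l $ 1) (l $ 2) (l $ 3) w"
  have zl: "zlam z = l" by (simp add: vec_eq_iff all_4' z_def)
  have Phi: "Phi Q x = wact wZ e z"
    using e by (simp add: Phi_def Let_def vec_eq_iff all_5 z_def w_def flip: l_def A_def e_def)
      (simp add: eval_nat_numeral)
  have A: "in_frame A" unfolding A_def by (rule in_frame_pencil[OF Q])
  have tr: "Finite_Cartesian_Product.transpose A = A" using A by (simp add: in_frame_def)
  have ker: "(A *v x) $ 0 = 0" "(A *v x) $ 1 = 0" "(A *v x) $ 2 = 0"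
    unfolding A_def l_def by (rule lam_ker)+
  have qx: "qf (Q $ k) x = 0" for k using x by (simp add: base_locus_def)
  have "qf A x = 0" unfolding A_def qf_eq_bl bl_pencil using qx by (simp add: qf_eq_bl)
  then have iso: "qf A (ypart x) = 0" using qf_frame_split[OF A, of x] ker by simp
  have sp: "mB A *s ypart x = x $ 6 *s kv A + x $ 7 *s lv A" by (rule ker_spanned[OF A ker])
  have "qf A (mB A *s ypart x) = 0" using iso by (simp add: qf_scale)
  then have "(x $ 6)\<^sup>2 * al A + 2 * x $ 6 * x $ 7 * be A + (x $ 7)\<^sup>2 * ga A = 0"
    unfolding sp qf_eq_bl
    by (simp add: bl_bilinear bl_commute[OF tr, of "lv A" "kv A"] al_def[symmetric] be_def[symmetric] ga_def[symmetric])
      (simp add: power2_eq_square algebra_simps)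
  \<comment> \<open>Multiply by \<open>ga A\<close> and complete the square.\<close>
  then have "(x $ 7 * ga A + x $ 6 * be A)\<^sup>2 = (x $ 6)\<^sup>2 * ((be A)\<^sup>2 - al A * ga A)"
    by algebra
  also have "\<dots> = e\<^sup>2 * det A"
    using det_in_frame[OF A nz(3)] by (simp add: e_def power_mult_distrib)
  finally have w: "w\<^sup>2 = det A" using e by (simp add: w_def power_divide)
  have "z \<noteq> 0" using nz(2) by (auto simp: z_def vec_eq_iff all_5)
  moreover have "z $ 4 = w" by (simp add: z_def)
  ultimately have zD: "z \<in> double_cover Q" using w by (simp add: double_cover_def zl A_def)
  define s where "s = ga A * mB A / x $ 6"
  have s: "s \<noteq> 0" using nz by (simp add: s_def)
  have c1: "mB A * w - be A = ga A / x $ 6 * x $ 7" using nz by (simp add: w_def e_def field_simps)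
  have isov: "isovec A w = s *s ypart x"
  proof -
    have "isovec A w = (ga A / x $ 6) *s (x $ 6 *s kv A + x $ 7 *s lv A)"
      unfolding isovec_def c1 using nz by (simp add: vec_eq_iff field_simps)
    also have "\<dots> = s *s ypart x" unfolding sp[symmetric] by (simp add: s_def)
    finally show ?thesis .
  qed
  have "hV Q z \<noteq> 0"
    unfolding hV_def Let_def zl A_def[symmetric] using nz s
    by (simp add: z_def isov lam_scale lam_ypart[OF Q] l_def[symmetric])
  then show "hV Q (Phi Q x) \<noteq> 0" using e by (simp add: Phi hV_wact)
  show "Phi Q x \<in> double_cover Q" unfolding Phi by (rule double_cover_wact[OF zD e])
  have "Psi Q z = (s ^ 4 * (- 2 * l $ 3)) *s x"
    unfolding Psi_def zl A_def[symmetric]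
    by (simp add: z_def isov lift_scale lift_ypart[OF Q qx qx qx] l_def)
  then have "Psi Q (Phi Q x) = (e ^ 40 * (s ^ 4 * (- 2 * l $ 3))) *s x"
    unfolding Phi Psi_wact by (simp add: vec_eq_iff mult.assoc)
  moreover have "e ^ 40 * (s ^ 4 * (- 2 * l $ 3)) \<noteq> 0" using e s nz by simp
  ultimately show "\<exists>c. c \<noteq> 0 \<and> Psi Q (Phi Q x) = c *s x" by blast
qed

lemma Psi_on_V:
  assumes Q: "frame_web Q" and z: "z \<in> double_cover Q" and h: "hV Q z \<noteq> 0"
  shows "Psi Q z \<in> base_locus Q" "hU Q (Psi Q z) \<noteq> 0" "\<exists>t. t \<noteq> 0 \<and> Phi Q (Psi Q z) = wact wZ t z"
proof -
  define l where "l = zlam z"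
  define w where "w = z $ 4"
  define A where "A = pencil Q l"
  define y where "y = isovec A w"
  define N where "N = - 2 * lam Q y $ 3"
  define x where "x = Psi Q z"
  have xl: "x = lift Q y" by (simp add: x_def Psi_def y_def A_def l_def w_def)
  have nz: "l $ 3 \<noteq> 0" "mB A \<noteq> 0" "ga A \<noteq> 0" "lam Q y $ 3 \<noteq> 0"
    using h by (auto simp: hV_def Let_def l_def A_def y_def w_def)
  then have N: "N \<noteq> 0" by (simp add: N_def)
  have A: "in_frame A" unfolding A_def by (rule in_frame_pencil[OF Q])
  have w2: "w\<^sup>2 = det A" using z by (simp add: double_cover_def w_def A_def l_def)
  have y0: "y $ 0 = 0" "y $ 1 = 0" "y $ 2 = 0" by (simp_all add: y_def isovec_nth)
  have yx: "ypart x = N *s y" unfolding xl ypart_lift[OF y0] by (simp add: N_def)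
  have yker: "(A *v y) $ 0 = 0" "(A *v y) $ 1 = 0" "(A *v y) $ 2 = 0"
    unfolding y_def by (rule isovec_ker[OF A])+
  have xker: "(A *v x) $ 0 = 0" "(A *v x) $ 1 = 0" "(A *v x) $ 2 = 0"
    using in_frame_ypart[OF A, of x] yker unfolding yx by (simp_all add: mult_scale)
  have q012: "qf (Q $ 0) x = 0" "qf (Q $ 1) x = 0" "qf (Q $ 2) x = 0"
    unfolding xl by (rule qf_lift[OF Q y0]; simp)+
  have "qf A x = 0"
    unfolding qf_frame_split[OF A, of x] xker yx qf_scale
    using isovec_isotropic[OF A nz(2) w2] by (simp add: y_def)
  \<comment> \<open>In the combination \<open>A\<close> of the four quadrics the first three terms
    vanish at \<open>x\<close>, so only the fourth is left.\<close>
  then have "l $ 3 * qf (Q $ 3) x = 0"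
    unfolding A_def qf_eq_bl bl_pencil sum_4' using q012 by (simp add: qf_eq_bl)
  then have q3: "qf (Q $ 3) x = 0" using nz by simp
  have x6: "x $ 6 = N * (ga A * mB A)" and x7: "x $ 7 = N * ((mB A * w - be A) * mB A)"
    using arg_cong[OF yx, of "\<lambda>v. v $ 6"] arg_cong[OF yx, of "\<lambda>v. v $ 7"]
    by (simp_all add: ypart_def y_def isovec_nth)
  have "x $ 6 \<noteq> 0" using nz N by (simp add: x6)
  then have "x \<noteq> 0" by auto
  then show "Psi Q z \<in> base_locus Q"
    unfolding x_def[symmetric] base_locus_def using q012 q3 by (simp add: all_4')
  define r where "r = N ^ 3 * (lam Q y $ 3 / l $ 3)"
  have r: "r \<noteq> 0" using N nz by (simp add: r_def)
  \<comment> \<open>\<open>pencil Q l *v y\<close> has zero components along 0 to 2, which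
    determines the parameter up to scale: this is how \<open>l\<close> is recovered from
    \<open>y\<close>.\<close>
  have "l $ 3 *s lam Q y = lam Q y $ 3 *s l"
    by (rule lam_proportional) (use yker in \<open>simp_all add: A_def\<close>)
  then have ly: "lam Q y = (lam Q y $ 3 / l $ 3) *s l"
    using nz by (simp add: vec_eq_iff field_simps)
  have lx: "lam Q x = r *s l"
    unfolding lam_ypart[OF Q, of x, symmetric] yx lam_scale by (subst ly) (simp add: r_def)
  have Ax: "pencil Q (r *s l) = smat r A" unfolding pencil_scale A_def ..
  show "hU Q (Psi Q z) \<noteq> 0"
    unfolding x_def[symmetric] hU_def Let_def lx Ax mB_smat ga_smat
    using nz r \<open>x $ 6 \<noteq> 0\<close> by simp
  define e where "e = r ^ 3 * mB A * x $ 6"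
  have e: "e \<noteq> 0" using r nz \<open>x $ 6 \<noteq> 0\<close> by (simp add: e_def)
  have w4: "e ^ 3 * (x $ 7 * (r ^ 7 * ga A) + x $ 6 * (r ^ 7 * be A)) = (e * r) ^ 4 * w"
  proof -
    have "x $ 7 * (r ^ 7 * ga A) + x $ 6 * (r ^ 7 * be A) = r ^ 7 * (N * (mB A * mB A) * ga A * w)"
      by (simp add: x6 x7 algebra_simps)
    also have "\<dots> = e * r ^ 4 * w" by (simp add: e_def x6 mult_ac flip: power_add)
    finally show ?thesis by (simp add: power_mult_distrib eval_nat_numeral mult_ac)
  qed
  have "Phi Q x = wact wZ (e * r) z"
    unfolding Phi_def Let_def lx Ax mB_smat ga_smat be_smat e_def[symmetric] w4
    by (simp add: vec_eq_iff all_5 w_def l_def)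
  then show "\<exists>t. t \<noteq> 0 \<and> Phi Q (Psi Q z) = wact wZ t z"
    unfolding x_def[symmetric] using e r by (intro exI[of _ "e * r"]) simp
qed

section \<open>Polynomiality of the maps and of the defining functions\<close>

lemma polyfn_if: "polyfn C f \<Longrightarrow> polyfn C g \<Longrightarrow> polyfn C (\<lambda>z. if b then f z else g z)"
  by (cases b) simp_all

lemma polyfn_minor3:
  assumes "\<And>i j. polyfn C (\<lambda>z. M z i j)"
  shows "polyfn C (\<lambda>z. minor3 (M z) a b c)"
  unfolding minor3_def det3_def by (intro polyfn_intros assms)

lemma polyfn_mult_vec:
  assumes "\<And>i j. polyfn C (\<lambda>z. A z $ i $ j)" "\<And>i. polyfn C (\<lambda>z. x z $ i)"
  shows "polyfn C (\<lambda>z. (A z *v x z) $ i)"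
  unfolding matrix_vector_mult_def using assms by (simp add: polyfn_intros)

lemma polyfn_bl:
  assumes "\<And>i j. polyfn C (\<lambda>z. A z $ i $ j)" "\<And>i. polyfn C (\<lambda>z. x z $ i)" "\<And>i. polyfn C (\<lambda>z. y z $ i)"
  shows "polyfn C (\<lambda>z. bl (A z) (x z) (y z))"
  unfolding bl_def by (intro polyfn_intros assms polyfn_mult_vec)

lemma polyfn_pencil:
  assumes "\<And>k i j. polyfn C (\<lambda>z. Q z $ k $ i $ j)" "\<And>k. polyfn C (\<lambda>z. l z $ k)"
  shows "polyfn C (\<lambda>z. pencil (Q z) (l z) $ i $ j)"
  unfolding pencil_nth by (intro polyfn_intros assms)

lemma polyfn_lam:
  assumes "\<And>k i j. polyfn C (\<lambda>z. Q z $ k $ i $ j)" "\<And>i. polyfn C (\<lambda>z. x z $ i)"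
  shows "polyfn C (\<lambda>z. lam (Q z) (x z) $ k)"
  unfolding lam_def Let_def vec4_def vec_lambda_beta
  by (intro polyfn_if polyfn_intros polyfn_minor3 polyfn_mult_vec assms)

context
  fixes C :: "('z \<Rightarrow> complex) set" and A :: "'z \<Rightarrow> complex^8^8"
  assumes A: "\<And>i j. polyfn C (\<lambda>z. A z $ i $ j)"
begin

lemma polyfn_mB: "polyfn C (\<lambda>z. mB (A z))"
  unfolding mB_def by (intro polyfn_minor3 A)

lemma polyfn_kv: "polyfn C (\<lambda>z. kv (A z) $ i)"
  unfolding kv_def Let_def vec8_def vec_lambda_beta
  by (intro polyfn_if polyfn_intros polyfn_minor3 polyfn_mB A)

lemma polyfn_lv: "polyfn C (\<lambda>z. lv (A z) $ i)"
  unfolding lv_def Let_def vec8_def vec_lambda_beta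
  by (intro polyfn_if polyfn_intros polyfn_minor3 polyfn_mB A)

lemma polyfn_be: "polyfn C (\<lambda>z. be (A z))"
  unfolding be_def by (intro polyfn_bl A polyfn_kv polyfn_lv)

lemma polyfn_ga: "polyfn C (\<lambda>z. ga (A z))"
  unfolding ga_def by (intro polyfn_bl A polyfn_lv)

lemma polyfn_isovec:
  assumes "polyfn C w"
  shows "polyfn C (\<lambda>z. isovec (A z) (w z) $ i)"
  unfolding isovec_def vector_add_component vector_smult_component
  by (intro polyfn_intros polyfn_kv polyfn_lv polyfn_be polyfn_ga polyfn_mB assms)

lemma polyfn_det: "polyfn C (\<lambda>z. det (A z))"
  unfolding det_def by (intro polyfn_intros A)

end

lemma polyfn_lift:
  assumes Q: "\<And>k i j. polyfn C (\<lambda>z. Q z $ k $ i $ j)" and y: "\<And>i. polyfn C (\<lambda>z. y z $ i)"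
  shows "polyfn C (\<lambda>z. lift (Q z) (y z) $ i)"
  unfolding lift_def Let_def vec8_def vec_lambda_beta qf_eq_bl det3_def
  by (intro polyfn_if polyfn_intros polyfn_minor3 polyfn_mult_vec polyfn_bl Q y)

lemma polyfn_hU:
  assumes "\<And>k i j. polyfn C (\<lambda>z. Q z $ k $ i $ j)" "\<And>i. polyfn C (\<lambda>z. x z $ i)"
  shows "polyfn C (\<lambda>z. hU (Q z) (x z))"
  unfolding hU_def Let_def
  by (intro polyfn_intros polyfn_mB polyfn_ga polyfn_pencil polyfn_lam assms)

lemma polyfn_zlam:
  assumes "\<And>i. i \<noteq> 4 \<Longrightarrow> polyfn C (\<lambda>z. x z $ i)"
  shows "polyfn C (\<lambda>z. zlam (x z) $ i)"
  unfolding zlam_def vec_lambda_beta by (intro polyfn_if assms) simp_all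

lemma polyfn_hV:
  assumes "\<And>k i j. polyfn C (\<lambda>z. Q z $ k $ i $ j)" "\<And>i. polyfn C (\<lambda>z. x z $ i)"
  shows "polyfn C (\<lambda>z. hV (Q z) (x z))"
  unfolding hV_def Let_def
  by (intro polyfn_intros polyfn_mB polyfn_ga polyfn_pencil polyfn_lam polyfn_isovec polyfn_zlam assms)

lemma wmap_Phi: "wmap (\<lambda>_. 1) wZ (Phi Q)"
  unfolding wmap_def whom_def
proof (intro exI[of _ 13] allI conjI impI)
  fix j :: 5
  show "polyfn vcoords (\<lambda>x. Phi Q x $ j)"
    unfolding Phi_def Let_def vec5_def vec_lambda_beta
    by (intro polyfn_if polyfn_intros polyfn_mB polyfn_ga polyfn_be polyfn_pencil polyfn_lam polyfn_vcoord)
  fix t :: complex and x :: "complex^8"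
  show "Phi Q (wact (\<lambda>_. 1) t x) $ j = t ^ (13 * wZ j) * Phi Q x $ j"
    unfolding wact_one Phi_scale by (simp add: wact_def power_mult)
qed

lemma wmap_Psi: "wmap wZ (\<lambda>_. 1) (Psi Q)"
  unfolding wmap_def whom_def
proof (intro exI[of _ 40] allI conjI impI)
  fix j :: 8
  show "polyfn vcoords (\<lambda>z. Psi Q z $ j)"
    unfolding Psi_def
    by (intro polyfn_lift polyfn_isovec polyfn_pencil polyfn_zlam polyfn_vcoord pf_const)
  fix t :: complex and z :: "complex^5"
  show "Psi Q (wact wZ t z) $ j = t ^ (40 * 1) * Psi Q z $ j"
    unfolding Psi_wact by simp
qed

lemma birational_frame:
  assumes Q: "frame_web Q"
    and dU: "wdense (\<lambda>_. 1) (base_locus Q) {x \<in> base_locus Q. hU Q x \<noteq> 0}"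
    and dV: "wdense wZ (double_cover Q) {z \<in> double_cover Q. hV Q z \<noteq> 0}"
    and ne: "\<exists>z\<in>double_cover Q. hV Q z \<noteq> 0"
  shows "birational (\<lambda>_. 1) (base_locus Q) wZ (double_cover Q)"
proof -
  let ?U = "{x \<in> base_locus Q. hU Q x \<noteq> 0}" and ?V = "{z \<in> double_cover Q. hV Q z \<noteq> 0}"
  have oU: "wopen_in (\<lambda>_. 1) (base_locus Q) ?U"
    unfolding wopen_in_def whom_def
    by (intro exI[of _ "{hU Q}"])
      (auto simp: wact_one[unfolded One_nat_def] hU_scale intro!: exI[of _ 34] polyfn_hU pf_const polyfn_vcoord)
  have oV: "wopen_in wZ (double_cover Q) ?V"
    unfolding wopen_in_def whom_def
    by (intro exI[of _ "{hV Q}"])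
      (auto simp: hV_wact intro!: exI[of _ 41] polyfn_hV pf_const polyfn_vcoord)
  have U: "Phi Q x \<in> ?V \<and> wequiv (\<lambda>_. 1) (Psi Q (Phi Q x)) x" if "x \<in> ?U" for x
  proof -
    have x: "x \<in> base_locus Q" "hU Q x \<noteq> 0" using that by auto
    obtain c where "c \<noteq> 0" "Psi Q (Phi Q x) = c *s x" using Phi_on_U(3)[OF Q x] by blast
    then have "wequiv (\<lambda>_. 1) (Psi Q (Phi Q x)) x"
      unfolding wequiv_def by (intro exI[of _ "inverse c"]) (auto simp: wact_one[unfolded One_nat_def])
    then show ?thesis using Phi_on_U(1,2)[OF Q x] by simp
  qed
  have V: "Psi Q z \<in> ?U \<and> wequiv wZ (Phi Q (Psi Q z)) z" if "z \<in> ?V" for z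
  proof -
    have z: "z \<in> double_cover Q" "hV Q z \<noteq> 0" using that by auto
    obtain t where "t \<noteq> 0" "Phi Q (Psi Q z) = wact wZ t z" using Psi_on_V(3)[OF Q z] by blast
    then have "wequiv wZ (Phi Q (Psi Q z)) z"
      unfolding wequiv_def by (intro exI[of _ "inverse t"]) (auto simp: wact_wact wact_id)
    then show ?thesis using Psi_on_V(1,2)[OF Q z] by simp
  qed
  have neV: "?V \<noteq> {}" using ne by auto
  have neU: "?U \<noteq> {}" using ne V by blast
  show ?thesis
    unfolding birational_def
    by (rule exI[of _ ?U], rule exI[of _ ?V], rule exI[of _ "Phi Q"], rule exI[of _ "Psi Q"])
      (intro conjI ballI oU oV dU dV neU neV wmap_Phi wmap_Psi U[THEN conjunct1] U[THEN conjunct2]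
        V[THEN conjunct1] V[THEN conjunct2])
qed

section \<open>Density on the double cover\<close>

text \<open>Each product is reduced by replacing the square of \<open>s\<close> by \<open>D\<close>,
  as in a quadratic extension.\<close>

lemma polyfn_sqrt_split:
  assumes "polyfn (insert s C) h" "polyfn C D"
  shows "\<exists>u v. polyfn C u \<and> polyfn C v \<and> (\<forall>z. (s z)\<^sup>2 = D z \<longrightarrow> h z = u z + s z * v z)"
  using assms(1)
proof (induction rule: polyfn.induct)
  case (pf_const c)
  show ?case by (rule exI[of _ "\<lambda>_. c"], rule exI[of _ "\<lambda>_. 0"]) (simp add: polyfn.pf_const)
next
  case (pf_coord f)
  show ?case
  proof (cases "f = s")
    case True
    then show ?thesis
      by (intro exI[of _ "\<lambda>_. 0"] exI[of _ "\<lambda>_. 1"]) (simp add: polyfn.pf_const)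
  next
    case False
    then have "polyfn C f" using pf_coord by (simp add: polyfn.pf_coord)
    then show ?thesis by (intro exI[of _ f] exI[of _ "\<lambda>_. 0"]) (simp add: polyfn.pf_const)
  qed
next
  case (pf_add f g)
  then obtain u v u' v' where uv: "polyfn C u" "polyfn C v" "\<forall>z. (s z)\<^sup>2 = D z \<longrightarrow> f z = u z + s z * v z"
    "polyfn C u'" "polyfn C v'" "\<forall>z. (s z)\<^sup>2 = D z \<longrightarrow> g z = u' z + s z * v' z"
    by metis
  show ?case
    by (rule exI[of _ "\<lambda>z. u z + u' z"], rule exI[of _ "\<lambda>z. v z + v' z"])
      (use uv in \<open>auto intro!: polyfn_intros simp: algebra_simps\<close>)
next
  case (pf_mult f g)
  then obtain u v u' v' where uv: "polyfn C u" "polyfn C v" "\<forall>z. (s z)\<^sup>2 = D z \<longrightarrow> f z = u z + s z * v z"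
    "polyfn C u'" "polyfn C v'" "\<forall>z. (s z)\<^sup>2 = D z \<longrightarrow> g z = u' z + s z * v' z"
    by metis
  have "(u z + s z * v z) * (u' z + s z * v' z) = u z * u' z + D z * (v z * v' z) + s z * (u z * v' z + v z * u' z)"
    if "(s z)\<^sup>2 = D z" for z
    unfolding that[symmetric] by (simp add: power2_eq_square algebra_simps)
  then show ?case
    by (intro exI[of _ "\<lambda>z. u z * u' z + D z * (v z * v' z)"] exI[of _ "\<lambda>z. u z * v' z + v z * u' z"])
      (use uv assms(2) in \<open>auto intro!: polyfn_intros\<close>)
qed

text \<open>The distances from \<open>w0\<close> to the two roots multiply to
  \<open>norm (d - w0^2)\<close>, so one of them is less than the square root of the bound.\<close>

lemma sqrt_near:
  fixes w0 d :: complex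
  assumes "\<epsilon> > 0" "norm (d - w0\<^sup>2) < \<epsilon>\<^sup>2"
  shows "\<exists>w. w\<^sup>2 = d \<and> norm (w - w0) < \<epsilon>"
proof -
  have "(csqrt d - w0) * (csqrt d + w0) = (csqrt d)\<^sup>2 - w0\<^sup>2"
    by (simp only: power2_eq_square square_diff_square_factored mult.commute)
  then have "norm (csqrt d - w0) * norm (csqrt d + w0) = norm (d - w0\<^sup>2)"
    by (simp flip: norm_mult)
  then have "norm (csqrt d - w0) < \<epsilon> \<or> norm (csqrt d + w0) < \<epsilon>"
    using assms mult_mono[of \<epsilon> "norm (csqrt d - w0)" \<epsilon> "norm (csqrt d + w0)"]
    by (force simp: power2_eq_square)
  then show ?thesis
  proof
    assume "norm (csqrt d - w0) < \<epsilon>"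
    then show ?thesis by (intro exI[of _ "csqrt d"]) simp
  next
    assume "norm (csqrt d + w0) < \<epsilon>"
    moreover have "norm (- csqrt d - w0) = norm (csqrt d + w0)" 
      using norm_minus_cancel[of "csqrt d + w0"] by simp
    ultimately show ?thesis by (intro exI[of _ "- csqrt d"]) simp
  qed
qed

lemma norm_vec_le_sum: "norm x \<le> (\<Sum>i\<in>UNIV. norm (x $ i))" for x :: "complex^'n"
  unfolding norm_vec_def by (rule L2_set_le_sum) simp

text \<open>The product of \<open>hV\<close> over the two points above \<open>\<lambda>\<close> is a polynomial in \<open>\<lambda>\<close> and the web.\<close>

lemma generic_dense_V:
  assumes ls: "zs $ 3 \<noteq> 0"
    and ex: "\<And>z. z \<in> double_cover Q0 \<Longrightarrow> zlam z = zlam zs \<Longrightarrow> hV Q0 z \<noteq> 0"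
  shows "\<exists>g. polyfn web_coords g \<and> g Q0 \<noteq> 0 \<and>
    (\<forall>Q. g Q \<noteq> 0 \<longrightarrow> wdense wZ (double_cover Q) {z \<in> double_cover Q. hV Q z \<noteq> 0} \<and>
      (\<exists>z\<in>double_cover Q. hV Q z \<noteq> 0))"
proof -
  define C :: "((complex^8^8^4) \<times> (complex^5) \<Rightarrow> complex) set"
    where "C = {\<lambda>(Q, z). Q $ k $ i $ j | k i j. True} \<union> {\<lambda>(Q, z). z $ i | i. i \<noteq> 4}"
  define s :: "(complex^8^8^4) \<times> (complex^5) \<Rightarrow> complex" where "s = (\<lambda>(Q, z). z $ 4)"
  define D where "D = (\<lambda>y::(complex^8^8^4) \<times> (complex^5). det (pencil (fst y) (zlam (snd y))))"
  have cQ: "polyfn C (\<lambda>y. fst y $ k $ i $ j)" for k i j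
    by (rule pf_coord) (auto simp: C_def case_prod_unfold)
  have cz: "polyfn C (\<lambda>y. snd y $ i)" if "i \<noteq> 4" for i
    by (rule pf_coord) (use that in \<open>auto simp: C_def case_prod_unfold\<close>)
  have pD: "polyfn C D"
    unfolding D_def by (intro polyfn_det polyfn_pencil polyfn_zlam cQ cz)
  have "polyfn (insert s C) (\<lambda>y. hV (fst y) (snd y))"
  proof (rule polyfn_hV)
    show "polyfn (insert s C) (\<lambda>y. fst y $ k $ i $ j)" for k i j
      by (rule polyfn_mono[OF cQ]) auto
    show "polyfn (insert s C) (\<lambda>y. snd y $ i)" for i
    proof (cases "i = 4")
      case True
      then show ?thesis by (intro pf_coord) (auto simp: s_def case_prod_unfold)
    next
      case False
      then show ?thesis using polyfn_mono[OF cz] by blast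
    qed
  qed
  from polyfn_sqrt_split[OF this pD] obtain u v where u: "polyfn C u" and v: "polyfn C v"
    and uv: "\<And>y. (s y)\<^sup>2 = D y \<Longrightarrow> hV (fst y) (snd y) = u y + s y * v y" by blast
  \<comment> \<open>The norm of \<open>hV\<close>, that is \<open>(u + w v) * (u - w v)\<close> with
    \<open>w^2 = D\<close>. As \<open>C\<close> omits the coordinate 4, it depends only on the web
    and on \<open>zlam z\<close>.\<close>
  define n where "n = (\<lambda>y. (u y)\<^sup>2 - D y * (v y)\<^sup>2)"
  have n: "polyfn C n" unfolding n_def by (intro polyfn_intros u v pD)
  have n_eq: "n (Q, z) = n (Q, z')" if "zlam z = zlam z'" for Q z z'
  proof (rule polyfn_eqI[OF n])
    fix c assume "c \<in> C"
    have "z $ i = z' $ i" if "i \<noteq> 4" for i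
    proof -
      have "z $ 0 = z' $ 0" "z $ 1 = z' $ 1" "z $ 2 = z' $ 2" "z $ 3 = z' $ 3"
        using \<open>zlam z = zlam z'\<close> by (metis zlam_nth)+
      then show ?thesis using that UNIV_5 by (metis (full_types) UNIV_I insertE singletonD)
    qed
    then show "c (Q, z) = c (Q, z')" using \<open>c \<in> C\<close> by (auto simp: C_def)
  qed
  have n_hV: "n (Q, z) = hV Q z * (u (Q, z) - z $ 4 * v (Q, z))" if "(z $ 4)\<^sup>2 = det (pencil Q (zlam z))" for Q z
  proof -
    have "hV Q z = u (Q, z) + z $ 4 * v (Q, z)" using uv[of "(Q, z)"] that by (simp add: s_def D_def)
    moreover have "D (Q, z) = (z $ 4)\<^sup>2" using that by (simp add: D_def)
    ultimately show ?thesis by (simp add: n_def power2_eq_square algebra_simps)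
  qed
  have setz: "\<exists>z'. zlam z' = zlam z \<and> z' $ 4 = w" for z w
    by (rule exI[of _ "vec5 (z $ 0) (z $ 1) (z $ 2) (z $ 3) w"]) (simp add: vec_eq_iff all_4')
  \<comment> \<open>Fixing the point of the base space at \<open>zs\<close> leaves a polynomial in
    the web alone.\<close>
  define g where "g = (\<lambda>Q. n (Q, zs))"
  have "polyfn web_coords g"
    unfolding g_def
  proof (rule polyfn_compose[OF n])
    fix c assume "c \<in> C"
    then consider k i j where "c = (\<lambda>(Q, z). Q $ k $ i $ j)" | i where "c = (\<lambda>(Q, z). z $ i)"
      by (auto simp: C_def)
    then show "polyfn web_coords (\<lambda>Q. c (Q, zs))"
      by cases (simp_all add: polyfn_web_coord pf_const)
  qed
  moreover have "g Q0 \<noteq> 0"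
  proof
    assume g0: "g Q0 = 0"
    define w where "w = csqrt (D (Q0, zs))"
    obtain z where z: "zlam z = zlam zs" "z $ 4 = w" using setz by blast
    obtain z' where z': "zlam z' = zlam zs" "z' $ 4 = - w" using setz by blast
    have sq: "(z $ 4)\<^sup>2 = det (pencil Q0 (zlam z))" "(z' $ 4)\<^sup>2 = det (pencil Q0 (zlam z'))"
      by (simp_all add: z z' w_def D_def)
    have "z $ 3 = zs $ 3" "z' $ 3 = zs $ 3" using z(1) z'(1) by (metis zlam_nth(4))+
    then have "z \<noteq> 0" "z' \<noteq> 0" using ls by auto
    then have "hV Q0 z \<noteq> 0" "hV Q0 z' \<noteq> 0" using ex z z' sq by (auto simp: double_cover_def)
    moreover have "u (Q0, z) = u (Q0, z')" "v (Q0, z) = v (Q0, z')"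
    proof -
      have "c (Q0, z) = c (Q0, z')" if "c \<in> C" for c
      proof -
        have "z $ i = z' $ i" if "i \<noteq> 4" for i
        proof -
          have "z $ 0 = z' $ 0" "z $ 1 = z' $ 1" "z $ 2 = z' $ 2" "z $ 3 = z' $ 3"
            using z(1) z'(1) by (metis zlam_nth)+
          then show ?thesis using that UNIV_5 by (metis (full_types) UNIV_I insertE singletonD)
        qed
        then show ?thesis using that by (auto simp: C_def)
      qed
      then show "u (Q0, z) = u (Q0, z')" "v (Q0, z) = v (Q0, z')"
        using polyfn_eqI[OF u] polyfn_eqI[OF v] by blast+
    qed
    moreover have "hV Q0 z' = u (Q0, z') + z' $ 4 * v (Q0, z')"
      using uv[of "(Q0, z')"] sq by (simp add: s_def D_def)
    ultimately have "n (Q0, z) \<noteq> 0" using n_hV[OF sq(1)] z z' by simp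
    then show False using g0 n_eq[OF z(1)] by (simp add: g_def)
  qed
  moreover have "wdense wZ (double_cover Q) {z \<in> double_cover Q. hV Q z \<noteq> 0} \<and> (\<exists>z\<in>double_cover Q. hV Q z \<noteq> 0)"
    if gQ: "g Q \<noteq> 0" for Q
  proof
    have good: "hV Q z \<noteq> 0" if "z \<in> double_cover Q" "n (Q, z) \<noteq> 0" for z
      using n_hV[of z Q] that by (auto simp: double_cover_def)
    show "wdense wZ (double_cover Q) {z \<in> double_cover Q. hV Q z \<noteq> 0}"
      unfolding wdense_def
    proof (intro conjI allI impI ballI)
      fix f d z0 assume f: "whom wZ d f \<and> (\<forall>x\<in>{z \<in> double_cover Q. hV Q z \<noteq> 0}. f x = 0)"
        and z0: "z0 \<in> double_cover Q"
      show "f z0 = 0"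
      proof (rule ccontr)
        assume nz: "f z0 \<noteq> 0"
        have "continuous_on UNIV f" using f continuous_polyfn_vcoords by (auto simp: whom_def)
        then have "isCont f z0" by (simp add: continuous_on_eq_continuous_at)
        then obtain \<delta>1 where \<delta>1: "\<delta>1 > 0" "\<And>z. dist z0 z < \<delta>1 \<Longrightarrow> f z \<noteq> 0"
          using continuous_at_avoid[of z0 f 0] nz by blast
        have z0n: "z0 \<noteq> 0" using z0 by (simp add: double_cover_def)
        \<comment> \<open>The bound by \<open>norm z0\<close> keeps nearby points away from the
          vertex of the cone.\<close>
        define \<delta> where "\<delta> = min \<delta>1 (norm z0)"
        have \<delta>: "\<delta> > 0" using \<delta>1 z0n by (simp add: \<delta>_def)
        \<comment> \<open>On the line from \<open>z0\<close> to \<open>zs\<close> the norm is a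
          polynomial that is nonzero at 1, so arbitrarily small \<open>t\<close> avoid its
          roots.\<close>
        define zt where "zt t = (\<chi> i. z0 $ i + t * (zs $ i - z0 $ i))" for t
        define K where "K = (\<Sum>i\<in>UNIV. norm (zs $ i - z0 $ i)) + 1"
        have K: "K > 0" unfolding K_def by (intro add_nonneg_pos sum_nonneg) auto
        have line: "\<exists>p. \<forall>t. c (Q, zt t) = poly p t" if "c \<in> C" for c
        proof -
          from that consider k i j where "c = (\<lambda>(Q, z). Q $ k $ i $ j)" | i where "c = (\<lambda>(Q, z). z $ i)"
            by (auto simp: C_def)
          then show ?thesis
          proof cases
            case 1
            then show ?thesis by (intro exI[of _ "[:Q $ k $ i $ j:]"]) simp
          next
            case 2
            then show ?thesis by (intro exI[of _ "[:z0 $ i, zs $ i - z0 $ i:]"]) (simp add: zt_def)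
          qed
        qed
        obtain p where p: "\<And>t. n (Q, zt t) = poly p t"
          using polyfn_along_curve[OF n, of "\<lambda>t. (Q, zt t)"] line by blast
        obtain q where q: "\<And>t. D (Q, zt t) = poly q t"
          using polyfn_along_curve[OF pD, of "\<lambda>t. (Q, zt t)"] line by blast
        have z0t: "zt 0 = z0" "zt 1 = zs" by (simp_all add: zt_def vec_eq_iff)
        have p1: "poly p 1 \<noteq> 0" using gQ p[of 1] by (simp add: g_def z0t)
        have q0: "poly q 0 = (z0 $ 4)\<^sup>2" using z0 q[of 0] by (simp add: z0t D_def double_cover_def)
        have "isCont (poly q) 0" by simp
        then obtain \<eta>1 where \<eta>1: "\<eta>1 > 0" "\<And>t. norm t < \<eta>1 \<Longrightarrow> norm (poly q t - poly q 0) < (\<delta> / 2)\<^sup>2"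
          unfolding continuous_at_eps_delta using \<delta> by (metis dist_norm diff_zero half_gt_zero zero_less_power)
        define \<eta> where "\<eta> = min \<eta>1 (\<delta> / (2 * K))"
        have "\<eta> > 0" using \<eta>1 \<delta> K by (simp add: \<eta>_def)
        then obtain t where t: "norm t < \<eta>" "poly p t \<noteq> 0" using poly_nonzero_near_0[OF p1] by blast
        have "norm (poly q t - (z0 $ 4)\<^sup>2) < (\<delta> / 2)\<^sup>2" using \<eta>1(2)[of t] t(1) q0 by (simp add: \<eta>_def)
        then obtain w where w: "w\<^sup>2 = poly q t" "norm (w - z0 $ 4) < \<delta> / 2"
          using sqrt_near[of "\<delta> / 2"] \<delta> by auto
        \<comment> \<open>The point \<open>zt t\<close> need not lie on the cover; its last
          coordinate is replaced by the square root nearest to \<open>z0 $ 4\<close>.\<close>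
        define z where "z = vec5 (zt t $ 0) (zt t $ 1) (zt t $ 2) (zt t $ 3) w"
        have zl: "zlam z = zlam (zt t)" "z $ 4 = w" by (simp_all add: z_def vec_eq_iff all_4')
        have "norm (z - z0) \<le> (\<Sum>i\<in>UNIV. norm ((z - z0) $ i))" by (rule norm_vec_le_sum)
        also have "\<dots> \<le> (\<Sum>i\<in>UNIV. norm t * norm (zs $ i - z0 $ i)) + norm (w - z0 $ 4)"
        proof -
          have "(\<Sum>i\<in>UNIV. norm ((z - z0) $ i)) = norm (t * (zs $ 0 - z0 $ 0)) + norm (t * (zs $ 1 - z0 $ 1))
            + norm (t * (zs $ 2 - z0 $ 2)) + norm (t * (zs $ 3 - z0 $ 3)) + norm (w - z0 $ 4)"
            unfolding UNIV_5 by (simp add: z_def zt_def)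
          also have "\<dots> \<le> (\<Sum>i\<in>UNIV. norm t * norm (zs $ i - z0 $ i)) + norm (w - z0 $ 4)"
            unfolding UNIV_5 by (simp add: norm_mult)
          finally show ?thesis .
        qed
        also have "\<dots> \<le> norm t * K + norm (w - z0 $ 4)"
          by (simp add: K_def sum_distrib_left[symmetric] algebra_simps)
        also have "norm t * K < \<delta> / 2" using t(1) K by (simp add: \<eta>_def field_simps)
        finally have zd: "norm (z - z0) < \<delta>" using w(2) by simp
        then have "z \<noteq> 0" by (auto simp: \<delta>_def)
        moreover have "w\<^sup>2 = det (pencil Q (zlam z))" using w(1) q[of t] by (simp add: D_def zl)
        ultimately have "z \<in> double_cover Q" by (simp add: double_cover_def zl)
        moreover have "n (Q, z) \<noteq> 0" using t(2) p[of t] n_eq[OF zl(1)] by simp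
        ultimately have "f z = 0" using good f by auto
        moreover have "dist z0 z < \<delta>1" using zd by (simp add: \<delta>_def dist_norm norm_minus_commute)
        ultimately show False using \<delta>1(2) by blast
      qed
    qed auto
    obtain z where z: "zlam z = zlam zs" "z $ 4 = csqrt (D (Q, zs))" using setz by blast
    have "z $ 3 = zs $ 3" using z(1) by (metis zlam_nth(4))
    then have "z \<in> double_cover Q" using z ls by (auto simp: double_cover_def D_def)
    moreover have "n (Q, z) \<noteq> 0" using gQ n_eq[OF z(1)] by (simp add: g_def)
    ultimately show "\<exists>z\<in>double_cover Q. hV Q z \<noteq> 0" using good by blast
  qed
  ultimately show ?thesis by blast
qed

section \<open>Dimension counts for webs\<close>

definition Pidx :: "8 set" where "Pidx = {0, 1, 2}"

text \<open>The 4 * 30 independent entries of four symmetric matrices with zero block on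
  \<open>P\<close>; by symmetry the upper triangle suffices.\<close>

definition web_index :: "(4 \<times> 8 \<times> 8) set" where
  "web_index = {(k, a, b). a \<le> b \<and> \<not> (a \<in> Pidx \<and> b \<in> Pidx)}"

definition webof :: "(4 \<times> 8 \<times> 8 \<Rightarrow> complex) \<Rightarrow> complex^8^8^4" where
  "webof u = (\<chi> k a b. if a \<in> Pidx \<and> b \<in> Pidx then 0 else u (k, min a b, max a b))"

definition entry :: "4 \<times> 8 \<times> 8 \<Rightarrow> complex^8^8^4 \<Rightarrow> complex" where
  "entry v Q = (case v of (k, a, b) \<Rightarrow> Q $ k $ a $ b)"

lemma frame_webI:
  assumes "\<And>k a b. Q $ k $ a $ b = Q $ k $ b $ a" "\<And>k a b. a \<in> Pidx \<Longrightarrow> b \<in> Pidx \<Longrightarrow> Q $ k $ a $ b = 0"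
  shows "frame_web Q"
  unfolding frame_web_def in_frame_def
proof (intro allI conjI)
  fix k
  show "Finite_Cartesian_Product.transpose (Q $ k) = Q $ k"
    unfolding vec_eq_iff transpose_def using assms(1)[of k] by simp
  show "\<forall>i\<in>{0, 1, 2}. \<forall>j\<in>{0, 1, 2}. Q $ k $ i $ j = 0" using assms(2) by (simp add: Pidx_def)
qed

lemma frame_web_sym: "frame_web Q \<Longrightarrow> Q $ k $ a $ b = Q $ k $ b $ a"
  by (rule in_frame_sym) (simp add: frame_web_def)

lemma frame_web_zero: "frame_web Q \<Longrightarrow> a \<in> Pidx \<Longrightarrow> b \<in> Pidx \<Longrightarrow> Q $ k $ a $ b = 0"
  unfolding frame_web_def in_frame_def Pidx_def by blast

lemma frame_web_min_max: "frame_web Q \<Longrightarrow> Q $ k $ min a b $ max a b = Q $ k $ a $ b"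
  using frame_web_sym[of Q k a b] by (simp add: min_def max_def)

lemma frame_web_webof: "frame_web (webof u)"
  by (rule frame_webI) (auto simp: webof_def min.commute max.commute)

lemma entry_webof: "v \<in> web_index \<Longrightarrow> entry v (webof u) = u v"
  by (auto simp: web_index_def entry_def webof_def min_def max_def)

lemma polyfn_entry: "polyfn web_coords (entry v)"
  using polyfn_web_coord[of "fst v" "fst (snd v)" "snd (snd v)"] by (simp add: entry_def[abs_def] case_prod_unfold)

lemma minmax_index: "\<not> (a \<in> Pidx \<and> b \<in> Pidx) \<Longrightarrow> (k, min a b, max a b) \<in> web_index"
  by (auto simp: web_index_def min_def max_def)

lemma sum_pairs_remove:
  fixes F :: "8 \<Rightarrow> 8 \<Rightarrow> complex"
  shows "(\<Sum>a\<in>UNIV. \<Sum>b\<in>UNIV. F a b) = F j j + (\<Sum>(a, b)\<in>UNIV - {(j, j)}. F a b)"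
proof -
  have "(\<Sum>a\<in>UNIV. \<Sum>b\<in>UNIV. F a b) = (\<Sum>(a, b)\<in>UNIV. F a b)"
    by (simp add: sum.cartesian_product)
  then show ?thesis by (simp add: sum.remove[of UNIV "(j, j)"])
qed

text \<open>Incidence count: the webs with a singular base point off the plane depend on fewer parameters
  than there are coordinates, since \<open>x\<^sub>j = 1\<close> and \<open>\<mu>\<^sub>i = 1\<close> let one solve the 11 equations
  for 11 entries of the web.\<close>

lemma generic_smooth_chart:
  assumes j: "j \<notin> Pidx"
  shows "\<exists>g. polyfn web_coords g \<and> (\<exists>Q. frame_web Q \<and> g Q \<noteq> 0) \<and>
    (\<forall>Q x \<mu>. frame_web Q \<longrightarrow> x $ j = 1 \<longrightarrow> \<mu> $ i = 1 \<longrightarrow> (\<forall>k. qf (Q $ k) x = 0) \<longrightarrow>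
       pencil Q \<mu> *v x = 0 \<longrightarrow> g Q = 0)"
proof -
  define Z :: "((complex^8^8^4) \<times> (complex^8) \<times> (complex^4)) set" where
    "Z = {(Q, x, \<mu>). frame_web Q \<and> x $ j = 1 \<and> \<mu> $ i = 1 \<and> (\<forall>k. qf (Q $ k) x = 0) \<and> pencil Q \<mu> *v x = 0}"
  \<comment> \<open>The solved entries: \<open>S1\<close> comes from the quadrics
    \<open>k \<noteq> i\<close> (3 entries), \<open>S2\<close> is row \<open>j\<close> of the matrix
    \<open>i\<close>, solved from the eight components of \<open>pencil Q \<mu> *v x = 0\<close>.
    The quadric \<open>i\<close> then vanishes at \<open>x\<close> automatically.\<close>
  define S1 :: "(4 \<times> 8 \<times> 8) set" where "S1 = (\<lambda>k. (k, j, j)) ` (UNIV - {i})"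
  define S2 :: "(4 \<times> 8 \<times> 8) set" where "S2 = range (\<lambda>a. (i, min a j, max a j))"
  define S where "S = S1 \<union> S2"
  define C :: "((complex^8^8^4) \<times> (complex^8) \<times> (complex^4) \<Rightarrow> complex) set" where
    "C = (\<lambda>v y. entry v (fst y)) ` (web_index - S) \<union> (\<lambda>a y. fst (snd y) $ a) ` (UNIV - {j})
      \<union> (\<lambda>k y. snd (snd y) $ k) ` (UNIV - {i})"
  have finI: "finite web_index" by simp
  have "S \<subseteq> web_index"
    using j minmax_index[of _ j] by (auto simp: S_def S1_def S2_def web_index_def)
  have "card S1 = 3" unfolding S1_def by (subst card_image) (auto simp: inj_on_def)
  moreover have "card S2 = 8"
    unfolding S2_def by (subst card_image) (auto simp: inj_on_def min_def max_def split: if_splits)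
  moreover have "S1 \<inter> S2 = {}" by (auto simp: S1_def S2_def)
  ultimately have cS: "card S = 11" unfolding S_def by (subst card_Un_disjoint) auto
  have cI: "card (web_index - S) + 11 = card web_index"
    using card_mono[OF finI \<open>S \<subseteq> web_index\<close>] by (subst card_Diff_subset[OF _ \<open>S \<subseteq> web_index\<close>]) (auto simp: cS)
  have "card C \<le> card ((\<lambda>v y. entry v (fst y)) ` (web_index - S) \<union> (\<lambda>a y. fst (snd y) $ a) ` (UNIV - {j})
        :: ((complex^8^8^4) \<times> (complex^8) \<times> (complex^4) \<Rightarrow> complex) set)
      + card ((\<lambda>k y. snd (snd y) $ k) ` (UNIV - {i}) :: ((complex^8^8^4) \<times> (complex^8) \<times> (complex^4) \<Rightarrow> complex) set)"
    unfolding C_def by (rule card_Un_le)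
  also have "\<dots> \<le> (card (web_index - S) + card (UNIV - {j})) + card (UNIV - {i})"
    by (intro add_mono order_trans[OF card_Un_le] card_image_le) auto
  \<comment> \<open>The free coordinates of \<open>x\<close> and \<open>\<mu>\<close> number 7 + 3 =
    10, one less than the 11 entries eliminated.\<close>
  also have "\<dots> = card (web_index - S) + 10" by (simp add: card_Diff_singleton)
  finally have cC: "card C < card web_index" using cI by simp
  have finC: "finite C" by (simp add: C_def)
  let ?q = "\<lambda>k a b y. fst y $ k $ a $ b" and ?x = "\<lambda>a y. fst (snd y) $ a" and ?m = "\<lambda>k y. snd (snd y) $ k"
  have cx: "polyfn_on Z C (?x a)" for a
  proof (cases "a = j")
    case True
    show ?thesis by (rule polyfn_on_cong[OF polyfn_on_const[of _ _ 1]]) (auto simp: Z_def True)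
  next
    case False
    then show ?thesis by (intro polyfn_onI pf_coord) (auto simp: C_def)
  qed
  have cm: "polyfn_on Z C (?m k)" for k
  proof (cases "k = i")
    case True
    show ?thesis by (rule polyfn_on_cong[OF polyfn_on_const[of _ _ 1]]) (auto simp: Z_def True)
  next
    case False
    then show ?thesis by (intro polyfn_onI pf_coord) (auto simp: C_def)
  qed
  have free: "polyfn_on Z C (?q k a b)" if "(k, min a b, max a b) \<notin> S" for k a b
  proof (cases "a \<in> Pidx \<and> b \<in> Pidx")
    case True
    then show ?thesis
      by (intro polyfn_on_cong[OF polyfn_on_const[of _ _ 0]]) (auto simp: Z_def frame_web_zero)
  next
    case False
    have "polyfn_on Z C (\<lambda>y. entry (k, min a b, max a b) (fst y))"
      using minmax_index[OF False, of k] that by (intro polyfn_onI pf_coord) (auto simp: C_def)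
    then show ?thesis by (rule polyfn_on_cong) (auto simp: Z_def entry_def frame_web_min_max)
  qed
  have c1: "polyfn_on Z C (?q k a b)" if "k \<noteq> i" for k a b
  proof -
    have off: "polyfn_on Z C (?q k a b)" if "(a, b) \<noteq> (j, j)" for a b
      using that \<open>k \<noteq> i\<close> by (intro free) (auto simp: S_def S1_def S2_def min_def max_def split: if_splits)
    have jj: "polyfn_on Z C (?q k j j)"
    proof (rule polyfn_on_cong)
      show "polyfn_on Z C (\<lambda>y. - (\<Sum>p\<in>UNIV - {(j, j)}. ?x (fst p) y * ?q k (fst p) (snd p) y * ?x (snd p) y))"
        by (intro polyfn_on_intros cx off) auto
      fix y assume y: "y \<in> Z"
      obtain Q x \<mu> where yy: "y = (Q, x, \<mu>)" by (metis prod.exhaust)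
      have "qf (Q $ k) x = 0" "x $ j = 1" using y by (auto simp: Z_def yy)
      then show "?q k j j y = - (\<Sum>p\<in>UNIV - {(j, j)}. ?x (fst p) y * ?q k (fst p) (snd p) y * ?x (snd p) y)"
        unfolding qf_def sum_pairs_remove[of _ j] by (simp add: yy case_prod_unfold add_eq_0_iff2)
    qed
    show ?thesis using off jj by (cases "(a, b) = (j, j)") auto
  qed
  have row: "?q i a j y = - (\<Sum>k\<in>UNIV - {i}. ?m k y * (\<Sum>b\<in>UNIV. ?q k a b y * ?x b y)) - (\<Sum>b\<in>UNIV - {j}. ?q i a b y * ?x b y)"
    if "y \<in> Z" for a y
  proof -
    obtain Q x \<mu> where yy: "y = (Q, x, \<mu>)" by (metis prod.exhaust)
    have 1: "x $ j = 1" "\<mu> $ i = 1" "(pencil Q \<mu> *v x) $ a = 0" using that by (auto simp: Z_def yy)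
    have "0 = (\<Sum>k\<in>UNIV. \<mu> $ k * (\<Sum>b\<in>UNIV. Q $ k $ a $ b * x $ b))"
      using 1(3) unfolding pencil_mult by (simp add: matrix_vector_mult_def)
    also have "\<dots> = (\<Sum>b\<in>UNIV. Q $ i $ a $ b * x $ b) + (\<Sum>k\<in>UNIV - {i}. \<mu> $ k * (\<Sum>b\<in>UNIV. Q $ k $ a $ b * x $ b))"
      by (subst sum.remove[of _ i]) (auto simp: 1)
    also have "(\<Sum>b\<in>UNIV. Q $ i $ a $ b * x $ b) = Q $ i $ a $ j + (\<Sum>b\<in>UNIV - {j}. Q $ i $ a $ b * x $ b)"
      by (subst sum.remove[of _ j]) (auto simp: 1)
    finally show ?thesis unfolding yy fst_conv snd_conv by algebra
  qed
  have c2: "polyfn_on Z C (?q i a b)" if "a \<noteq> j" "b \<noteq> j" for a b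
    using that by (intro free) (auto simp: S_def S1_def S2_def min_def max_def split: if_splits)
  have c3: "polyfn_on Z C (?q i a j)" if "a \<noteq> j" for a
    by (rule polyfn_on_cong[OF _ row], intro polyfn_on_diff polyfn_on_uminus polyfn_on_sum polyfn_on_mult cm cx)
      (use that in \<open>auto intro: c1 c2\<close>)
  \<comment> \<open>Component \<open>j\<close> of the kernel equation involves the entries
    \<open>(j, b)\<close>, so these are supplied by symmetry before \<open>(j, j)\<close> is solved
    for.\<close>
  have c4: "polyfn_on Z C (?q i j b)" if "b \<noteq> j" for b
    by (rule polyfn_on_cong[OF c3[OF that]]) (auto simp: Z_def intro: frame_web_sym)
  have c5: "polyfn_on Z C (?q i j j)"
    by (rule polyfn_on_cong[OF _ row], intro polyfn_on_diff polyfn_on_uminus polyfn_on_sum polyfn_on_mult cm cx)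
      (auto intro: c1 c4)
  have all: "polyfn_on Z C (?q k a b)" for k a b
    using c1 c2 c3 c4 c5 by (cases "k = i"; cases "a = j"; cases "b = j") auto
  have "polyfn_on Z C (\<lambda>y. entry v (fst y))" for v
    using all[of "fst v" "fst (snd v)" "snd (snd v)"] by (simp add: entry_def case_prod_unfold)
  then obtain N c where c: "\<exists>\<alpha>\<in>web_index \<rightarrow>\<^sub>E {..N}. c \<alpha> \<noteq> 0"
    "\<And>z. z \<in> Z \<Longrightarrow> multipoly web_index N c (\<lambda>v. entry v (fst z)) = 0"
    using algebraic_relation[OF finC finI cC, of Z "\<lambda>v y. entry v (fst y)"] by blast
  define g where "g = (\<lambda>Q. multipoly web_index N c (\<lambda>v. entry v Q))"
  have "polyfn web_coords g" unfolding g_def by (intro polyfn_multipoly polyfn_entry)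
  moreover have "\<exists>Q. frame_web Q \<and> g Q \<noteq> 0"
  proof -
    obtain u where "multipoly web_index N c u \<noteq> 0" using c(1) multipoly_nonzero[OF finI] by blast
    then have "g (webof u) \<noteq> 0"
      unfolding g_def using multipoly_cong[of web_index "\<lambda>v. entry v (webof u)" u N c] by (simp add: entry_webof)
    then show ?thesis using frame_web_webof by blast
  qed
  moreover have "g Q = 0" if "frame_web Q" "x $ j = 1" "\<mu> $ i = 1" "\<forall>k. qf (Q $ k) x = 0" "pencil Q \<mu> *v x = 0" for Q x \<mu>
    using c(2)[of "(Q, x, \<mu>)"] that by (simp add: g_def Z_def)
  ultimately show ?thesis by blast
qed

text \<open>Forces \<open>x\<close> onto all four quadrics by correcting only the diagonal entries
  at \<open>j\<close>, which works when \<open>x $ j = 1\<close>. It is a polynomial retraction onto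
  the incidence variety.\<close>

definition fixq :: "8 \<Rightarrow> complex^8^8^4 \<Rightarrow> complex^8 \<Rightarrow> complex^8^8^4" where
  "fixq j Q x = (\<chi> k a b. if a = j \<and> b = j then Q $ k $ a $ b - qf (Q $ k) x else Q $ k $ a $ b)"

lemma qf_fixq:
  assumes "x $ j = 1"
  shows "qf (fixq j Q x $ k) x = 0"
proof -
  have "qf (fixq j Q x $ k) x = Q $ k $ j $ j - qf (Q $ k) x
      + (\<Sum>(a, b)\<in>UNIV - {(j, j)}. x $ a * fixq j Q x $ k $ a $ b * x $ b)"
    unfolding qf_def[of "fixq j Q x $ k"] sum_pairs_remove[of _ j] using assms by (simp add: fixq_def)
  also have "(\<Sum>(a, b)\<in>UNIV - {(j, j)}. x $ a * fixq j Q x $ k $ a $ b * x $ b)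
      = (\<Sum>(a, b)\<in>UNIV - {(j, j)}. x $ a * Q $ k $ a $ b * x $ b)"
    by (intro sum.cong refl) (auto simp: fixq_def split: if_splits)
  also have "Q $ k $ j $ j - qf (Q $ k) x + \<dots> = 0"
    unfolding qf_def[of "Q $ k"] sum_pairs_remove[of _ j] using assms by simp
  finally show ?thesis .
qed

lemma fixq_id: "(\<And>k. qf (Q $ k) x = 0) \<Longrightarrow> fixq j Q x = Q"
  by (simp add: fixq_def vec_eq_iff)

lemma frame_web_fixq: "frame_web Q \<Longrightarrow> j \<notin> Pidx \<Longrightarrow> frame_web (fixq j Q x)"
  by (rule frame_webI) (auto simp: fixq_def frame_web_zero intro: frame_web_sym)

definition webline :: "complex^8^8^4 \<Rightarrow> complex^8^8^4 \<Rightarrow> complex \<Rightarrow> complex^8^8^4" where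
  "webline Q Q' t = (\<chi> k a b. Q $ k $ a $ b + t * (Q' $ k $ a $ b - Q $ k $ a $ b))"

lemma webline_0: "webline Q Q' 0 = Q" and webline_1: "webline Q Q' 1 = Q'"
  by (simp_all add: webline_def vec_eq_iff)

lemma frame_web_webline: "frame_web Q \<Longrightarrow> frame_web Q' \<Longrightarrow> frame_web (webline Q Q' t)"
  by (rule frame_webI) (simp_all add: webline_def frame_web_zero frame_web_sym[of Q] frame_web_sym[of Q'])

text \<open>The image of the hypersurface \<open>hU = 0\<close> under \<open>(Q, x) \<mapsto> (Q, (x\<^sub>a)\<^bsub>a \<in> J\<^esub>)\<close> lies in a hypersurface.\<close>

lemma generic_dense_chart:
  assumes j: "j \<notin> Pidx" and J: "card J = 4"
    and ex: "frame_web Q0" "\<And>k. qf (Q0 $ k) x0 = 0" "x0 $ j \<noteq> 0" "hU Q0 x0 \<noteq> 0"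
  shows "\<exists>G. (\<forall>b. polyfn web_coords (\<lambda>Q. G Q b)) \<and> (\<forall>Q. polyfn vcoords (G Q)) \<and>
    (\<forall>Q b b'. (\<forall>a\<in>J. b $ a = b' $ a) \<longrightarrow> G Q b = G Q b') \<and> (\<exists>Q b. frame_web Q \<and> G Q b \<noteq> 0) \<and>
    (\<forall>Q x. frame_web Q \<longrightarrow> (\<forall>k. qf (Q $ k) x = 0) \<longrightarrow> x $ j \<noteq> 0 \<longrightarrow> hU Q x = 0 \<longrightarrow> G Q x = 0)"
proof -
  \<comment> \<open>The triple stands for the point \<open>s *s x\<close> of the affine cone, with
    the direction normalized at \<open>j\<close> and \<open>s\<close> supplying the missing
    dimension.\<close>
  define Z :: "((complex^8^8^4) \<times> (complex^8) \<times> complex) set" where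
    "Z = {(Q, x, s). frame_web Q \<and> x $ j = 1 \<and> (\<forall>k. qf (Q $ k) x = 0)}"
  define S :: "(4 \<times> 8 \<times> 8) set" where "S = range (\<lambda>k. (k, j, j))"
  define C :: "((complex^8^8^4) \<times> (complex^8) \<times> complex \<Rightarrow> complex) set" where
    "C = insert (\<lambda>y. snd (snd y)) ((\<lambda>v y. entry v (fst y)) ` (web_index - S) \<union> (\<lambda>a y. fst (snd y) $ a) ` (UNIV - {j}))"
  define I :: "((4 \<times> 8 \<times> 8) + 8) set" where "I = Inl ` web_index \<union> Inr ` J"
  define \<phi> :: "(4 \<times> 8 \<times> 8) + 8 \<Rightarrow> (complex^8^8^4) \<times> (complex^8) \<times> complex \<Rightarrow> complex" where
    "\<phi> = (\<lambda>i y. case i of Inl v \<Rightarrow> entry v (fst y) | Inr a \<Rightarrow> snd (snd y) * fst (snd y) $ a)"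
  define h where "h = (\<lambda>y::(complex^8^8^4) \<times> (complex^8) \<times> complex. hU (fst y) (snd (snd y) *s fst (snd y)))"
  have finC: "finite C" and finI: "finite I" by (simp_all add: C_def I_def)
  have "card S = 4" unfolding S_def by (subst card_image) (auto simp: inj_on_def)
  moreover have SI: "S \<subseteq> web_index" using j by (auto simp: S_def web_index_def)
  ultimately have cI: "card (web_index - S) + 4 = card web_index"
    using card_mono[OF _ SI] by (subst card_Diff_subset[OF _ SI]) auto
  have "card C \<le> Suc (card ((\<lambda>v y. entry v (fst y)) ` (web_index - S) \<union> (\<lambda>a y. fst (snd y) $ a) ` (UNIV - {j})
      :: ((complex^8^8^4) \<times> (complex^8) \<times> complex \<Rightarrow> complex) set))"
    unfolding C_def by (rule card_insert_le_m1[of "Suc _", simplified]) auto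
  also have "\<dots> \<le> Suc (card (web_index - S) + card (UNIV - {j}))"
    by (intro Suc_le_mono[THEN iffD2] order_trans[OF card_Un_le] add_mono card_image_le) auto
  \<comment> \<open>Source parameters: all entries but 4, plus 7 for \<open>x\<close> and 1 for
    \<open>s\<close>. This matches the target: all entries and the four coordinates in
    \<open>J\<close>.\<close>
  also have "\<dots> = card web_index + 4" using cI by (simp add: card_Diff_singleton)
  also have "\<dots> = card I"
    unfolding I_def by (subst card_Un_disjoint) (auto simp: card_image J)
  finally have cC: "card C \<le> card I" .
  let ?q = "\<lambda>k a b y. fst y $ k $ a $ b" and ?x = "\<lambda>a y. fst (snd y) $ a" and ?s = "\<lambda>y. snd (snd y)"
  have cs: "polyfn_on Z C ?s" by (intro polyfn_onI pf_coord) (simp add: C_def)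
  have cx: "polyfn_on Z C (?x a)" for a
  proof (cases "a = j")
    case True
    show ?thesis by (rule polyfn_on_cong[OF polyfn_on_const[of _ _ 1]]) (auto simp: Z_def True)
  next
    case False
    then show ?thesis by (intro polyfn_onI pf_coord) (auto simp: C_def)
  qed
  have off: "polyfn_on Z C (?q k a b)" if "(a, b) \<noteq> (j, j)" for k a b
  proof (cases "a \<in> Pidx \<and> b \<in> Pidx")
    case True
    then show ?thesis
      by (intro polyfn_on_cong[OF polyfn_on_const[of _ _ 0]]) (auto simp: Z_def frame_web_zero)
  next
    case False
    have "(k, min a b, max a b) \<notin> S" using that by (auto simp: S_def min_def max_def split: if_splits)
    then have "polyfn_on Z C (\<lambda>y. entry (k, min a b, max a b) (fst y))"
      using minmax_index[OF False, of k] by (intro polyfn_onI pf_coord) (auto simp: C_def)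
    then show ?thesis by (rule polyfn_on_cong) (auto simp: Z_def entry_def frame_web_min_max)
  qed
  have jj: "polyfn_on Z C (?q k j j)" for k
  proof (rule polyfn_on_cong)
    show "polyfn_on Z C (\<lambda>y. - (\<Sum>p\<in>UNIV - {(j, j)}. ?x (fst p) y * ?q k (fst p) (snd p) y * ?x (snd p) y))"
      by (intro polyfn_on_intros cx off) auto
    fix y assume y: "y \<in> Z"
    obtain Q x s where yy: "y = (Q, x, s)" by (metis prod.exhaust)
    have "qf (Q $ k) x = 0" "x $ j = 1" using y by (auto simp: Z_def yy)
    then show "?q k j j y = - (\<Sum>p\<in>UNIV - {(j, j)}. ?x (fst p) y * ?q k (fst p) (snd p) y * ?x (snd p) y)"
      unfolding qf_def sum_pairs_remove[of _ j] by (simp add: yy case_prod_unfold add_eq_0_iff2)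
  qed
  have all: "polyfn_on Z C (?q k a b)" for k a b
    using off jj by (cases "(a, b) = (j, j)") auto
  have ce: "polyfn_on Z C (\<lambda>y. entry v (fst y))" for v
    using all[of "fst v" "fst (snd v)" "snd (snd v)"] by (simp add: entry_def case_prod_unfold)
  have c\<phi>: "polyfn_on Z C (\<phi> i)" for i
    unfolding \<phi>_def by (cases i) (auto intro: polyfn_on_mult ce cs cx)
  have ch: "polyfn_on Z C h"
  proof -
    define C' :: "((complex^8^8^4) \<times> (complex^8) \<Rightarrow> complex) set" where
      "C' = {\<lambda>y. fst y $ k $ a $ b | k a b. True} \<union> {\<lambda>y. snd y $ a | a. True}"
    have "polyfn C' (\<lambda>y. hU (fst y) (snd y))"
      by (intro polyfn_hU pf_coord) (auto simp: C'_def)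
    then have "polyfn_on Z C (\<lambda>y. hU (fst (fst y, ?s y *s fst (snd y))) (snd (fst y, ?s y *s fst (snd y))))"
      by (rule polyfn_on_compose) (auto simp: C'_def intro!: polyfn_on_mult[OF cs cx] all)
    then show ?thesis by (simp add: h_def)
  qed
  define zs where "zs = (Q0, inverse (x0 $ j) *s x0, x0 $ j)"
  have zsZ: "zs \<in> Z" using ex by (simp add: zs_def Z_def qf_scale)
  have zsh: "h zs \<noteq> 0" using ex by (simp add: zs_def h_def)
  have conn: "\<exists>\<gamma>. \<gamma> 0 = z \<and> \<gamma> 1 = zs \<and> (\<forall>t. \<gamma> t \<in> Z) \<and> (\<forall>c\<in>C. \<exists>p. \<forall>t. c (\<gamma> t) = poly p t)" if z: "z \<in> Z" for z
  proof -
    obtain Q x s where zz: "z = (Q, x, s)" by (metis prod.exhaust)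
    obtain Q' x' s' where zzs: "zs = (Q', x', s')" by (metis prod.exhaust)
    define X where "X t = (\<chi> a. x $ a + t * (x' $ a - x $ a))" for t
    \<comment> \<open>Straight segments, pushed back into \<open>Z\<close> by \<open>fixq\<close>.
      The correction touches only the diagonal entries at \<open>j\<close>, which are not in
      \<open>C\<close>, so the coordinates in \<open>C\<close> stay linear in
      \<open>t\<close>.\<close>
    define \<gamma> where "\<gamma> t = (fixq j (webline Q Q' t) (X t), X t, s + t * (s' - s))" for t
    have X01: "X 0 = x" "X 1 = x'" by (simp_all add: X_def vec_eq_iff)
    have Z1: "frame_web Q" "x $ j = 1" "\<And>k. qf (Q $ k) x = 0" using z by (auto simp: zz Z_def)
    have Z2: "frame_web Q'" "x' $ j = 1" "\<And>k. qf (Q' $ k) x' = 0" using zsZ by (auto simp: zzs Z_def)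
    have "\<gamma> 0 = z" "\<gamma> 1 = zs"
      using Z1 Z2 by (simp_all add: \<gamma>_def X01 webline_0 webline_1 fixq_id zz zzs)
    moreover have "\<gamma> t \<in> Z" for t
    proof -
      have "X t $ j = 1" using Z1 Z2 by (simp add: X_def)
      then show ?thesis using frame_web_fixq[OF frame_web_webline[OF Z1(1) Z2(1)] j]
        by (simp add: \<gamma>_def Z_def qf_fixq)
    qed
    moreover have "\<exists>p. \<forall>t. c (\<gamma> t) = poly p t" if "c \<in> C" for c
    proof -
      from that consider "c = ?s" | v where "v \<in> web_index - S" "c = (\<lambda>y. entry v (fst y))"
        | a where "c = (\<lambda>y. fst (snd y) $ a)" by (auto simp: C_def)
      then show ?thesis
      proof cases
        case 1
        then show ?thesis by (intro exI[of _ "[:s, s' - s:]"]) (simp add: \<gamma>_def)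
      next
        case 2
        obtain k a b where v: "v = (k, a, b)" by (metis prod.exhaust)
        have "\<not> (a = j \<and> b = j)" using 2(1) by (auto simp: v S_def)
        then show ?thesis
          by (intro exI[of _ "[:Q $ k $ a $ b, Q' $ k $ a $ b - Q $ k $ a $ b:]"])
            (auto simp: 2(2) v \<gamma>_def entry_def fixq_def webline_def)
      next
        case 3
        then show ?thesis by (intro exI[of _ "[:x $ a, x' $ a - x $ a:]"]) (simp add: \<gamma>_def X_def)
      qed
    qed
    ultimately show ?thesis by blast
  qed
  have "\<exists>N c. (\<exists>v. multipoly I N c v \<noteq> 0) \<and> (\<forall>z\<in>Z. h z = 0 \<longrightarrow> multipoly I N c (\<lambda>i. \<phi> i z) = 0)"
    by (rule algebraic_relation_on_hypersurface[where \<phi> = \<phi>, OF finC finI cC c\<phi> ch zsZ zsh conn])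
  then obtain N c where c: "\<exists>v. multipoly I N c v \<noteq> 0"
    "\<And>z. z \<in> Z \<Longrightarrow> h z = 0 \<Longrightarrow> multipoly I N c (\<lambda>i. \<phi> i z) = 0"
    by blast
  define G :: "complex^8^8^4 \<Rightarrow> complex^8 \<Rightarrow> complex" where
    "G Q b = multipoly I N c (\<lambda>i. case i of Inl v \<Rightarrow> entry v Q | Inr a \<Rightarrow> b $ a)" for Q b
  have "polyfn web_coords (\<lambda>Q. G Q b)" for b
    unfolding G_def by (rule polyfn_multipoly) (auto simp: I_def polyfn_entry pf_const)
  moreover have "polyfn vcoords (G Q)" for Q
    unfolding G_def by (rule polyfn_multipoly) (auto simp: I_def polyfn_vcoord pf_const)
  moreover have "G Q b = G Q b'" if "\<forall>a\<in>J. b $ a = b' $ a" for Q b b'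
    unfolding G_def by (rule multipoly_cong) (use that in \<open>auto simp: I_def\<close>)
  moreover have "\<exists>Q b. frame_web Q \<and> G Q b \<noteq> 0"
  proof -
    obtain v where v: "multipoly I N c v \<noteq> 0" using c(1) by blast
    have "G (webof (\<lambda>w. v (Inl w))) (\<chi> a. v (Inr a)) = multipoly I N c v"
      unfolding G_def by (rule multipoly_cong) (auto simp: I_def entry_webof)
    then show ?thesis using v frame_web_webof by metis
  qed
  moreover have "G Q x = 0" if "frame_web Q" "\<forall>k. qf (Q $ k) x = 0" "x $ j \<noteq> 0" "hU Q x = 0" for Q x
  proof -
    define z where "z = (Q, inverse (x $ j) *s x, x $ j)"
    have "z \<in> Z" "h z = 0" using that by (simp_all add: z_def Z_def qf_scale h_def)
    then have "multipoly I N c (\<lambda>i. \<phi> i z) = 0" by (rule c(2))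
    moreover have "multipoly I N c (\<lambda>i. \<phi> i z) = G Q x"
      unfolding G_def by (rule multipoly_cong) (use that in \<open>auto simp: \<phi>_def z_def I_def\<close>)
    ultimately show ?thesis by simp
  qed
  ultimately show ?thesis by blast
qed

section \<open>Density on the base locus\<close>

lemma has_derivative_vec_lambda:
  fixes g :: "'i::finite \<Rightarrow> 'a::real_normed_vector \<Rightarrow> complex"
  assumes "\<And>i. (g i has_derivative g' i) (at x)"
  shows "((\<lambda>x. \<chi> i. g i x) has_derivative (\<lambda>v. \<chi> i. g' i v)) (at x)"
proof (rule has_derivative_componentwise_within[THEN iffD2], rule ballI)
  fix b :: "complex^'i" assume "b \<in> Basis"
  then obtain i u where "b = axis i u" by (auto simp: Basis_vec_def)
  then show "((\<lambda>x. (\<chi> i. g i x) \<bullet> b) has_derivative (\<lambda>v. (\<chi> i. g' i v) \<bullet> b)) (at x)"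
    using has_derivative_inner_left[OF assms] by (simp add: inner_axis)
qed

lemma has_derivative_qf:
  assumes "Finite_Cartesian_Product.transpose A = A"
  shows "(qf A has_derivative (\<lambda>v. 2 * bl A x v)) (at x)"
proof -
  have nth: "((\<lambda>x. x $ i) has_derivative (\<lambda>v. v $ i)) (at x)" for i :: 8 and x :: "complex^8"
    by (rule bounded_linear.has_derivative[OF bounded_linear_vec_nth has_derivative_ident])
  have "((\<lambda>x. \<Sum>i\<in>UNIV. \<Sum>j\<in>UNIV. x $ i * A $ i $ j * x $ j) has_derivative
      (\<lambda>v. \<Sum>i\<in>UNIV. \<Sum>j\<in>UNIV. x $ i * A $ i $ j * v $ j + v $ i * A $ i $ j * x $ j)) (at x)"
    by (intro has_derivative_sum has_derivative_mult has_derivative_mult_left nth)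
  moreover have "(\<Sum>i\<in>UNIV. \<Sum>j\<in>UNIV. x $ i * A $ i $ j * v $ j + v $ i * A $ i $ j * x $ j) = 2 * bl A x v" for v
  proof -
    have "(\<Sum>i\<in>UNIV. \<Sum>j\<in>UNIV. x $ i * A $ i $ j * v $ j + v $ i * A $ i $ j * x $ j) = bl A x v + bl A v x"
      by (simp add: sum.distrib bl_def matrix_vector_mult_def sum_distrib_left mult.assoc)
    then show ?thesis using bl_commute[OF assms, of v x] by simp
  qed
  ultimately show ?thesis unfolding qf_def[abs_def] by simp
qed

text \<open>Four columns form a basis, so the corresponding coordinates can be solved for;
  \<open>J\<close> is the set of the other four, which stay free.\<close>

lemma complementary_coordinates:
  fixes M :: "complex^8^4"
  assumes "\<And>c. (\<Sum>k\<in>UNIV. c k *s row k M) = 0 \<Longrightarrow> (\<forall>k. c k = 0)"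
  shows "\<exists>J. card J = 4 \<and> (\<forall>c d. \<exists>v. M *v v = c \<and> (\<forall>a\<in>J. v $ a = d $ a))"
proof -
  have "\<exists>B. M ** B = mat 1" unfolding matrix_right_invertible_independent_rows using assms by blast
  then have sp: "vec.span (columns M) = UNIV" unfolding matrix_right_invertible_span_columns .
  obtain B where B: "B \<subseteq> columns M" "vec.independent B" "columns M \<subseteq> vec.span B" "card B = vec.dim (columns M)"
    by (rule vec.basis_exists)
  have spB: "vec.span B = UNIV" using vec.span_minimal[OF B(3) vec.subspace_span] sp by blast
  have "vec.dim (columns M) = 4" using vec.dim_span[of "columns M"] sp vec_dim_card[where 'n=4 and 'a=complex] by simp
  then have cB: "card B = 4" using B(4) by simp
  then have finB: "finite B" using card.infinite by fastforce
  have "\<forall>\<beta>\<in>B. \<exists>i. column i M = \<beta>" using B(1) by (auto simp: columns_def)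
  then obtain \<iota> where \<iota>: "\<And>\<beta>. \<beta> \<in> B \<Longrightarrow> column (\<iota> \<beta>) M = \<beta>" by metis
  have inj: "inj_on \<iota> B" by (rule inj_on_inverseI[of _ "\<lambda>i. column i M"]) (rule \<iota>)
  define K where "K = \<iota> ` B"
  have cK: "card K = 4" unfolding K_def by (simp add: card_image[OF inj] cB)
  have "card (- K) = 4" using cK by (simp add: Compl_eq_Diff_UNIV card_Diff_subset)
  moreover have "\<exists>v. M *v v = c \<and> (\<forall>a\<in>- K. v $ a = d $ a)" for c d
  proof -
    define d' where "d' = (\<chi> a. if a \<in> K then 0 else d $ a)"
    have "c - M *v d' \<in> vec.span B" using spB by simp
    then obtain r where r: "c - M *v d' = (\<Sum>\<beta>\<in>B. r \<beta> *s \<beta>)" unfolding vec.span_finite[OF finB] by auto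
    define e where "e = (\<chi> a. if a \<in> K then r (column a M) else 0)"
    have "M *v e = (\<Sum>a\<in>K. r (column a M) *s column a M)"
      unfolding matrix_mult_sum e_def by (rule sum.mono_neutral_cong_right) auto
    also have "\<dots> = (\<Sum>\<beta>\<in>B. r \<beta> *s \<beta>)"
      unfolding K_def by (subst sum.reindex[OF inj]) (simp add: \<iota>)
    finally have "M *v (d' + e) = c" using r by (simp add: matrix_vector_right_distrib algebra_simps)
    moreover have "(d' + e) $ a = d $ a" if "a \<in> - K" for a using that by (simp add: d'_def e_def)
    ultimately show ?thesis by blast
  qed
  ultimately show ?thesis by blast
qed

text \<open>An implicit function argument: the four quadrics together with the coordinates in
  \<open>J\<close> form a map with surjective derivative at \<open>x0\<close>, so it is open
  there.\<close>

lemma local_parametrization: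
  fixes x0 :: "complex^8"
  assumes Q: "frame_web Q" and q0: "\<And>k. qf (Q $ k) x0 = 0"
    and ind: "\<And>\<mu>. pencil Q \<mu> *v x0 = 0 \<Longrightarrow> \<mu> = 0"
  shows "\<exists>J. card J = 4 \<and> (\<forall>\<epsilon>>0. \<exists>\<delta>>0. \<forall>b. (\<forall>a\<in>J. norm (b $ a - x0 $ a) < \<delta>) \<longrightarrow>
    (\<exists>x. dist x0 x < \<epsilon> \<and> (\<forall>k. qf (Q $ k) x = 0) \<and> (\<forall>a\<in>J. x $ a = b $ a)))"
proof -
  define M :: "complex^8^4" where "M = (\<chi> k. Q $ k *v x0)"
  have tr: "Finite_Cartesian_Product.transpose (Q $ k) = Q $ k" for k
    using Q by (simp add: frame_web_def in_frame_def)
  have "\<forall>k. c k = 0" if c: "(\<Sum>k\<in>UNIV. c k *s row k M) = 0" for c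
  proof -
    have "pencil Q (\<chi> k. c k) *v x0 = 0"
      using c by (simp add: vec_eq_iff pencil_mult row_def M_def)
    then have "(\<chi> k. c k) = 0" by (rule ind)
    then show ?thesis by (simp add: vec_eq_iff)
  qed
  then obtain J where J: "card J = 4" "\<And>c d. \<exists>v. M *v v = c \<and> (\<forall>a\<in>J. v $ a = d $ a)"
    using complementary_coordinates[of M] by blast
  have "finite J" by simp
  then obtain e :: "4 \<Rightarrow> 8" where e: "bij_betw e UNIV J"
    using finite_same_card_bij[of "UNIV :: 4 set" J] J(1) by auto
  then have eJ: "e i \<in> J" for i by (auto simp: bij_betw_def)
  define f where "f x = ((\<chi> k. qf (Q $ k) x) :: complex^4, (\<chi> i. x $ e i) :: complex^4)" for x
  define f' where "f' v = ((\<chi> k. 2 * bl (Q $ k) x0 v) :: complex^4, (\<chi> i. v $ e i) :: complex^4)" for v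
  have der: "(f has_derivative f') (at x0)"
    unfolding f_def[abs_def] f'_def[abs_def]
    by (intro has_derivative_Pair has_derivative_vec_lambda has_derivative_qf tr
        bounded_linear.has_derivative[OF bounded_linear_vec_nth has_derivative_ident])
  have Mv: "(M *v v) $ k = bl (Q $ k) x0 v" for v k
    unfolding bl_commute[OF tr, of k x0 v] by (simp add: M_def matrix_vector_mult_def[of "\<chi> k. Q $ k *v x0"] bl_def mult.commute)
  have surj: "surj f'"
  proof -
    have "\<exists>v. f' v = (c, d)" for c d
    proof -
      \<comment> \<open>The halving compensates for the factor 2 in the derivative of a quadratic
        form.\<close>
      obtain v where v: "M *v v = (1 / 2) *s c" "\<forall>a\<in>J. v $ a = (\<chi> a. d $ the_inv e a) $ a" using J(2) by blast
      have "2 * bl (Q $ k) x0 v = c $ k" for k unfolding Mv[symmetric] v(1) by simp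
      moreover have "the_inv e (e i) = i" for i using e by (intro the_inv_f_f) (auto simp: bij_betw_def)
      ultimately have "f' v = (c, d)" using v(2) eJ by (simp add: f'_def vec_eq_iff)
      then show ?thesis by blast
    qed
    then show ?thesis by (metis prod.exhaust surj_def)
  qed
  have "linear f'" using has_derivative_linear[OF der] .
  then obtain g' where g': "linear g'" "f' \<circ> g' = id"
    using real_vector.linear_surjective_right_inverse surj by blast
  have cont: "continuous_on UNIV f"
  proof -
    have "continuous_on UNIV (qf (Q $ k))" for k
      unfolding qf_def[abs_def] by (intro continuous_intros)
    then show ?thesis unfolding f_def[abs_def] by (intro continuous_intros) auto
  qed
  have "\<exists>\<delta>>0. \<forall>b. (\<forall>a\<in>J. norm (b $ a - x0 $ a) < \<delta>) \<longrightarrow>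
    (\<exists>x. dist x0 x < \<epsilon> \<and> (\<forall>k. qf (Q $ k) x = 0) \<and> (\<forall>a\<in>J. x $ a = b $ a))" if \<epsilon>: "\<epsilon> > 0" for \<epsilon>
  proof -
    have "f x0 \<in> interior (f ` ball x0 \<epsilon>)"
      by (rule sussmann_open_mapping[of UNIV f x0 f' g' "ball x0 \<epsilon>"])
        (use cont der g' \<epsilon> in \<open>auto simp: linear_conv_bounded_linear\<close>)
    then obtain r where r: "r > 0" "ball (f x0) r \<subseteq> f ` ball x0 \<epsilon>" by (meson mem_interior)
    \<comment> \<open>Four coordinates, each off by less than \<open>r / 5\<close>, stay within the
      ball of radius \<open>r\<close>.\<close>
    have "\<exists>x. dist x0 x < \<epsilon> \<and> (\<forall>k. qf (Q $ k) x = 0) \<and> (\<forall>a\<in>J. x $ a = b $ a)"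
      if b: "\<forall>a\<in>J. norm (b $ a - x0 $ a) < r / 5" for b
    proof -
      define p where "p = (0 :: complex^4, (\<chi> i. b $ e i) :: complex^4)"
      have "(\<chi> k. qf (Q $ k) x0) = (0 :: complex^4)" by (simp add: vec_eq_iff q0)
      then have "dist (f x0) p = norm ((\<chi> i. x0 $ e i) - (\<chi> i. b $ e i) :: complex^4)"
        unfolding f_def p_def by (simp add: dist_norm norm_Pair)
      also have "\<dots> \<le> (\<Sum>i\<in>UNIV. norm (((\<chi> i. x0 $ e i) - (\<chi> i. b $ e i) :: complex^4) $ i))"
        by (rule norm_vec_le_sum)
      also have "\<dots> \<le> (\<Sum>i\<in>(UNIV::4 set). r / 5)"
        using b eJ by (intro sum_mono) (simp add: norm_minus_commute less_imp_le)
      also have "\<dots> < r" using r(1) by simp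
      finally have "p \<in> f ` ball x0 \<epsilon>" using r(2) by auto
      then obtain x where x: "dist x0 x < \<epsilon>" "p = f x" by auto
      have "qf (Q $ k) x = 0" for k using x(2) by (simp add: p_def f_def vec_eq_iff)
      moreover have "x $ a = b $ a" if aJ: "a \<in> J" for a
      proof -
        obtain i where "a = e i" using e aJ by (auto simp: bij_betw_def)
        then show ?thesis using x(2) by (simp add: p_def f_def vec_eq_iff)
      qed
      ultimately show ?thesis using x(1) by blast
    qed
    then show ?thesis using r(1) by (intro exI[of _ "r / 5"]) auto
  qed
  then show ?thesis using J(1) by blast
qed

text \<open>The webs form a linear space: on the line joining a web that is good for the product
  with one that is good for \<open>g i\<close>, both are nonzero polynomials in the
  parameter.\<close>

lemma frame_web_prod_nonzero:
  assumes "finite I" "\<And>i. i \<in> I \<Longrightarrow> polyfn web_coords (g i)" "\<And>i. i \<in> I \<Longrightarrow> \<exists>Q. frame_web Q \<and> g i Q \<noteq> 0"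
  shows "\<exists>Q. frame_web Q \<and> (\<forall>i\<in>I. g i Q \<noteq> 0)"
  using assms
proof (induction I rule: finite_induct)
  case empty
  then show ?case using frame_web_webof by blast
next
  case (insert i I)
  obtain Q where Q: "frame_web Q" "\<forall>i\<in>I. g i Q \<noteq> 0" using insert by blast
  obtain Q' where Q': "frame_web Q'" "g i Q' \<noteq> 0" using insert by blast
  have line: "\<exists>p. \<forall>t. c (webline Q Q' t) = poly p t" if cC: "c \<in> web_coords" for c
  proof -
    obtain k a b where "c = (\<lambda>Q. Q $ k $ a $ b)" using cC by (auto simp: web_coords_def)
    then show ?thesis
      by (intro exI[of _ "[:Q $ k $ a $ b, Q' $ k $ a $ b - Q $ k $ a $ b:]"]) (simp add: webline_def)
  qed
  have "polyfn web_coords (\<lambda>Q. \<Prod>i\<in>I. g i Q)" using insert by (intro polyfn_prod) auto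
  then obtain p where p: "\<And>t. (\<Prod>i\<in>I. g i (webline Q Q' t)) = poly p t"
    using polyfn_along_curve[of web_coords _ "webline Q Q'"] line by blast
  have "polyfn web_coords (g i)" using insert by auto
  then obtain q where q: "\<And>t. g i (webline Q Q' t) = poly q t"
    using polyfn_along_curve[of web_coords _ "webline Q Q'"] line by blast
  have "poly p 0 \<noteq> 0" using Q(2) insert(1) by (simp add: p[symmetric] webline_0)
  moreover have "poly q 1 \<noteq> 0" using Q'(2) by (simp add: q[symmetric] webline_1)
  ultimately obtain t where t: "poly p t \<noteq> 0" "poly q t \<noteq> 0" using poly_nonzero_avoid_finite by blast
  have "\<forall>i'\<in>insert i I. g i' (webline Q Q' t) \<noteq> 0"
    using t insert(1) by (auto simp: p[symmetric] q[symmetric])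
  then show ?case using frame_web_webline[OF Q(1) Q'(1)] by blast
qed

lemma continuous_zero_limit:
  fixes f :: "complex^'n \<Rightarrow> complex"
  assumes "continuous_on UNIV f" "\<And>\<epsilon>. \<epsilon> > 0 \<Longrightarrow> \<exists>x. dist x0 x < \<epsilon> \<and> f x = 0"
  shows "f x0 = 0"
proof (rule ccontr)
  assume "f x0 \<noteq> 0"
  moreover have "isCont f x0" using assms(1) by (simp add: continuous_on_eq_continuous_at)
  ultimately obtain \<delta> where "\<delta> > 0" "\<And>x. dist x0 x < \<delta> \<Longrightarrow> f x \<noteq> 0"
    using continuous_at_avoid[of x0 f 0] by blast
  then show False using assms(2) by blast
qed

lemma polyfn_line_near:
  fixes f :: "complex^'n \<Rightarrow> complex"
  assumes f: "polyfn vcoords f" and b: "f b \<noteq> 0" and \<delta>: "\<delta> > 0"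
  shows "\<exists>t. (\<forall>a. norm (t * (b $ a - x $ a)) < \<delta>) \<and> f (\<chi> a. x $ a + t * (b $ a - x $ a)) \<noteq> 0"
proof -
  have line: "\<exists>p. \<forall>t. c (\<chi> a. x $ a + t * (b $ a - x $ a)) = poly p t" if cC: "c \<in> vcoords" for c
  proof -
    obtain a where "c = (\<lambda>x. x $ a)" using cC by (auto simp: vcoords_def)
    then show ?thesis by (intro exI[of _ "[:x $ a, b $ a - x $ a:]"]) simp
  qed
  obtain p where p: "\<And>t. f (\<chi> a. x $ a + t * (b $ a - x $ a)) = poly p t"
    using polyfn_along_curve[OF f, of "\<lambda>t. \<chi> a. x $ a + t * (b $ a - x $ a)"] line by blast
  have "poly p 1 \<noteq> 0" using b by (simp add: p[symmetric])
  define K where "K = (\<Sum>a\<in>UNIV. norm (b $ a - x $ a)) + 1"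
  have K: "K > 0" unfolding K_def by (intro add_nonneg_pos sum_nonneg) auto
  then obtain t where t: "norm t < \<delta> / K" "poly p t \<noteq> 0"
    using poly_nonzero_near_0[OF \<open>poly p 1 \<noteq> 0\<close>, of "\<delta> / K"] \<delta> by auto
  have "norm (t * (b $ a - x $ a)) < \<delta>" for a
  proof -
    have "norm (b $ a - x $ a) \<le> (\<Sum>a\<in>UNIV. norm (b $ a - x $ a))" by (rule member_le_sum) auto
    then have "norm (b $ a - x $ a) \<le> K" by (simp add: K_def)
    then have "norm (t * (b $ a - x $ a)) \<le> norm t * K" by (simp add: norm_mult mult_left_mono)
    also have "\<dots> < \<delta>" using t(1) K by (simp add: field_simps)
    finally show ?thesis .
  qed
  then show ?thesis using t(2) p by metis
qed

section \<open>Smoothness at points of the plane and density\<close>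

text \<open>Up to a constant, a maximal minor of the Jacobian of the four quadrics. At points of
  \<open>P\<close> the gradient components 0 to 2 vanish for a frame web, so the columns are taken
  from the others.\<close>

definition plane_minor :: "complex^8^8^4 \<Rightarrow> complex^8 \<Rightarrow> complex" where
  "plane_minor Q x = det ((\<chi> k l. (Q $ k *v x) $ (if l = 0 then 3 else if l = 1 then 4 else if l = 2 then 5 else 6))
     :: complex^4^4)"

lemma plane_minor_independent:
  assumes "plane_minor Q x \<noteq> 0" "pencil Q \<mu> *v x = 0"
  shows "\<mu> = 0"
proof -
  define M :: "complex^4^4" where
    "M = (\<chi> k l. (Q $ k *v x) $ (if l = 0 then 3 else if l = 1 then 4 else if l = 2 then 5 else 6))"
  have "invertible M" using assms(1) by (simp add: plane_minor_def M_def invertible_det_nz)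
  then have ind: "\<And>c. (\<Sum>k\<in>UNIV. c k *s row k M) = 0 \<Longrightarrow> (\<forall>k. c k = 0)"
    unfolding invertible_right_inverse matrix_right_invertible_independent_rows by blast
  have "(\<Sum>k\<in>UNIV. \<mu> $ k *s row k M) $ l = 0" for l
  proof -
    have "(\<Sum>k\<in>UNIV. \<mu> $ k *s row k M) $ l
        = (pencil Q \<mu> *v x) $ (if l = 0 then 3 else if l = 1 then 4 else if l = 2 then 5 else 6)"
      unfolding pencil_mult by (simp add: row_def M_def)
    then show ?thesis using assms(2) by simp
  qed
  then have "(\<Sum>k\<in>UNIV. \<mu> $ k *s row k M) = 0" by (simp add: vec_eq_iff)
  then have "\<forall>k. \<mu> $ k = 0" using ind[of "\<lambda>k. \<mu> $ k"] by blast
  then show ?thesis by (simp add: vec_eq_iff)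
qed

lemma polyfn_plane_minor: "polyfn web_coords (\<lambda>Q. plane_minor Q x)"
  unfolding plane_minor_def[abs_def] det_def vec_lambda_beta
  by (intro polyfn_intros polyfn_mult_vec polyfn_web_coord)

lemma plane_minor_nonzero: "\<exists>Q. frame_web Q \<and> plane_minor Q (axis 0 1) \<noteq> 0"
proof -
  define \<iota> :: "4 \<Rightarrow> 8" where "\<iota> l = (if l = 0 then 3 else if l = 1 then 4 else if l = 2 then 5 else 6)" for l
  have \<iota>: "\<iota> l = \<iota> k \<longleftrightarrow> l = k" "\<iota> l \<noteq> 0" "\<iota> l \<notin> Pidx" for l k
    using UNIV_4' by (auto simp: \<iota>_def Pidx_def)
  \<comment> \<open>The quadrics \<open>2 * x $ 0 * x $ (\<iota> k)\<close>; their matrices send the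
    first basis vector to distinct basis vectors, so the minor there is that of the
    identity.\<close>
  define Q :: "complex^8^8^4" where
    "Q = (\<chi> k a b. if (a = 0 \<and> b = \<iota> k) \<or> (b = 0 \<and> a = \<iota> k) then 1 else 0)"
  have "frame_web Q" by (rule frame_webI) (use \<iota>(3) in \<open>auto simp: Q_def\<close>)
  moreover have "plane_minor Q (axis 0 1) = det (mat 1 :: complex^4^4)"
    unfolding plane_minor_def \<iota>_def[symmetric]
    by (rule arg_cong[of _ _ det]) (auto simp: vec_eq_iff mat_def matrix_mult_axis Q_def \<iota>)
  ultimately show ?thesis by auto
qed

lemma dense_base_locus:
  assumes Q: "frame_web Q"
    and smooth: "\<And>x \<mu> j. x \<in> base_locus Q \<Longrightarrow> j \<notin> Pidx \<Longrightarrow> x $ j \<noteq> 0 \<Longrightarrow> pencil Q \<mu> *v x = 0 \<Longrightarrow> \<mu> = 0"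
    and G: "\<And>j J. j \<notin> Pidx \<Longrightarrow> card J = 4 \<Longrightarrow> \<exists>g. polyfn vcoords g \<and> (\<exists>b. g b \<noteq> 0) \<and>
      (\<forall>b b'. (\<forall>a\<in>J. b $ a = b' $ a) \<longrightarrow> g b = g b') \<and>
      (\<forall>x\<in>base_locus Q. x $ j \<noteq> 0 \<longrightarrow> hU Q x = 0 \<longrightarrow> g x = 0)"
    and plane: "plane_minor Q (axis 0 1) \<noteq> 0"
  shows "wdense (\<lambda>_. 1) (base_locus Q) {x \<in> base_locus Q. hU Q x \<noteq> 0}"
  unfolding wdense_def
proof (intro conjI allI impI ballI)
  fix f d x assume f: "whom (\<lambda>_. 1) d f \<and> (\<forall>x\<in>{x \<in> base_locus Q. hU Q x \<noteq> 0}. f x = 0)" and x: "x \<in> base_locus Q"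
  have cont: "continuous_on UNIV f" using f continuous_polyfn_vcoords by (auto simp: whom_def)
  have off: "f x = 0" if x: "x \<in> base_locus Q" and j: "j \<notin> Pidx" "x $ j \<noteq> 0" for x j
  proof (rule continuous_zero_limit[OF cont])
    fix \<epsilon> :: real assume "\<epsilon> > 0"
    have "isCont (\<lambda>x. x $ j) x" by (intro continuous_intros)
    then obtain \<epsilon>1 where \<epsilon>1: "\<epsilon>1 > 0" "\<And>x'. dist x x' < \<epsilon>1 \<Longrightarrow> x' $ j \<noteq> 0"
      using continuous_at_avoid[of x "\<lambda>x. x $ j" 0] j(2) by blast
    have qx: "\<And>k. qf (Q $ k) x = 0" using x by (simp add: base_locus_def)
    obtain J where J: "card J = 4" "\<And>\<epsilon>. \<epsilon> > 0 \<Longrightarrow> \<exists>\<delta>>0. \<forall>b. (\<forall>a\<in>J. norm (b $ a - x $ a) < \<delta>) \<longrightarrow>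
      (\<exists>x'. dist x x' < \<epsilon> \<and> (\<forall>k. qf (Q $ k) x' = 0) \<and> (\<forall>a\<in>J. x' $ a = b $ a))"
      using local_parametrization[OF Q qx smooth[OF x j]] by blast
    obtain \<delta> where \<delta>: "\<delta> > 0" "\<And>b. (\<forall>a\<in>J. norm (b $ a - x $ a) < \<delta>) \<Longrightarrow>
      (\<exists>x'. dist x x' < min \<epsilon> \<epsilon>1 \<and> (\<forall>k. qf (Q $ k) x' = 0) \<and> (\<forall>a\<in>J. x' $ a = b $ a))"
      using J(2)[of "min \<epsilon> \<epsilon>1"] \<open>\<epsilon> > 0\<close> \<epsilon>1(1) by auto
    obtain g b where g: "polyfn vcoords g" "g b \<noteq> 0" "\<And>b b'. (\<forall>a\<in>J. b $ a = b' $ a) \<Longrightarrow> g b = g b'"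
      "\<And>x. x \<in> base_locus Q \<Longrightarrow> x $ j \<noteq> 0 \<Longrightarrow> hU Q x = 0 \<Longrightarrow> g x = 0"
      using G[OF j(1) J(1)] by blast
    \<comment> \<open>Only the coordinates in \<open>J\<close> of this perturbed point matter:
      \<open>x'\<close> is a base point sharing them, and \<open>g\<close> depends on nothing
      else.\<close>
    obtain t where t: "\<forall>a. norm (t * (b $ a - x $ a)) < \<delta>" "g (\<chi> a. x $ a + t * (b $ a - x $ a)) \<noteq> 0"
      using polyfn_line_near[OF g(1,2) \<delta>(1)] by blast
    obtain x' where x': "dist x x' < min \<epsilon> \<epsilon>1" "\<forall>k. qf (Q $ k) x' = 0"
      "\<forall>a\<in>J. x' $ a = (\<chi> a. x $ a + t * (b $ a - x $ a)) $ a"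
      using \<delta>(2)[of "\<chi> a. x $ a + t * (b $ a - x $ a)"] t(1) by auto
    have xj: "x' $ j \<noteq> 0" using \<epsilon>1(2) x'(1) by auto
    then have "x' \<noteq> 0" by auto
    then have xB: "x' \<in> base_locus Q" using x'(2) by (simp add: base_locus_def)
    have "g x' \<noteq> 0" using g(3)[OF x'(3)] t(2) by simp
    then have "hU Q x' \<noteq> 0" using g(4)[OF xB xj] by blast
    then have "f x' = 0" using f xB by auto
    then show "\<exists>x'. dist x x' < \<epsilon> \<and> f x' = 0" using x'(1) by auto
  qed
  show "f x = 0"
  proof (cases "\<exists>j. j \<notin> Pidx \<and> x $ j \<noteq> 0")
    case True
    then show ?thesis using off[OF x] by blast
  next
    case False
    have pm: "polyfn vcoords (plane_minor Q)"
      unfolding plane_minor_def[abs_def] det_def vec_lambda_beta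
      by (intro polyfn_intros polyfn_mult_vec polyfn_vcoord)
    have smooth_pt: "f p = 0" if p: "plane_minor Q p \<noteq> 0" "\<And>j. j \<notin> Pidx \<Longrightarrow> p $ j = 0" for p
    proof (rule continuous_zero_limit[OF cont])
      fix \<epsilon> :: real assume \<epsilon>: "\<epsilon> > 0"
      have qp: "qf (Q $ k) p = 0" for k
      proof -
        have "p $ i * Q $ k $ i $ j * p $ j = 0" for i j
          using p(2)[of i] p(2)[of j] frame_web_zero[OF Q, of i j k]
          by (cases "i \<in> Pidx"; cases "j \<in> Pidx") auto
        then show ?thesis unfolding qf_def by (intro sum.neutral ballI)
      qed
      obtain J where J: "card J = 4" "\<And>\<epsilon>. \<epsilon> > 0 \<Longrightarrow> \<exists>\<delta>>0. \<forall>b. (\<forall>a\<in>J. norm (b $ a - p $ a) < \<delta>) \<longrightarrow>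
        (\<exists>x'. dist p x' < \<epsilon> \<and> (\<forall>k. qf (Q $ k) x' = 0) \<and> (\<forall>a\<in>J. x' $ a = b $ a))"
        using local_parametrization[OF Q qp plane_minor_independent[OF p(1)]] by blast
      obtain \<delta> where \<delta>: "\<delta> > 0" "\<And>b. (\<forall>a\<in>J. norm (b $ a - p $ a) < \<delta>) \<Longrightarrow>
        (\<exists>x'. dist p x' < \<epsilon> \<and> (\<forall>k. qf (Q $ k) x' = 0) \<and> (\<forall>a\<in>J. x' $ a = b $ a))"
        using J(2)[OF \<epsilon>] by auto
      \<comment> \<open>Four free coordinates cannot all belong to \<open>P\<close>, so moving one
        of them leads off the plane while staying on the base locus.\<close>
      have "\<not> J \<subseteq> Pidx"
      proof
        assume "J \<subseteq> Pidx"
        then have "card J \<le> card Pidx" by (intro card_mono) auto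
        also have "card Pidx \<le> 3" unfolding Pidx_def by (simp add: card_insert_if)
        finally show False using J(1) by simp
      qed
      then obtain j where j: "j \<in> J" "j \<notin> Pidx" by blast
      define b where "b = (\<chi> a. p $ a + of_real (\<delta> / 2))"
      have "\<forall>a\<in>J. norm (b $ a - p $ a) < \<delta>" using \<delta>(1) by (simp add: b_def)
      then obtain x' where x': "dist p x' < \<epsilon>" "\<forall>k. qf (Q $ k) x' = 0" "\<forall>a\<in>J. x' $ a = b $ a"
        using \<delta>(2) by blast
      have xj: "x' $ j \<noteq> 0" using x'(3) j p(2)[OF j(2)] \<delta>(1) by (simp add: b_def)
      then have "x' \<noteq> 0" by auto
      then have "x' \<in> base_locus Q" using x'(2) by (simp add: base_locus_def)
      then have "f x' = 0" using off[OF _ j(2) xj] by blast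
      then show "\<exists>x'. dist p x' < \<epsilon> \<and> f x' = 0" using x'(1) by blast
    qed
    show ?thesis
    proof (rule continuous_zero_limit[OF cont])
      fix \<epsilon> :: real assume \<epsilon>: "\<epsilon> > 0"
      \<comment> \<open>The segment towards the first basis vector stays inside \<open>P\<close>;
        with \<open>\<epsilon> / 9\<close> the eight coordinates together move by less than
        \<open>\<epsilon>\<close>.\<close>
      then obtain t where t: "\<forall>a. norm (t * (axis 0 1 $ a - x $ a)) < \<epsilon> / 9"
        "plane_minor Q (\<chi> a. x $ a + t * (axis 0 1 $ a - x $ a)) \<noteq> 0"
        using polyfn_line_near[OF pm plane, of "\<epsilon> / 9" x] by auto
      define p where "p = (\<chi> a. x $ a + t * (axis 0 1 $ a - x $ a))"
      have "p $ j = 0" if "j \<notin> Pidx" for j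
      proof -
        have "j \<noteq> 0" using that by (auto simp: Pidx_def)
        moreover have "x $ j = 0" using False that by blast
        ultimately show ?thesis by (simp add: p_def axis_def)
      qed
      then have "f p = 0" using smooth_pt t(2) by (simp add: p_def)
      moreover have "dist x p < \<epsilon>"
      proof -
        have "dist x p = norm (p - x)" by (simp add: dist_norm norm_minus_commute)
        also have "\<dots> \<le> (\<Sum>a\<in>UNIV. norm ((p - x) $ a))" by (rule norm_vec_le_sum)
        also have "\<dots> \<le> (\<Sum>a\<in>(UNIV::8 set). \<epsilon> / 9)"
          using t(1) by (intro sum_mono) (simp add: p_def less_imp_le)
        also have "\<dots> < \<epsilon>" using \<epsilon> by simp
        finally show ?thesis .
      qed
      ultimately show "\<exists>p. dist x p < \<epsilon> \<and> f p = 0" by blast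
    qed
  qed
qed auto

lemma generic_dense_U:
  assumes ex: "frame_web Q0" "\<And>k. qf (Q0 $ k) x0 = 0" "\<And>j. j \<notin> Pidx \<Longrightarrow> x0 $ j \<noteq> 0" "hU Q0 x0 \<noteq> 0"
  shows "\<exists>g. polyfn web_coords g \<and> (\<exists>Q. frame_web Q \<and> g Q \<noteq> 0) \<and>
    (\<forall>Q. frame_web Q \<longrightarrow> g Q \<noteq> 0 \<longrightarrow> wdense (\<lambda>_. 1) (base_locus Q) {x \<in> base_locus Q. hU Q x \<noteq> 0})"
proof -
  define Ps where "Ps j i g \<longleftrightarrow> polyfn web_coords g \<and> (\<exists>Q. frame_web Q \<and> g Q \<noteq> 0) \<and>
    (\<forall>Q x \<mu>. frame_web Q \<longrightarrow> x $ j = 1 \<longrightarrow> \<mu> $ i = 1 \<longrightarrow> (\<forall>k. qf (Q $ k) x = 0) \<longrightarrow>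
       pencil Q \<mu> *v x = 0 \<longrightarrow> g Q = 0)" for j i g
  have "\<forall>j i. \<exists>g. j \<notin> Pidx \<longrightarrow> Ps j i g"
    unfolding Ps_def using generic_smooth_chart by blast
  then obtain s where s0: "\<And>j i. j \<notin> Pidx \<Longrightarrow> Ps j i (s j i)" by metis
  have s: "polyfn web_coords (s j i)" "\<exists>Q. frame_web Q \<and> s j i Q \<noteq> 0"
    "\<And>Q x \<mu>. frame_web Q \<Longrightarrow> x $ j = 1 \<Longrightarrow> \<mu> $ i = 1 \<Longrightarrow> (\<forall>k. qf (Q $ k) x = 0) \<Longrightarrow>
       pencil Q \<mu> *v x = 0 \<Longrightarrow> s j i Q = 0" if "j \<notin> Pidx" for j i
    using s0[OF that, of i] unfolding Ps_def by blast+
  define PG where "PG j J G \<longleftrightarrow> (\<forall>b. polyfn web_coords (\<lambda>Q. G Q b)) \<and> (\<forall>Q. polyfn vcoords (G Q)) \<and>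
    (\<forall>Q b b'. (\<forall>a\<in>J. b $ a = b' $ a) \<longrightarrow> G Q b = G Q b') \<and> (\<exists>Q b. frame_web Q \<and> G Q b \<noteq> 0) \<and>
    (\<forall>Q x. frame_web Q \<longrightarrow> (\<forall>k. qf (Q $ k) x = 0) \<longrightarrow> x $ j \<noteq> 0 \<longrightarrow> hU Q x = 0 \<longrightarrow> G Q x = 0)" for j J G
  have "\<forall>j J. \<exists>G. j \<notin> Pidx \<longrightarrow> card J = 4 \<longrightarrow> PG j J G"
    unfolding PG_def using generic_dense_chart[OF _ _ ex(1,2) ex(3) ex(4)] by blast
  then obtain G where G0: "\<And>j J. j \<notin> Pidx \<Longrightarrow> card J = 4 \<Longrightarrow> PG j J (G j J)" by metis
  have G: "\<And>b. polyfn web_coords (\<lambda>Q. G j J Q b)" "\<And>Q. polyfn vcoords (G j J Q)"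
    "\<And>Q b b'. (\<forall>a\<in>J. b $ a = b' $ a) \<Longrightarrow> G j J Q b = G j J Q b'" "\<exists>b Q. frame_web Q \<and> G j J Q b \<noteq> 0"
    "\<And>Q x. frame_web Q \<Longrightarrow> (\<forall>k. qf (Q $ k) x = 0) \<Longrightarrow> x $ j \<noteq> 0 \<Longrightarrow> hU Q x = 0 \<Longrightarrow> G j J Q x = 0"
    if "j \<notin> Pidx" "card J = 4" for j J
    using G0[OF that] unfolding PG_def by blast+
  \<comment> \<open>Evaluation at a suitable fixed \<open>b\<close> turns \<open>G j J\<close> into
    a polynomial in the web alone, whose nonvanishing shows that \<open>G j J Q\<close> is not
    identically zero.\<close>
  define b where "b j J = (SOME b. \<exists>Q. frame_web Q \<and> G j J Q b \<noteq> 0)" for j J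
  have b: "\<exists>Q. frame_web Q \<and> G j J Q (b j J) \<noteq> 0" if "j \<notin> Pidx" "card J = 4" for j J
    unfolding b_def by (rule someI_ex) (rule G(4)[OF that])
  define I1 :: "(8 \<times> 4) set" where "I1 = (- Pidx) \<times> UNIV"
  define I2 :: "(8 \<times> 8 set) set" where "I2 = (- Pidx) \<times> {J. card J = 4}"
  define g where "g = (\<lambda>i Q. case i of Inl (j, i) \<Rightarrow> s j i Q | Inr None \<Rightarrow> plane_minor Q (axis 0 1)
    | Inr (Some (j, J)) \<Rightarrow> G j J Q (b j J))"
  define I where "I = Inl ` I1 \<union> Inr ` (insert None (Some ` I2))"
  have "finite I" by (simp add: I_def)
  moreover have gp: "polyfn web_coords (g i)" if "i \<in> I" for i
    using that s(1) G(1) polyfn_plane_minor by (auto simp: I_def g_def I1_def I2_def)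
  moreover have "\<exists>Q. frame_web Q \<and> g i Q \<noteq> 0" if "i \<in> I" for i
    using that s(2) b plane_minor_nonzero by (auto simp: I_def g_def I1_def I2_def)
  ultimately obtain Q where Q: "frame_web Q" "\<forall>i\<in>I. g i Q \<noteq> 0"
    using frame_web_prod_nonzero[of I g] by blast
  define gg where "gg Q = (\<Prod>i\<in>I. g i Q)" for Q
  have "polyfn web_coords gg" unfolding gg_def[abs_def] using gp by (rule polyfn_prod)
  moreover have "\<exists>Q. frame_web Q \<and> gg Q \<noteq> 0" using Q \<open>finite I\<close> by (auto simp: gg_def)
  moreover have "wdense (\<lambda>_. 1) (base_locus Q) {x \<in> base_locus Q. hU Q x \<noteq> 0}"
    if Q: "frame_web Q" and gQ: "gg Q \<noteq> 0" for Q
  proof (rule dense_base_locus[OF Q])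
    have nz: "g i Q \<noteq> 0" if "i \<in> I" for i using gQ \<open>finite I\<close> that by (auto simp: gg_def)
    show "plane_minor Q (axis 0 1) \<noteq> 0" using nz[of "Inr None"] by (simp add: I_def g_def)
    fix j :: 8
    assume j: "j \<notin> Pidx"
    show "\<mu> = 0" if x: "x \<in> base_locus Q" "x $ j \<noteq> 0" and \<mu>: "pencil Q \<mu> *v x = 0" for x \<mu>
    proof (rule ccontr)
      assume "\<mu> \<noteq> 0"
      then obtain i where i: "\<mu> $ i \<noteq> 0" by (auto simp: vec_eq_iff)
      have "s j i Q = 0"
      proof (rule s(3)[OF j Q, of "inverse (x $ j) *s x" "inverse (\<mu> $ i) *s \<mu>"])
        show "\<forall>k. qf (Q $ k) (inverse (x $ j) *s x) = 0" using x(1) by (simp add: qf_scale base_locus_def)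
        show "pencil Q (inverse (\<mu> $ i) *s \<mu>) *v (inverse (x $ j) *s x) = 0"
          by (simp add: pencil_scale smat_mult mult_scale \<mu>)
      qed (use x i in auto)
      then show False using nz[of "Inl (j, i)"] j by (simp add: I_def g_def I1_def)
    qed
    fix J :: "8 set" assume J: "card J = 4"
    have "Inr (Some (j, J)) \<in> I" using j J by (simp add: I_def I2_def)
    from nz[OF this] have nzG: "G j J Q (b j J) \<noteq> 0" by (simp add: g_def)
    show "\<exists>g. polyfn vcoords g \<and> (\<exists>b. g b \<noteq> 0) \<and>
      (\<forall>b b'. (\<forall>a\<in>J. b $ a = b' $ a) \<longrightarrow> g b = g b') \<and>
      (\<forall>x\<in>base_locus Q. x $ j \<noteq> 0 \<longrightarrow> hU Q x = 0 \<longrightarrow> g x = 0)"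
    proof (intro exI[of _ "G j J Q"] conjI allI impI ballI)
      show "G j J Q x = 0" if "x \<in> base_locus Q" "x $ j \<noteq> 0" "hU Q x = 0" for x
        using G(5)[OF j J Q _ that(2,3)] that(1) by (simp add: base_locus_def)
    qed (use G(2,3)[OF j J] nzG in blast)+
  qed
  ultimately show ?thesis by blast
qed

section \<open>A general web and change of coordinates\<close>

text \<open>At \<open>\<lambda> = (0, 0, 0, 1)\<close> the \<open>3 \<times> 5\<close> block is \<open>[I | -2 | -1]\<close> and the binary form is \<open>t\<^sup>2 - s\<^sup>2\<close>, so the two
  isotropic vectors are explicit, and \<open>hV\<close> is nonzero at both.\<close>

definition exval :: "4 \<Rightarrow> 8 \<Rightarrow> 8 \<Rightarrow> complex" where
  "exval k a b =
    (if (k, a, b) \<in> {(0, 0, 6), (1, 1, 6), (2, 2, 6), (3, 0, 3), (3, 1, 4), (3, 2, 5), (3, 7, 7)} then 1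
     else if (k, a, b) \<in> {(3, 0, 6), (3, 1, 6), (3, 2, 6)} then - 2
     else if (k, a, b) \<in> {(3, 0, 7), (3, 1, 7), (3, 2, 7), (3, 6, 6)} then - 1 else 0)"

definition exweb :: "complex^8^8^4" where
  "exweb = (\<chi> k a b. exval k a b + (if a = b then 0 else exval k b a))"

lemma exval_zero: "b \<in> Pidx \<Longrightarrow> exval k a b = 0"
  unfolding Pidx_def by (elim insertE emptyE) (simp_all add: exval_def)

lemma frame_web_exweb: "frame_web exweb"
  by (rule frame_webI) (simp_all add: exweb_def exval_zero add.commute)

lemma exweb_rows:
  "(exweb $ 0 *v x) $ 0 = x $ 6" "(exweb $ 0 *v x) $ 1 = 0" "(exweb $ 0 *v x) $ 2 = 0"
  "(exweb $ 1 *v x) $ 0 = 0" "(exweb $ 1 *v x) $ 1 = x $ 6" "(exweb $ 1 *v x) $ 2 = 0"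
  "(exweb $ 2 *v x) $ 0 = 0" "(exweb $ 2 *v x) $ 1 = 0" "(exweb $ 2 *v x) $ 2 = x $ 6"
  "(exweb $ 3 *v x) $ 0 = x $ 3 - 2 * x $ 6 - x $ 7" "(exweb $ 3 *v x) $ 1 = x $ 4 - 2 * x $ 6 - x $ 7"
  "(exweb $ 3 *v x) $ 2 = x $ 5 - 2 * x $ 6 - x $ 7"
  by (simp_all add: matrix_vector_mult_def sum_8 exweb_def exval_def)

lemma qf_exweb:
  assumes "x $ 0 = 0" "x $ 1 = 0" "x $ 2 = 0"
  shows "qf (exweb $ 0) x = 0" "qf (exweb $ 1) x = 0" "qf (exweb $ 2) x = 0"
    "qf (exweb $ 3) x = (x $ 7)\<^sup>2 - (x $ 6)\<^sup>2"
  using assms by (simp_all add: qf_def sum_8 exweb_def exval_def power2_eq_square)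

lemma exweb_kernel:
  "mB (exweb $ 3) = 1" "lv (exweb $ 3) = vec8 0 0 0 1 1 1 0 1" "kv (exweb $ 3) = vec8 0 0 0 2 2 2 1 0"
  by (simp_all add: mB_def kv_def lv_def Let_def minor3_def det3_def exweb_def exval_def)

lemma ga_exweb: "ga (exweb $ 3) = 1"
  unfolding ga_def qf_eq_bl[symmetric] exweb_kernel by (simp add: qf_exweb)

lemma lam_exweb_3: "lam exweb x $ 3 = - (x $ 6 ^ 3)"
  by (simp add: lam_def Let_def minor3_def det3_def exweb_rows power3_eq_cube)

lemma pencil_axis: "l = vec4 0 0 0 1 \<Longrightarrow> pencil Q l = Q $ 3"
  by (simp add: pencil_def vec_eq_iff sum_4')

text \<open>Coordinate 6 of the isotropic vector is \<open>ga * mB = 1\<close> for every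
  \<open>w\<close>, so both sheets are handled at once.\<close>

lemma hV_exweb:
  assumes "zlam z = zlam (vec5 0 0 0 1 0)"
  shows "hV exweb z \<noteq> 0"
proof -
  have l: "zlam z = vec4 0 0 0 1" unfolding assms by (simp add: vec_eq_iff all_4')
  have z3: "z $ 3 = 1" using arg_cong[OF assms, of "\<lambda>v. v $ 3"] by simp
  show ?thesis
    unfolding hV_def Let_def pencil_axis[OF l]
    by (simp add: z3 exweb_kernel ga_exweb lam_exweb_3 isovec_def)
qed

text \<open>The point is the sum of \<open>kv\<close> and \<open>lv\<close>, hence on the isotropic
  line with coordinates 6 and 7 equal. Its coordinates off \<open>P\<close> are all nonzero, so it
  serves in every chart.\<close>

lemma hU_exweb: "hU exweb (vec8 0 0 0 3 3 3 1 1) \<noteq> 0"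
proof -
  have "lam exweb (vec8 0 0 0 3 3 3 1 1) = (- 1) *s vec4 0 0 0 1"
    by (simp add: vec_eq_iff all_4' lam_def Let_def minor3_def det3_def exweb_rows)
  then have "pencil exweb (lam exweb (vec8 0 0 0 3 3 3 1 1)) = smat (- 1) (exweb $ 3)"
    by (simp only: pencil_scale pencil_axis[OF refl])
  then show ?thesis
    unfolding hU_def Let_def by (simp add: mB_smat ga_smat exweb_kernel ga_exweb lam_exweb_3)
qed

lemma generic_birational_frame:
  "\<exists>g. polyfn web_coords g \<and> (\<exists>Q. frame_web Q \<and> (\<forall>l. pencil Q l = 0 \<longrightarrow> l = 0) \<and> g Q \<noteq> 0) \<and>
    (\<forall>Q. frame_web Q \<longrightarrow> g Q \<noteq> 0 \<longrightarrow> birational (\<lambda>_. 1) (base_locus Q) wZ (double_cover Q))"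
proof -
  obtain gU where gU: "polyfn web_coords gU" "\<exists>Q. frame_web Q \<and> gU Q \<noteq> 0"
    "\<And>Q. frame_web Q \<Longrightarrow> gU Q \<noteq> 0 \<Longrightarrow> wdense (\<lambda>_. 1) (base_locus Q) {x \<in> base_locus Q. hU Q x \<noteq> 0}"
  proof -
    have "qf (exweb $ k) (vec8 0 0 0 3 3 3 1 1) = 0" for k
    proof -
      have "\<forall>k. qf (exweb $ k) (vec8 0 0 0 3 3 3 1 1) = 0"
        unfolding all_4' by (simp add: qf_exweb)
      then show ?thesis by blast
    qed
    moreover have "vec8 0 0 0 3 3 3 1 1 $ j \<noteq> 0" if "j \<notin> Pidx" for j
    proof -
      have "j \<noteq> 0" "j \<noteq> 1" "j \<noteq> 2" using that by (auto simp: Pidx_def)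
      then show ?thesis by (simp add: vec8_def)
    qed
    ultimately show thesis
      using generic_dense_U[OF frame_web_exweb _ _ hU_exweb] that by blast
  qed
  obtain gV where gV: "polyfn web_coords gV" "gV exweb \<noteq> 0"
    "\<And>Q. gV Q \<noteq> 0 \<Longrightarrow> wdense wZ (double_cover Q) {z \<in> double_cover Q. hV Q z \<noteq> 0}"
    "\<And>Q. gV Q \<noteq> 0 \<Longrightarrow> \<exists>z\<in>double_cover Q. hV Q z \<noteq> 0"
  proof -
    have "vec5 0 0 0 1 0 $ 3 \<noteq> 0" by simp
    from generic_dense_V[OF this, of exweb] hV_exweb show thesis using that by blast
  qed
  \<comment> \<open>The plane minor joins the product so that the web found has linearly independent
    quadrics. It fills the last two places of the index type \<open>4\<close>.\<close>
  define g where "g = (\<lambda>i::4. if i = 0 then gU else if i = 1 then gV else (\<lambda>Q. plane_minor Q (axis 0 1)))"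
  have gp: "polyfn web_coords (g i)" for i
    using gU(1) gV(1) polyfn_plane_minor by (simp add: g_def)
  have "\<exists>Q. frame_web Q \<and> g i Q \<noteq> 0" for i
    using gU(2) gV(2) frame_web_exweb plane_minor_nonzero by (auto simp: g_def)
  then obtain Q where Q: "frame_web Q" "\<forall>i\<in>UNIV. g i Q \<noteq> 0"
    using frame_web_prod_nonzero[of UNIV g] gp by auto
  define gg where "gg Q = (\<Prod>i\<in>UNIV. g i Q)" for Q
  have gg: "g i Q \<noteq> 0" if "gg Q \<noteq> 0" for i Q using that by (auto simp: gg_def)
  have "polyfn web_coords gg" unfolding gg_def[abs_def] using gp by (intro polyfn_prod)
  moreover have "gg Q \<noteq> 0" using Q(2) by (simp add: gg_def)
  moreover have "l = 0" if "pencil Q l = 0" for l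
    using plane_minor_independent[of Q "axis 0 1" l] gg[OF \<open>gg Q \<noteq> 0\<close>, of 2] that by (simp add: g_def)
  moreover have "birational (\<lambda>_. 1) (base_locus Q) wZ (double_cover Q)" if "frame_web Q" "gg Q \<noteq> 0" for Q
    using gg[OF that(2), of 0] gg[OF that(2), of 1] gU(3) gV(3,4) that(1)
    by (intro birational_frame) (auto simp: g_def)
  ultimately show ?thesis using Q(1) by blast
qed

section \<open>Transport of birationality along polynomial automorphisms\<close>

text \<open>Polynomial automorphisms of the affine space that commute with the weighted action, and
  so descend to weighted projective space.\<close>

definition equivariant_iso :: "('i \<Rightarrow> nat) \<Rightarrow> (complex^'i \<Rightarrow> complex^'i) \<Rightarrow> (complex^'i \<Rightarrow> complex^'i) \<Rightarrow> bool" where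
  "equivariant_iso w L L' \<longleftrightarrow> (\<forall>i. polyfn vcoords (\<lambda>x. L x $ i)) \<and> (\<forall>i. polyfn vcoords (\<lambda>x. L' x $ i)) \<and>
    (\<forall>x. L (L' x) = x) \<and> (\<forall>x. L' (L x) = x) \<and>
    (\<forall>t x. L (wact w t x) = wact w t (L x)) \<and> (\<forall>t x. L' (wact w t x) = wact w t (L' x))"

lemma equivariant_iso_sym: "equivariant_iso w L L' \<Longrightarrow> equivariant_iso w L' L"
  by (auto simp: equivariant_iso_def)

lemma polyfn_compose_vec:
  assumes "polyfn vcoords f" "\<And>i. polyfn C (\<lambda>x. L x $ i)"
  shows "polyfn C (\<lambda>x. f (L x))"
  by (rule polyfn_compose[OF assms(1)]) (use assms(2) in \<open>auto simp: vcoords_def\<close>)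

lemma whom_equivariant:
  assumes "whom w d f" "equivariant_iso w L L'"
  shows "whom w d (\<lambda>x. f (L x))"
  using assms unfolding whom_def equivariant_iso_def by (auto intro: polyfn_compose_vec)

lemma wopen_in_equivariant:
  assumes "wopen_in w X U" "equivariant_iso w L L'"
  shows "wopen_in w (L ` X) (L ` U)"
proof -
  obtain F where F: "\<forall>f\<in>F. \<exists>d. whom w d f" "U = X - {x. \<forall>f\<in>F. f x = 0}"
    using assms(1) by (auto simp: wopen_in_def)
  have inv: "L' (L x) = x" "L (L' x) = x" for x using assms(2) by (auto simp: equivariant_iso_def)
  show ?thesis
    unfolding wopen_in_def
  proof (intro exI[of _ "(\<lambda>f x. f (L' x)) ` F"] conjI)
    show "\<forall>f\<in>(\<lambda>f x. f (L' x)) ` F. \<exists>d. whom w d f"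
      using F(1) whom_equivariant[OF _ equivariant_iso_sym[OF assms(2)]] by blast
    show "L ` U = L ` X - {x. \<forall>f\<in>(\<lambda>f x. f (L' x)) ` F. f x = 0}"
      unfolding F(2) by (auto simp: inv)
  qed
qed

lemma wdense_equivariant:
  assumes "wdense w X U" "equivariant_iso w L L'"
  shows "wdense w (L ` X) (L ` U)"
  unfolding wdense_def
proof (intro conjI allI impI)
  show "L ` U \<subseteq> L ` X" using assms(1) by (auto simp: wdense_def)
  fix f d assume f: "whom w d f \<and> (\<forall>x\<in>L ` U. f x = 0)"
  then have "whom w d (\<lambda>x. f (L x))" "\<forall>x\<in>U. f (L x) = 0" using whom_equivariant[OF _ assms(2)] by auto
  then show "\<forall>x\<in>L ` X. f x = 0" using assms(1) unfolding wdense_def by blast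
qed

lemma wequiv_equivariant: "wequiv w x y \<Longrightarrow> equivariant_iso w L L' \<Longrightarrow> wequiv w (L x) (L y)"
  unfolding wequiv_def equivariant_iso_def by metis

lemma wmap_equivariant:
  assumes "wmap w w' \<Phi>" "equivariant_iso w L L'" "equivariant_iso w' K K'"
  shows "wmap w w' (\<lambda>x. K (\<Phi> (L' x)))"
proof -
  obtain e where e: "\<And>j. whom w (e * w' j) (\<lambda>x. \<Phi> x $ j)" using assms(1) by (auto simp: wmap_def)
  have act: "\<Phi> (wact w t x) = wact w' (t ^ e) (\<Phi> x)" if "t \<noteq> 0" for t x
    using e that unfolding whom_def by (simp add: vec_eq_iff wact_def power_mult)
  show ?thesis
    unfolding wmap_def whom_def
  proof (intro exI[of _ e] allI conjI impI)
    fix j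
    have "polyfn vcoords (\<lambda>x. \<Phi> (L' x) $ i)" for i
      using e assms(2) polyfn_compose_vec[of "\<lambda>x. \<Phi> x $ i" vcoords L'] by (auto simp: whom_def equivariant_iso_def)
    then show "polyfn vcoords (\<lambda>x. K (\<Phi> (L' x)) $ j)"
      using assms(3) polyfn_compose_vec[of "\<lambda>y. K y $ j" vcoords "\<lambda>x. \<Phi> (L' x)"] by (auto simp: equivariant_iso_def)
    fix t :: complex and x assume "t \<noteq> 0"
    then have "K (\<Phi> (L' (wact w t x))) = wact w' (t ^ e) (K (\<Phi> (L' x)))"
      using assms(2,3) act by (simp add: equivariant_iso_def)
    then show "K (\<Phi> (L' (wact w t x))) $ j = t ^ (e * w' j) * K (\<Phi> (L' x)) $ j"
      by (simp add: wact_def power_mult)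
  qed
qed

lemma birational_equivariant:
  assumes "birational w X w' Y" and L: "equivariant_iso w L L'" and K: "equivariant_iso w' K K'"
  shows "birational w (L ` X) w' (K ` Y)"
proof -
  obtain U V \<Phi> \<Psi> where b: "wopen_in w X U" "U \<noteq> {}" "wdense w X U" "wopen_in w' Y V" "V \<noteq> {}" "wdense w' Y V"
    "wmap w w' \<Phi>" "wmap w' w \<Psi>" "\<And>x. x \<in> U \<Longrightarrow> \<Phi> x \<in> V \<and> wequiv w (\<Psi> (\<Phi> x)) x"
    "\<And>y. y \<in> V \<Longrightarrow> \<Psi> y \<in> U \<and> wequiv w' (\<Phi> (\<Psi> y)) y"
    using assms(1) unfolding birational_def by blast
  have inv: "L' (L x) = x" "K' (K y) = y" for x y using L K by (auto simp: equivariant_iso_def)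
  show ?thesis
    unfolding birational_def
  proof (rule exI[of _ "L ` U"], rule exI[of _ "K ` V"], rule exI[of _ "\<lambda>x. K (\<Phi> (L' x))"],
      rule exI[of _ "\<lambda>y. L (\<Psi> (K' y))"], intro conjI ballI)
    fix x assume "x \<in> L ` U"
    then obtain u where u: "u \<in> U" "x = L u" by blast
    then show "K (\<Phi> (L' x)) \<in> K ` V" "wequiv w (L (\<Psi> (K' (K (\<Phi> (L' x)))))) x"
      using b(9)[OF u(1)] wequiv_equivariant[OF _ L] by (auto simp: inv)
  next
    fix y assume "y \<in> K ` V"
    then obtain v where v: "v \<in> V" "y = K v" by blast
    then show "L (\<Psi> (K' y)) \<in> L ` U" "wequiv w' (K (\<Phi> (L' (L (\<Psi> (K' y)))))) y"
      using b(10)[OF v(1)] wequiv_equivariant[OF _ K] by (auto simp: inv)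
  qed (use b wopen_in_equivariant[OF _ L] wopen_in_equivariant[OF _ K] wdense_equivariant[OF _ L]
      wdense_equivariant[OF _ K] wmap_equivariant[OF _ L K] wmap_equivariant[OF _ K L] in auto)
qed

section \<open>Moving an arbitrary plane to the coordinate plane\<close>

lemma matrix_with_columns:
  fixes p1 p2 p3 :: "complex^8"
  assumes ind: "\<forall>a b c. a *s p1 + b *s p2 + c *s p3 = 0 \<longrightarrow> a = 0 \<and> b = 0 \<and> c = 0"
  shows "\<exists>S :: complex^8^8. invertible S \<and> column 0 S = p1 \<and> column 1 S = p2 \<and> column 2 S = p3"
proof -
  have ne: "p1 \<noteq> p2" "p1 \<noteq> p3" "p2 \<noteq> p3"
    using ind[rule_format, of 1 "-1" 0] ind[rule_format, of 1 0 "-1"] ind[rule_format, of 0 1 "-1"] by auto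
  have indep: "vec.independent {p1, p2, p3}"
  proof (rule vec.independent_if_scalars_zero)
    fix f x assume f: "(\<Sum>x\<in>{p1, p2, p3}. f x *s x) = 0" and "x \<in> {p1, p2, p3}"
    have "f p1 *s p1 + f p2 *s p2 + f p3 *s p3 = 0" using f ne by (simp add: add.assoc)
    then show "f x = 0" using ind \<open>x \<in> {p1, p2, p3}\<close> by blast
  qed simp
  obtain B where B: "{p1, p2, p3} \<subseteq> B" "vec.independent B" "UNIV \<subseteq> vec.span B"
    by (rule vec.maximal_independent_subset_extend[OF subset_UNIV indep])
  have spB: "vec.span B = UNIV" using B(3) by blast
  have cB: "card B = 8"
    using vec.dim_span_eq_card_independent[OF B(2)] spB vec_dim_card[where 'n=8 and 'a=complex] by simp
  then have finB: "finite B" using card.infinite by fastforce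
  have "card (B - {p1, p2, p3}) = 5"
    using B(1) finB ne cB by (simp add: card_Diff_subset)
  moreover have "card (UNIV - {0, 1, 2} :: 8 set) = 5" by (simp add: card_Diff_subset)
  ultimately obtain e where e: "bij_betw e (UNIV - {0, 1, 2} :: 8 set) (B - {p1, p2, p3})"
    using finite_same_card_bij[of "UNIV - {0, 1, 2} :: 8 set" "B - {p1, p2, p3}"] finB by auto
  define c where "c j = (if j = 0 then p1 else if j = 1 then p2 else if j = 2 then p3 else e j)" for j
  define S :: "complex^8^8" where "S = (\<chi> i j. c j $ i)"
  have col: "column j S = c j" for j by (simp add: S_def column_def vec_eq_iff)
  have "B \<subseteq> columns S"
  proof
    fix v assume v: "v \<in> B"
    have "\<exists>j. c j = v"
    proof (cases "v \<in> {p1, p2, p3}")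
      case True
      then have "v = c 0 \<or> v = c 1 \<or> v = c 2" by (auto simp: c_def)
      then show ?thesis by blast
    next
      case False
      then obtain j where "j \<in> UNIV - {0, 1, 2}" "v = e j" using e v by (auto simp: bij_betw_def)
      then show ?thesis by (intro exI[of _ j]) (simp add: c_def)
    qed
    then show "v \<in> columns S" by (auto simp: columns_def col)
  qed
  then have "vec.span (columns S) = UNIV" using vec.span_mono[of B "columns S"] spB by blast
  then have "invertible S"
    unfolding invertible_right_inverse matrix_right_invertible_span_columns .
  then show ?thesis using col by (intro exI[of _ S]) (simp add: c_def)
qed

definition web_cong :: "complex^8^8 \<Rightarrow> complex^8^8^4 \<Rightarrow> complex^8^8^4" where
  "web_cong S Q = (\<chi> k. Finite_Cartesian_Product.transpose S ** Q $ k ** S)"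

lemma web_cong_entry: "web_cong S Q $ k $ i $ j = bl (Q $ k) (column i S) (column j S)"
  by (simp add: web_cong_def gram_entry)

lemma bl_cong: "bl (Finite_Cartesian_Product.transpose S ** A ** S) x y = bl A (S *v x) (S *v y)"
proof -
  have "bl (Finite_Cartesian_Product.transpose S ** A ** S) x y
      = (\<Sum>i\<in>UNIV. x $ i * (\<Sum>k\<in>UNIV. S $ k $ i * (A *v (S *v y)) $ k))"
  proof -
    have "(Finite_Cartesian_Product.transpose S *v u) $ i = (\<Sum>k\<in>UNIV. S $ k $ i * u $ k)" for u i
      by (simp add: matrix_vector_mult_def transpose_def)
    then show ?thesis unfolding bl_def matrix_vector_mul_assoc[symmetric] by simp
  qed
  also have "\<dots> = (\<Sum>k\<in>UNIV. \<Sum>i\<in>UNIV. S $ k $ i * x $ i * (A *v (S *v y)) $ k)"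
    by (subst sum.swap) (simp add: sum_distrib_left mult_ac)
  also have "\<dots> = bl A (S *v x) (S *v y)"
    unfolding bl_def by (simp add: matrix_vector_mult_def[of S x] sum_distrib_right)
  finally show ?thesis .
qed

lemma qf_cong: "qf (web_cong S Q $ k) x = qf (Q $ k) (S *v x)"
  by (simp add: web_cong_def qf_eq_bl bl_cong)

lemma pencil_cong: "pencil (web_cong S Q) l = Finite_Cartesian_Product.transpose S ** pencil Q l ** S"
  by (simp add: vec_eq_iff gram_entry pencil_nth web_cong_entry bl_pencil)

lemma web_cong_inverse:
  assumes "S' ** S = mat 1"
  shows "web_cong S (web_cong S' Q) = Q"
proof -
  have "Finite_Cartesian_Product.transpose S ** (Finite_Cartesian_Product.transpose S' ** A ** S') ** S
      = Finite_Cartesian_Product.transpose (S' ** S) ** A ** (S' ** S)" for A :: "complex^8^8"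
    by (simp add: matrix_transpose_mul matrix_mul_assoc)
  then show ?thesis by (simp add: web_cong_def vec_eq_iff assms transpose_mat)
qed

text \<open>A form vanishing on \<open>P\<close> has vanishing polarization on \<open>P\<close>, so
  in the basis given by the columns of \<open>S\<close> the corner block is zero. The converse pulls
  back along \<open>S'\<close>.\<close>

lemma webs_on_iff_frame_web:
  assumes inv: "S ** S' = mat 1" "S' ** S = mat 1"
    and col: "column 0 S = p1" "column 1 S = p2" "column 2 S = p3"
  shows "Q \<in> webs_on p1 p2 p3 \<longleftrightarrow> frame_web (web_cong S Q) \<and> (\<forall>l. pencil Q l = 0 \<longrightarrow> l = 0)"
proof -
  have comb: "S *v vec8 a b c 0 0 0 0 0 = a *s p1 + b *s p2 + c *s p3" for a b c
    unfolding matrix_mult_sum by (simp add: sum_8 col)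
  have sym: "\<forall>k. Finite_Cartesian_Product.transpose (Q $ k) = Q $ k" if F: "frame_web (web_cong S Q)"
  proof
    fix k
    define A where "A = web_cong S Q $ k"
    have "Finite_Cartesian_Product.transpose A = A" using F by (simp add: A_def frame_web_def in_frame_def)
    then have "Finite_Cartesian_Product.transpose (Finite_Cartesian_Product.transpose S' ** A ** S')
        = Finite_Cartesian_Product.transpose S' ** A ** S'"
      by (simp add: matrix_transpose_mul matrix_mul_assoc)
    moreover have "Q $ k = Finite_Cartesian_Product.transpose S' ** A ** S'"
      using arg_cong[OF web_cong_inverse[OF inv(1), of Q], of "\<lambda>Q. Q $ k"]
      by (simp add: A_def web_cong_def[of S' "web_cong S Q"])
    ultimately show "Finite_Cartesian_Product.transpose (Q $ k) = Q $ k" by simp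
  qed
  have zero: "\<forall>k a b c. qf (Q $ k) (a *s p1 + b *s p2 + c *s p3) = 0" if F: "frame_web (web_cong S Q)"
  proof (intro allI)
    fix k a b c
    have "qf (web_cong S Q $ k) (vec8 a b c 0 0 0 0 0) = 0"
      using in_frame_zero[OF frame_webD[OF F]] by (simp add: qf_def sum_8)
    then show "qf (Q $ k) (a *s p1 + b *s p2 + c *s p3) = 0" unfolding qf_cong comb .
  qed
  have frame: "frame_web (web_cong S Q)"
    if tr: "\<forall>k. Finite_Cartesian_Product.transpose (Q $ k) = Q $ k"
      and z: "\<forall>k a b c. qf (Q $ k) (a *s p1 + b *s p2 + c *s p3) = 0"
  proof (rule frame_webI)
    show "web_cong S Q $ k $ a $ b = web_cong S Q $ k $ b $ a" for k a b
      unfolding web_cong_entry using tr bl_commute by blast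
    fix k and a b :: 8 assume ab: "a \<in> Pidx" "b \<in> Pidx"
    define L where "L = {a *s p1 + b *s p2 + c *s p3 | a b c. True}"
    have inL: "column i S \<in> L" if "i \<in> Pidx" for i
    proof -
      have "p1 = 1 *s p1 + 0 *s p2 + 0 *s p3" "p2 = 0 *s p1 + 1 *s p2 + 0 *s p3" "p3 = 0 *s p1 + 0 *s p2 + 1 *s p3"
        by simp_all
      then have "p1 \<in> L" "p2 \<in> L" "p3 \<in> L" unfolding L_def by blast+
      then show ?thesis using that col by (auto simp: Pidx_def)
    qed
    have add: "u + v \<in> L" if uv: "u \<in> L" "v \<in> L" for u v
    proof -
      obtain a b c a' b' c' where "u = a *s p1 + b *s p2 + c *s p3" "v = a' *s p1 + b' *s p2 + c' *s p3"
        using uv unfolding L_def by blast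
      then have "u + v = (a + a') *s p1 + (b + b') *s p2 + (c + c') *s p3"
        by (simp add: vec_eq_iff algebra_simps)
      then show ?thesis unfolding L_def by blast
    qed
    have q0: "qf (Q $ k) u = 0" if "u \<in> L" for u using that z unfolding L_def by blast
    let ?u = "column a S" and ?v = "column b S"
    have "qf (Q $ k) (?u + ?v) = qf (Q $ k) ?u + qf (Q $ k) ?v + 2 * bl (Q $ k) ?u ?v"
      using bl_commute[of "Q $ k" ?v ?u] tr by (simp add: qf_eq_bl bl_bilinear)
    then show "web_cong S Q $ k $ a $ b = 0"
      unfolding web_cong_entry using q0 add inL ab by simp
  qed
  show ?thesis unfolding webs_on_def using sym zero frame by blast
qed

text \<open>The coordinate change multiplies the determinant of every member by the square of
  \<open>det S\<close>, so the double covers are matched by rescaling the last coordinate by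
  \<open>det S\<close>.\<close>

lemma birational_web_cong:
  assumes inv: "S ** S' = mat 1" "S' ** S = mat 1"
    and b: "birational (\<lambda>_. 1) (base_locus (web_cong S Q)) wZ (double_cover (web_cong S Q))"
  shows "birational (\<lambda>_. 1) (base_locus Q) wZ (double_cover Q)"
proof -
  have dS: "det S \<noteq> 0"
    using arg_cong[OF inv(1), of det] by (auto simp: det_mul)
  have SS: "S *v (S' *v x) = x" "S' *v (S *v x) = x" for x
    by (simp_all add: matrix_vector_mul_assoc inv)
  define K where "K c z = vec5 (z $ 0) (z $ 1) (z $ 2) (z $ 3) (c * z $ 4)" for c and z :: "complex^5"
  have Kpoly: "polyfn vcoords (\<lambda>z. K c z $ i)" for c i
    unfolding K_def vec5_def vec_lambda_beta by (intro polyfn_if polyfn_intros polyfn_vcoord)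
  have K: "equivariant_iso wZ (K (inverse (det S))) (K (det S))"
    unfolding equivariant_iso_def using Kpoly dS by (auto simp: K_def vec_eq_iff all_5)
  have L: "equivariant_iso (\<lambda>_. 1) (\<lambda>x. S *v x) (\<lambda>x. S' *v x)"
    unfolding equivariant_iso_def wact_one
    by (auto simp: SS mult_scale intro!: polyfn_mult_vec pf_const polyfn_vcoord)
  have "(\<lambda>x. S *v x) ` base_locus (web_cong S Q) = base_locus Q"
  proof (intro equalityI subsetI)
    fix x assume "x \<in> (\<lambda>x. S *v x) ` base_locus (web_cong S Q)"
    then obtain y where y: "x = S *v y" "y \<noteq> 0" "\<forall>k. qf (Q $ k) (S *v y) = 0" by (auto simp: base_locus_def qf_cong)
    have "x \<noteq> 0" using y(1,2) SS(2)[of y] by auto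
    then show "x \<in> base_locus Q" using y by (simp add: base_locus_def)
  next
    fix x assume x: "x \<in> base_locus Q"
    have "S' *v x \<noteq> 0" using x SS(1)[of x] by (auto simp: base_locus_def)
    then have "S' *v x \<in> base_locus (web_cong S Q)" using x by (simp add: base_locus_def qf_cong SS)
    then show "x \<in> (\<lambda>x. S *v x) ` base_locus (web_cong S Q)" using SS(1)[of x] by (metis imageI)
  qed
  moreover have "K (inverse (det S)) ` double_cover (web_cong S Q) = double_cover Q"
  proof -
    have dc: "z \<in> double_cover (web_cong S Q) \<longleftrightarrow> z \<noteq> 0 \<and> (z $ 4)\<^sup>2 = (det S)\<^sup>2 * det (pencil Q (zlam z))" for z
      by (simp add: double_cover_def pencil_cong det_mul power2_eq_square mult_ac)
    have zl: "zlam (K c z) = zlam z" for c z by (simp add: K_def vec_eq_iff all_4')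
    have K0: "K c z = 0 \<longleftrightarrow> z = 0" if "c \<noteq> 0" for c z
      using that by (simp add: K_def vec_eq_iff all_5)
    have K4: "K c z $ 4 = c * z $ 4" for c z by (simp add: K_def)
    have KK: "K (inverse (det S)) (K (det S) z) = z" for z using dS by (simp add: K_def vec_eq_iff all_5)
    show ?thesis
    proof (intro equalityI subsetI)
      fix z assume "z \<in> K (inverse (det S)) ` double_cover (web_cong S Q)"
      then obtain y where y: "z = K (inverse (det S)) y" "y \<noteq> 0" "(y $ 4)\<^sup>2 = (det S)\<^sup>2 * det (pencil Q (zlam y))"
        unfolding dc[abs_def] by (auto simp: dc)
      then show "z \<in> double_cover Q"
        using dS by (simp add: double_cover_def K0 K4 zl power_mult_distrib power_inverse)
    next
      fix z assume z: "z \<in> double_cover Q"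
      then have "K (det S) z \<in> double_cover (web_cong S Q)"
        using dS by (simp add: dc K0 K4 zl power_mult_distrib) (simp add: double_cover_def)
      then show "z \<in> K (inverse (det S)) ` double_cover (web_cong S Q)" using KK[of z] by (metis imageI)
    qed
  qed
  ultimately show ?thesis using birational_equivariant[OF b L K] by simp
qed

theorem mainTheorem1:
  fixes p1 p2 p3 :: "complex^8"
  assumes "\<forall>a b c. a *s p1 + b *s p2 + c *s p3 = 0 \<longrightarrow> a = 0 \<and> b = 0 \<and> c = 0"
  shows "\<exists>g. polyfn web_coords g \<and> (\<exists>Q\<in>webs_on p1 p2 p3. g Q \<noteq> 0) \<and>
           (\<forall>Q\<in>webs_on p1 p2 p3. g Q \<noteq> 0 \<longrightarrow>
              birational (\<lambda>_. 1) (base_locus Q) wZ (double_cover Q))"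
proof -
  obtain S :: "complex^8^8" where S: "invertible S" "column 0 S = p1" "column 1 S = p2" "column 2 S = p3"
    using matrix_with_columns[OF assms] by blast
  obtain S' where inv: "S ** S' = mat 1" "S' ** S = mat 1" using S(1) unfolding invertible_def by blast
  obtain g where g: "polyfn web_coords g"
    "\<exists>Q. frame_web Q \<and> (\<forall>l. pencil Q l = 0 \<longrightarrow> l = 0) \<and> g Q \<noteq> 0"
    "\<And>Q. frame_web Q \<Longrightarrow> g Q \<noteq> 0 \<Longrightarrow> birational (\<lambda>_. 1) (base_locus Q) wZ (double_cover Q)"
    using generic_birational_frame by blast
  have iff: "Q \<in> webs_on p1 p2 p3 \<longleftrightarrow> frame_web (web_cong S Q) \<and> (\<forall>l. pencil Q l = 0 \<longrightarrow> l = 0)" for Q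
    using webs_on_iff_frame_web[OF inv S(2-4)] .
  have "polyfn web_coords (\<lambda>Q. g (web_cong S Q))"
  proof (rule polyfn_compose[OF g(1)])
    fix c assume "c \<in> web_coords"
    then obtain k a b where "c = (\<lambda>Q. Q $ k $ a $ b)" by (auto simp: web_coords_def)
    then show "polyfn web_coords (\<lambda>Q. c (web_cong S Q))"
      unfolding web_cong_entry by (auto intro!: polyfn_bl polyfn_web_coord pf_const simp: web_cong_entry)
  qed
  moreover have "\<exists>Q\<in>webs_on p1 p2 p3. g (web_cong S Q) \<noteq> 0"
  proof -
    obtain Q where Q: "frame_web Q" "\<forall>l. pencil Q l = 0 \<longrightarrow> l = 0" "g Q \<noteq> 0" using g(2) by blast
    \<comment> \<open>The witness is moved back by \<open>S'\<close>, so that the congruence by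
      \<open>S\<close> returns the good frame web.\<close>
    have eq: "web_cong S (web_cong S' Q) = Q" by (rule web_cong_inverse[OF inv(2)])
    have "l = 0" if "pencil (web_cong S' Q) l = 0" for l
    proof -
      have "pencil Q l = Finite_Cartesian_Product.transpose S ** pencil (web_cong S' Q) l ** S"
        using pencil_cong[of S "web_cong S' Q" l] by (simp add: eq)
      then have "pencil Q l = 0" unfolding that by (simp add: matrix_matrix_mult_def vec_eq_iff)
      then show ?thesis using Q(2) by blast
    qed
    then have "web_cong S' Q \<in> webs_on p1 p2 p3" using Q(1) by (simp add: iff eq)
    then show ?thesis using Q(3) eq by (intro bexI[of _ "web_cong S' Q"]) auto
  qed
  moreover have "birational (\<lambda>_. 1) (base_locus Q) wZ (double_cover Q)"
    if "Q \<in> webs_on p1 p2 p3" "g (web_cong S Q) \<noteq> 0" for Q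
    using birational_web_cong[OF inv g(3)] that iff by blast
  ultimately show ?thesis by blast
qed

end
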